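(* Let $F$ be a surface in $\mathbb{R}^3$ which has deformation preserving the Möbius metric and the ratio of principal curvatures. Then the deformation is given by $$e^{\omega}\to|\lambda|^2e^{\omega},\qquad H\to\frac{1}{|\lambda|}H,\qquad Q\to\lambda Q,$$ where $\lambda$ is a function with $|\lambda|=|f|$ for some holomorphic function $f$. Moreover, if $|\lambda|=1$ (respectively $\lambda$ is holomorphic), then $F$ is a Bonnet surface (respectively a HIMC surface).
   Context: A surface in Euclidean $3$-space $\mathbb{R}^3$ is a conformal immersion $F:M\to\mathbb{R}^3$ of a Riemann surface $M$. Let $n$ be its unit normal, $z$ a local complex coordinate on $M$, and $\mathrm{I}=e^{\omega}dz\,d\bar z$ its first fundamental form. $H$ denotes the mean curvature and $K$ the Gaussian curvature. The (metrical) Hopf differential is $Q\,dz^2$ with $Q=\langle F_{zz},n\rangle$. The Möbius metric of $F$ is the (possibly singular) metric $\mathrm{I}_{\mathcal{M}}=(H^2-K)\,\mathrm{I}=4|Q|^2e^{-\omega}dz\,d\bar z$ on $M$. The ratio of principal curvatures is the quotient of the two principal curvatures of the surface; it is a similarity invariant, as is the function $K/H^2$. A deformation of $F$ passes from $F$ to other conformally immersed surfaces $M\to\mathbb{R}^3$. It preserves the Möbius metric and the ratio of principal curvatures if these are the same for the deformed surfaces as for $F$. The arrows in the claim indicate how the data $(e^{\omega},H,Q)$ of $F$ change into those of the deformed surface; the function $\lambda$ is complex-valued. A Bonnet surface is a surface in $\mathbb{R}^3$ which admits a non-trivial one-parameter family of isometric deformations preserving the mean curvature. A HIMC surface (surface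 with harmonic inverse mean curvature) is a surface in $\mathbb{R}^3$ whose inverse mean curvature function $1/H$ is a harmonic function on $M$.
   Formalization: Umbilic points are assumed nowhere dense (round spheres are counterexamples); f exists on simply connected open sets; in the last part the deformation (for Bonnet, a smooth one-parameter family) is not by similarities only, and F is not minimal in the HIMC case. *)

theory Defs
  imports "HOL-Complex_Analysis.Complex_Analysis"
begin

section \<open>Smooth maps\<close>

text \<open>Intended for open \<open>U\<close> only.\<close>

primrec Ck_on :: "nat \<Rightarrow> ('a::euclidean_space \<Rightarrow> 'b::real_normed_vector) \<Rightarrow> 'a set \<Rightarrow> bool" where
  "Ck_on 0 f U \<longleftrightarrow> continuous_on U f"
| "Ck_on (Suc k) f U \<longleftrightarrow>
     f differentiable_on U \<and> (\<forall>b\<in>Basis. Ck_on k (\<lambda>x. frechet_derivative f (at x) b) U)"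

definition smooth_on :: "('a::euclidean_space \<Rightarrow> 'b::real_normed_vector) \<Rightarrow> 'a set \<Rightarrow> bool" where
  "smooth_on f U \<longleftrightarrow> (\<forall>k. Ck_on k f U)"

definition pderiv_dir :: "(complex \<Rightarrow> 'b::real_normed_vector) \<Rightarrow> complex \<Rightarrow> complex \<Rightarrow> 'b" where
  "pderiv_dir f v z = frechet_derivative f (at z) v"

text \<open>The Wirtinger derivative \<open>f\<^sub>z\<close>.\<close>

definition wirtinger :: "(complex \<Rightarrow> complex) \<Rightarrow> complex \<Rightarrow> complex" where
  "wirtinger f z = (pderiv_dir f 1 z - \<i> * pderiv_dir f \<i> z) / 2"

definition harmonic_on :: "(complex \<Rightarrow> real) \<Rightarrow> complex set \<Rightarrow> bool" where
  "harmonic_on u U \<longleftrightarrow> Ck_on 2 u U \<and>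
     (\<forall>z\<in>U. pderiv_dir (pderiv_dir u 1) 1 z + pderiv_dir (pderiv_dir u \<i>) \<i> z = 0)"

section \<open>Riemann surfaces\<close>

text \<open>A chart of \<open>M\<close> is a pair of its domain and its coordinate map. The maximality of the atlas
  is not required; every notion below is independent of the charts used to express it.\<close>

type_synonym 'm chart = "'m set \<times> ('m \<Rightarrow> complex)"

definition chart_dom :: "'m chart \<Rightarrow> 'm set" where
  "chart_dom c = fst c"

definition coord :: "'m chart \<Rightarrow> 'm \<Rightarrow> complex" where
  "coord c = snd c"

definition coord_inv :: "'m chart \<Rightarrow> complex \<Rightarrow> 'm" where
  "coord_inv c = inv_into (chart_dom c) (coord c)"

definition chart_img :: "'m chart \<Rightarrow> complex set" where
  "chart_img c = coord c ` chart_dom c"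

definition in_chart :: "'m chart \<Rightarrow> ('m \<Rightarrow> 'b) \<Rightarrow> complex \<Rightarrow> 'b" where
  "in_chart c f = f \<circ> coord_inv c"

definition riemann_surface :: "'m::t2_space set \<Rightarrow> 'm chart set \<Rightarrow> bool" where
  "riemann_surface M A \<longleftrightarrow>
     M \<noteq> {} \<and> connected M \<and> \<Union> (chart_dom ` A) = M \<and>
     (\<forall>c\<in>A. openin (top_of_set M) (chart_dom c) \<and> open (chart_img c) \<and>
            homeomorphism (chart_dom c) (chart_img c) (coord c) (coord_inv c)) \<and>
     (\<forall>c\<in>A. \<forall>d\<in>A. in_chart c (coord d) holomorphic_on coord c ` (chart_dom c \<inter> chart_dom d))"

definition holomorphic_fun :: "'m chart set \<Rightarrow> 'm set \<Rightarrow> ('m \<Rightarrow> complex) \<Rightarrow> bool" where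
  "holomorphic_fun A V f \<longleftrightarrow> (\<forall>c\<in>A. in_chart c f holomorphic_on coord c ` (chart_dom c \<inter> V))"

section \<open>Surface geometry in a coordinate\<close>

text \<open>Here \<open>X\<close> is the surface expressed in a coordinate \<open>z = x + \<i>y\<close>. The unit normal is the one
  determined by the orientation of the Riemann surface, so it does not depend on the coordinate.\<close>

definition first_form :: "(complex \<Rightarrow> real^3) \<Rightarrow> complex \<Rightarrow> complex \<Rightarrow> complex \<Rightarrow> real" where
  "first_form X z v w = pderiv_dir X v z \<bullet> pderiv_dir X w z"

definition unit_normal :: "(complex \<Rightarrow> real^3) \<Rightarrow> complex \<Rightarrow> real^3" where
  "unit_normal X z = sgn (cross3 (pderiv_dir X 1 z) (pderiv_dir X \<i> z))"

definition second_form :: "(complex \<Rightarrow> real^3) \<Rightarrow> complex \<Rightarrow> complex \<Rightarrow> complex \<Rightarrow> real" where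
  "second_form X z v w = pderiv_dir (pderiv_dir X v) w z \<bullet> unit_normal X z"

text \<open>The function \<open>e\<^sup>\<omega>\<close> in \<open>I = e\<^sup>\<omega> dz d\<zbar>\<close>, where \<open>dz d\<zbar> = dx\<^sup>2 + dy\<^sup>2\<close>.\<close>

definition conf_factor :: "(complex \<Rightarrow> real^3) \<Rightarrow> complex \<Rightarrow> real" where
  "conf_factor X z = first_form X z 1 1"

definition conformal_at :: "(complex \<Rightarrow> real^3) \<Rightarrow> complex \<Rightarrow> bool" where
  "conformal_at X z \<longleftrightarrow> (\<exists>\<rho>>0. \<forall>v w. first_form X z v w = \<rho> * (v \<bullet> w))"

definition mean_curv :: "(complex \<Rightarrow> real^3) \<Rightarrow> complex \<Rightarrow> real" where
  "mean_curv X z =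
     (first_form X z 1 1 * second_form X z \<i> \<i> - 2 * first_form X z 1 \<i> * second_form X z 1 \<i>
        + first_form X z \<i> \<i> * second_form X z 1 1)
     / (2 * (first_form X z 1 1 * first_form X z \<i> \<i> - (first_form X z 1 \<i>)\<^sup>2))"

definition gauss_curv :: "(complex \<Rightarrow> real^3) \<Rightarrow> complex \<Rightarrow> real" where
  "gauss_curv X z =
     (second_form X z 1 1 * second_form X z \<i> \<i> - (second_form X z 1 \<i>)\<^sup>2)
     / (first_form X z 1 1 * first_form X z \<i> \<i> - (first_form X z 1 \<i>)\<^sup>2)"

text \<open>The coefficient \<open>Q = \<langle>F\<^sub>z\<^sub>z, n\<rangle>\<close> of the Hopf differential, with the inner product extended
  complex bilinearly.\<close>

definition hopf :: "(complex \<Rightarrow> real^3) \<Rightarrow> complex \<Rightarrow> complex" where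
  "hopf X z = (\<Sum>j\<in>UNIV. wirtinger (wirtinger (\<lambda>w. complex_of_real (X w $ j))) z
                            * complex_of_real (unit_normal X z $ j))"

text \<open>The coefficient of \<open>dz d\<zbar>\<close> in the Moebius metric \<open>(H\<^sup>2 - K) I\<close>. It vanishes exactly at
  the umbilic points.\<close>

definition moebius_factor :: "(complex \<Rightarrow> real^3) \<Rightarrow> complex \<Rightarrow> real" where
  "moebius_factor X z = ((mean_curv X z)\<^sup>2 - gauss_curv X z) * conf_factor X z"

text \<open>Principal curvatures are the eigenvalues of the second fundamental form relative to the
  first one.\<close>

definition principal_curvs :: "(complex \<Rightarrow> real^3) \<Rightarrow> complex \<Rightarrow> real set" where
  "principal_curvs X z =
     {k. \<exists>v. v \<noteq> 0 \<and> (\<forall>w. second_form X z v w = k * first_form X z v w)}"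

definition max_curv :: "(complex \<Rightarrow> real^3) \<Rightarrow> complex \<Rightarrow> real" where
  "max_curv X z = Max (principal_curvs X z)"

definition min_curv :: "(complex \<Rightarrow> real^3) \<Rightarrow> complex \<Rightarrow> real" where
  "min_curv X z = Min (principal_curvs X z)"

section \<open>Surfaces, deformations, Bonnet and HIMC surfaces\<close>

definition conformal_immersion :: "'m chart set \<Rightarrow> ('m \<Rightarrow> real^3) \<Rightarrow> bool" where
  "conformal_immersion A F \<longleftrightarrow>
     (\<forall>c\<in>A. smooth_on (in_chart c F) (chart_img c) \<and>
            (\<forall>z\<in>chart_img c. conformal_at (in_chart c F) z))"

definition non_umbilic_points :: "'m chart set \<Rightarrow> ('m \<Rightarrow> real^3) \<Rightarrow> 'm set" where
  "non_umbilic_points A F =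
     {p. \<exists>c\<in>A. p \<in> chart_dom c \<and> moebius_factor (in_chart c F) (coord c p) \<noteq> 0}"

definition same_moebius_metric :: "'m chart set \<Rightarrow> ('m \<Rightarrow> real^3) \<Rightarrow> ('m \<Rightarrow> real^3) \<Rightarrow> bool" where
  "same_moebius_metric A F G \<longleftrightarrow>
     (\<forall>c\<in>A. \<forall>z\<in>chart_img c. moebius_factor (in_chart c G) z = moebius_factor (in_chart c F) z)"

text \<open>Equality of the ratios (maximal : minimal) of principal curvatures, cross-multiplied because
  one of the two may vanish. At a point where both principal curvatures of \<open>F\<close> or of \<open>G\<close> vanish
  the ratio is undefined and the equation holds trivially.\<close>

definition same_curv_ratio :: "'m chart set \<Rightarrow> ('m \<Rightarrow> real^3) \<Rightarrow> ('m \<Rightarrow> real^3) \<Rightarrow> bool" where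
  "same_curv_ratio A F G \<longleftrightarrow>
     (\<forall>c\<in>A. \<forall>z\<in>chart_img c.
        max_curv (in_chart c G) z * min_curv (in_chart c F) z =
        max_curv (in_chart c F) z * min_curv (in_chart c G) z)"

definition isometric_to :: "'m chart set \<Rightarrow> ('m \<Rightarrow> real^3) \<Rightarrow> ('m \<Rightarrow> real^3) \<Rightarrow> bool" where
  "isometric_to A F G \<longleftrightarrow>
     (\<forall>c\<in>A. \<forall>z\<in>chart_img c. \<forall>v w.
        first_form (in_chart c G) z v w = first_form (in_chart c F) z v w)"

definition same_mean_curv :: "'m chart set \<Rightarrow> ('m \<Rightarrow> real^3) \<Rightarrow> ('m \<Rightarrow> real^3) \<Rightarrow> bool" where
  "same_mean_curv A F G \<longleftrightarrow>
     (\<forall>c\<in>A. \<forall>z\<in>chart_img c. mean_curv (in_chart c G) z = mean_curv (in_chart c F) z)"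

definition similar_surfaces :: "'m set \<Rightarrow> ('m \<Rightarrow> real^3) \<Rightarrow> ('m \<Rightarrow> real^3) \<Rightarrow> bool" where
  "similar_surfaces M F G \<longleftrightarrow>
     (\<exists>r>0. \<exists>B b. orthogonal_transformation B \<and> (\<forall>p\<in>M. G p = r *\<^sub>R B (F p) + b))"

definition congruent_surfaces :: "'m set \<Rightarrow> ('m \<Rightarrow> real^3) \<Rightarrow> ('m \<Rightarrow> real^3) \<Rightarrow> bool" where
  "congruent_surfaces M F G \<longleftrightarrow>
     (\<exists>B b. orthogonal_transformation B \<and> (\<forall>p\<in>M. G p = B (F p) + b))"

text \<open>The surface \<open>G\<close> is a deformation of \<open>F\<close> preserving the Moebius metric and the ratio of
  principal curvatures.\<close>

definition preserving_deformation :: "'m chart set \<Rightarrow> ('m \<Rightarrow> real^3) \<Rightarrow> ('m \<Rightarrow> real^3) \<Rightarrow> bool" where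
  "preserving_deformation A F G \<longleftrightarrow>
     conformal_immersion A G \<and> same_moebius_metric A F G \<and> same_curv_ratio A F G"

text \<open>A one-parameter family of conformal immersions through \<open>F\<close>, smooth in the parameter and the
  point jointly.\<close>

definition one_parameter_family ::
    "'m set \<Rightarrow> 'm chart set \<Rightarrow> ('m \<Rightarrow> real^3) \<Rightarrow> real set \<Rightarrow> (real \<Rightarrow> 'm \<Rightarrow> real^3) \<Rightarrow> bool" where
  "one_parameter_family M A F T \<Phi> \<longleftrightarrow>
     open T \<and> is_interval T \<and> 0 \<in> T \<and> (\<forall>p\<in>M. \<Phi> 0 p = F p) \<and>
     (\<forall>t\<in>T. conformal_immersion A (\<Phi> t)) \<and>
     (\<forall>c\<in>A. smooth_on (\<lambda>(t, z). in_chart c (\<Phi> t) z) (T \<times> chart_img c))"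

text \<open>The data change by \<open>e\<^sup>\<omega> \<rightarrow> |\<lambda>|\<^sup>2 e\<^sup>\<omega>\<close>, \<open>H \<rightarrow> H / |\<lambda>|\<close>, \<open>Q \<rightarrow> \<lambda> Q\<close>
  from \<open>F\<close> to \<open>G\<close>.\<close>

definition deformed_by ::
    "'m chart set \<Rightarrow> ('m \<Rightarrow> real^3) \<Rightarrow> ('m \<Rightarrow> real^3) \<Rightarrow> ('m \<Rightarrow> complex) \<Rightarrow> bool" where
  "deformed_by A F G lam \<longleftrightarrow>
     (\<forall>c\<in>A. \<forall>z\<in>chart_img c.
        conf_factor (in_chart c G) z = (cmod (in_chart c lam z))\<^sup>2 * conf_factor (in_chart c F) z \<and>
        mean_curv (in_chart c G) z = 1 / cmod (in_chart c lam z) * mean_curv (in_chart c F) z \<and>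
        hopf (in_chart c G) z = in_chart c lam z * hopf (in_chart c F) z)"

definition bonnet_surface :: "'m set \<Rightarrow> 'm chart set \<Rightarrow> ('m \<Rightarrow> real^3) \<Rightarrow> bool" where
  "bonnet_surface M A F \<longleftrightarrow>
     conformal_immersion A F \<and>
     (\<exists>T \<Phi>. one_parameter_family M A F T \<Phi> \<and>
        (\<forall>t\<in>T. isometric_to A F (\<Phi> t) \<and> same_mean_curv A F (\<Phi> t)) \<and>
        (\<exists>t\<in>T. \<not> congruent_surfaces M F (\<Phi> t)))"

definition minimal_surface :: "'m chart set \<Rightarrow> ('m \<Rightarrow> real^3) \<Rightarrow> bool" where
  "minimal_surface A F \<longleftrightarrow> (\<forall>c\<in>A. \<forall>z\<in>chart_img c. mean_curv (in_chart c F) z = 0)"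

definition himc_surface :: "'m chart set \<Rightarrow> ('m \<Rightarrow> real^3) \<Rightarrow> bool" where
  "himc_surface A F \<longleftrightarrow>
     conformal_immersion A F \<and>
     (\<forall>c\<in>A. (\<forall>z\<in>chart_img c. mean_curv (in_chart c F) z \<noteq> 0) \<and>
            harmonic_on (\<lambda>z. 1 / mean_curv (in_chart c F) z) (chart_img c))"

end

theory Submission
  imports Defs
begin

text \<open>
  Write \<open>\<rho> = e\<^sup>\<omega>\<close>. The principal curvatures are \<open>H + s\<close> and \<open>H - s\<close> with \<open>s = 2|Q|/\<rho>\<close>, and the
  Moebius metric is \<open>s\<^sup>2 \<rho> dz d\<zbar>\<close>. Put \<open>m = sqrt (\<rho>'/\<rho>)\<close>, where primes denote the data of the deformed
  surface. Equality of the Moebius metrics gives \<open>s' = s/m\<close> and \<open>|Q'| = m |Q|\<close>; equality of the ratios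
  gives \<open>s' H = s H'\<close>, hence \<open>H' = H/m\<close> wherever \<open>s \<noteq> 0\<close>, and everywhere because the umbilic points have
  dense complement. So \<open>\<lambda> = Q'/Q\<close>, completed by \<open>m\<close> at the umbilic points, is the required factor; it does
  not depend on the chart since \<open>Q\<close> and \<open>\<rho>\<close> are multiplied by \<open>\<phi>'\<^sup>2\<close> and \<open>|\<phi>'|\<^sup>2\<close> under a change of coordinate.

  The data \<open>H\<^sup>2 \<rho>\<close> and \<open>(H\<^sup>2 - K) \<rho>\<close> are the same for both surfaces, so \<open>K \<rho>\<close> is too. The Gauss equation
  \<open>\<Delta> log \<rho> = -2 K \<rho>\<close> then shows that \<open>log |\<lambda>|\<close> is harmonic (\<open>harmonic_log_ratio\<close>). Locally it is the real
  part of a holomorphic function, and \<open>|\<lambda>|\<close> is the modulus of the exponential of that function. Two such local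
  functions differ by a locally constant unimodular factor, so they are the sheets of a covering, and
  over a simply connected set there is a global one (\<open>global_section\<close>, \<open>modulus_global\<close>).

  If \<open>|\<lambda>| = 1\<close>, the deformation preserves \<open>\<rho>\<close> and \<open>H\<close>, and a deformed surface that is not similar to \<open>F\<close> is
  not congruent to it.

  If \<open>\<lambda>\<close> is holomorphic, write \<open>\<lambda> = 1/k\<^sup>2\<close> on a coordinate disc. Comparing the Codazzi equations
  \<open>2 Q\<^sub>\<zbar> = \<rho> H\<^sub>z\<close> of both surfaces yields \<open>(H Im k)\<^sub>z = 0\<close> (\<open>mean_curv_times_Im_constant\<close>), so \<open>H Im k = b\<close> for a real
  constant \<open>b\<close>. If \<open>b \<noteq> 0\<close>, then \<open>H\<close> has no zero and \<open>1/H = Im (k/b)\<close> is harmonic. Whether \<open>b\<close> vanishes can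
  be read off at every point, \<open>b = 0\<close> being equivalent to \<open>H = 0 \<or> \<lambda> > 0\<close>, so it vanishes on all discs or on
  none. On a surface that is not minimal, \<open>b = 0\<close> throughout would make \<open>\<lambda>\<close> positive on some disc, hence
  constant, and then both surfaces would have proportional fundamental forms and be similar
  (\<open>positive_constant_imp_similar\<close>).
\<close>

section \<open>Monodromy for local sections\<close>

text \<open>The sheets of a covering of \<open>V\<close> with fibre \<open>E x\<close> over \<open>x\<close>, given by their sections. The topology
  of the total space is encoded in the sheets: \<open>dichotomy\<close> says that the sheets are open and separated from each other,
  and \<open>even\<close> that \<open>V\<close> is evenly covered, by path-connected sets because the section over \<open>V\<close> is
  constructed along paths.\<close>
locale local_sections =
  fixes V :: "'m::topological_space set"
    and P :: "('m set \<times> ('m \<Rightarrow> 'b)) set"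
    and E :: "'m \<Rightarrow> 'b set"
  assumes fibre: "\<And>W g x. (W, g) \<in> P \<Longrightarrow> x \<in> W \<Longrightarrow> g x \<in> E x"
    and dichotomy: "\<And>W g W' g' x. (W, g) \<in> P \<Longrightarrow> (W', g') \<in> P \<Longrightarrow> x \<in> W \<inter> W' \<Longrightarrow>
          \<exists>N. openin (top_of_set V) N \<and> x \<in> N \<and> N \<subseteq> W \<inter> W' \<and>
              ((\<forall>y\<in>N. g y = g' y) \<or> (\<forall>y\<in>N. g y \<noteq> g' y))"
    and even: "\<And>x. x \<in> V \<Longrightarrow> \<exists>W. openin (top_of_set V) W \<and> x \<in> W \<and> path_connected W \<and>
          (\<forall>y\<in>W. \<forall>v\<in>E y. \<exists>g. (W, g) \<in> P \<and> g y = v)"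
begin

text \<open>A map into the covering space over \<open>\<gamma>\<close> that is continuous for the topology given by the sheets.\<close>
definition lift :: "'s::topological_space set \<Rightarrow> ('s \<Rightarrow> 'm) \<Rightarrow> ('s \<Rightarrow> 'b) \<Rightarrow> bool" where
  "lift S \<gamma> h \<longleftrightarrow> (\<forall>s\<in>S. \<exists>W g N. (W, g) \<in> P \<and> openin (top_of_set S) N \<and> s \<in> N \<and>
                      (\<forall>t\<in>N. \<gamma> t \<in> W \<and> h t = g (\<gamma> t)))"

lemma lift_obtain:
  assumes "lift S \<gamma> h" "s \<in> S"
  obtains W g N where "(W, g) \<in> P" "open N" "s \<in> N" "\<forall>t\<in>S \<inter> N. \<gamma> t \<in> W \<and> h t = g (\<gamma> t)"
proof -
  obtain W g N where *: "(W, g) \<in> P" "openin (top_of_set S) N" "s \<in> N"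
      "\<forall>t\<in>N. \<gamma> t \<in> W \<and> h t = g (\<gamma> t)"
    using assms unfolding lift_def by blast
  obtain T where T: "open T" "N = S \<inter> T" using *(2) unfolding openin_open by blast
  show thesis by (rule that[OF *(1) T(1)]) (use * T in auto)
qed

lemma lift_in_fibre: "lift S \<gamma> h \<Longrightarrow> s \<in> S \<Longrightarrow> h s \<in> E (\<gamma> s)"
  unfolding lift_def using fibre by metis

lemma lift_compose:
  assumes "lift S \<gamma> h" "continuous_on T k" "k ` T \<subseteq> S"
  shows "lift T (\<lambda>t. \<gamma> (k t)) (\<lambda>t. h (k t))"
  unfolding lift_def
proof
  fix t assume "t \<in> T"
  then have "k t \<in> S" using assms(3) by auto
  then obtain W g N where *: "(W, g) \<in> P" "openin (top_of_set S) N" "k t \<in> N"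
      "\<forall>t\<in>N. \<gamma> t \<in> W \<and> h t = g (\<gamma> t)"
    using assms(1) unfolding lift_def by blast
  have "openin (top_of_set T) (T \<inter> k -` N)"
    using continuous_openin_preimage[OF assms(2) _ *(2)] assms(3) by auto
  then show "\<exists>W g N. (W, g) \<in> P \<and> openin (top_of_set T) N \<and> t \<in> N \<and>
                 (\<forall>t\<in>N. \<gamma> (k t) \<in> W \<and> h (k t) = g (\<gamma> (k t)))"
    using * \<open>t \<in> T\<close> by (intro exI[of _ W] exI[of _ g] exI[of _ "T \<inter> k -` N"]) auto
qed

lemma lift_cong:
  assumes "lift S \<gamma> h" "\<And>s. s \<in> S \<Longrightarrow> \<gamma> s = \<gamma>' s" "\<And>s. s \<in> S \<Longrightarrow> h s = h' s"
  shows "lift S \<gamma>' h'"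
  unfolding lift_def
proof
  fix s assume "s \<in> S"
  then obtain W g N where *: "(W, g) \<in> P" "openin (top_of_set S) N" "s \<in> N"
      "\<forall>t\<in>N. \<gamma> t \<in> W \<and> h t = g (\<gamma> t)"
    using assms(1) unfolding lift_def by blast
  have "N \<subseteq> S" using *(2) openin_imp_subset by blast
  then have "\<forall>t\<in>N. \<gamma>' t \<in> W \<and> h' t = g (\<gamma>' t)" using *(4) assms(2,3) by (metis subsetD)
  with * show "\<exists>W g N. (W, g) \<in> P \<and> openin (top_of_set S) N \<and> s \<in> N \<and>
                 (\<forall>t\<in>N. \<gamma>' t \<in> W \<and> h' t = g (\<gamma>' t))" by blast
qed

lemma lift_subset: "lift S \<gamma> h \<Longrightarrow> T \<subseteq> S \<Longrightarrow> lift T \<gamma> h"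
  using lift_compose[of S \<gamma> h T "\<lambda>x. x"] by auto

lemma lift_section: "(W, g) \<in> P \<Longrightarrow> \<gamma> ` S \<subseteq> W \<Longrightarrow> lift S \<gamma> (\<lambda>s. g (\<gamma> s))"
  unfolding lift_def by (metis image_subset_iff openin_subtopology_self)

text \<open>The set on which two lifts agree is open and closed, by \<open>dichotomy\<close>.\<close>
lemma lift_unique:
  assumes "connected S" "continuous_on S \<gamma>" "\<gamma> ` S \<subseteq> V"
    and h: "lift S \<gamma> h" and h': "lift S \<gamma> h'"
    and "a \<in> S" "h a = h' a" "b \<in> S"
  shows "h b = h' b"
proof -
  have "(\<lambda>s. h s = h' s) constant_on S"
  proof (rule locally_constant_imp_constant[OF assms(1)])
    fix s assume s: "s \<in> S"
    obtain W g N where 1: "(W, g) \<in> P" "openin (top_of_set S) N" "s \<in> N"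
      "\<forall>t\<in>N. \<gamma> t \<in> W \<and> h t = g (\<gamma> t)" using h s unfolding lift_def by blast
    obtain W' g' N' where 2: "(W', g') \<in> P" "openin (top_of_set S) N'" "s \<in> N'"
      "\<forall>t\<in>N'. \<gamma> t \<in> W' \<and> h' t = g' (\<gamma> t)" using h' s unfolding lift_def by blast
    obtain O' where 3: "openin (top_of_set V) O'" "\<gamma> s \<in> O'"
      "(\<forall>y\<in>O'. g y = g' y) \<or> (\<forall>y\<in>O'. g y \<noteq> g' y)"
      using dichotomy[OF 1(1) 2(1), of "\<gamma> s"] 1 2 by auto
    have o: "openin (top_of_set S) (S \<inter> \<gamma> -` O')"
      using continuous_openin_preimage[OF assms(2) _ 3(1)] assms(3) by auto
    have "openin (top_of_set S) (N \<inter> N' \<inter> (S \<inter> \<gamma> -` O'))"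
      by (rule openin_Int[OF openin_Int[OF 1(2) 2(2)] o])
    moreover have "\<forall>t \<in> N \<inter> N' \<inter> (S \<inter> \<gamma> -` O'). (h t = h' t) = (h s = h' s)"
      using 1 2 3 by auto
    ultimately show "\<exists>T. openin (top_of_set S) T \<and> s \<in> T \<and> (\<forall>t\<in>T. (h t = h' t) = (h s = h' s))"
      using 1(3) 2(3) 3(2) s by blast
  qed
  then show ?thesis using assms(6-8) unfolding constant_on_def by blast
qed

lemma lift_glue:
  assumes "continuous_on (S1 \<union> S2) \<gamma>" "\<gamma> ` (S1 \<union> S2) \<subseteq> V" "closed S1" "closed S2"
    and h1: "lift S1 \<gamma> h1" and h2: "lift S2 \<gamma> h2"
    and agree: "\<And>s. s \<in> S1 \<inter> S2 \<Longrightarrow> h1 s = h2 s"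
  shows "lift (S1 \<union> S2) \<gamma> (\<lambda>s. if s \<in> S1 then h1 s else h2 s)"
  unfolding lift_def
proof
  let ?S = "S1 \<union> S2" and ?h = "\<lambda>s. if s \<in> S1 then h1 s else h2 s"
  fix s assume s: "s \<in> ?S"
  consider "s \<in> S1 - S2" | "s \<in> S2 - S1" | "s \<in> S1 \<inter> S2" using s by blast
  then show "\<exists>W g N. (W, g) \<in> P \<and> openin (top_of_set ?S) N \<and> s \<in> N \<and>
                (\<forall>t\<in>N. \<gamma> t \<in> W \<and> ?h t = g (\<gamma> t))"
  proof cases
    case 1
    then have s12: "s \<in> S1" by blast
    obtain W g N where *: "(W, g) \<in> P" "open N" "s \<in> N"
      "\<forall>t\<in>S1 \<inter> N. \<gamma> t \<in> W \<and> h1 t = g (\<gamma> t)"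
      by (rule lift_obtain[OF h1 s12])
    have "openin (top_of_set ?S) (?S \<inter> (N \<inter> - S2))"
      using *(2) assms(4) by (intro openin_open_Int open_Int) auto
    moreover have "\<forall>t\<in>?S \<inter> (N \<inter> - S2). \<gamma> t \<in> W \<and> ?h t = g (\<gamma> t)" using *(4) by auto
    moreover have "s \<in> ?S \<inter> (N \<inter> - S2)" using *(3) 1 by blast
    ultimately show ?thesis using *(1) by blast
  next
    case 2
    then have s12: "s \<in> S2" by blast
    obtain W g N where *: "(W, g) \<in> P" "open N" "s \<in> N"
      "\<forall>t\<in>S2 \<inter> N. \<gamma> t \<in> W \<and> h2 t = g (\<gamma> t)"
      by (rule lift_obtain[OF h2 s12])
    have "openin (top_of_set ?S) (?S \<inter> (N \<inter> - S1))"
      using *(2) assms(3) by (intro openin_open_Int open_Int) auto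
    moreover have "\<forall>t\<in>?S \<inter> (N \<inter> - S1). \<gamma> t \<in> W \<and> ?h t = g (\<gamma> t)" using *(4) by auto
    moreover have "s \<in> ?S \<inter> (N \<inter> - S1)" using *(3) 2 by blast
    ultimately show ?thesis using *(1) by blast
  next
    case 3
    then have s12: "s \<in> S1" "s \<in> S2" by auto
    obtain W g N where *: "(W, g) \<in> P" "open N" "s \<in> N"
      "\<forall>t\<in>S1 \<inter> N. \<gamma> t \<in> W \<and> h1 t = g (\<gamma> t)"
      by (rule lift_obtain[OF h1 s12(1)])
    obtain W' g' N' where **: "(W', g') \<in> P" "open N'" "s \<in> N'"
      "\<forall>t\<in>S2 \<inter> N'. \<gamma> t \<in> W' \<and> h2 t = g' (\<gamma> t)"
      by (rule lift_obtain[OF h2 s12(2)])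
    have "\<gamma> s \<in> W \<inter> W'" using * ** s12 by auto
    from dichotomy[OF *(1) **(1) this]
    obtain O' where O: "openin (top_of_set V) O'" "\<gamma> s \<in> O'" "O' \<subseteq> W \<inter> W'"
      "(\<forall>y\<in>O'. g y = g' y) \<or> (\<forall>y\<in>O'. g y \<noteq> g' y)" by auto
    have "g (\<gamma> s) = g' (\<gamma> s)" using agree[OF 3] *(3,4) **(3,4) s12 by auto
    then have O': "\<forall>y\<in>O'. g y = g' y" using O by blast
    let ?N = "(?S \<inter> (N \<inter> N')) \<inter> (?S \<inter> \<gamma> -` O')"
    have o: "openin (top_of_set ?S) (?S \<inter> \<gamma> -` O')"
      using continuous_openin_preimage[OF assms(1) _ O(1)] assms(2) by auto
    have "openin (top_of_set ?S) ?N"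
      by (rule openin_Int[OF openin_open_Int[OF open_Int[OF *(2) **(2)]] o])
    moreover have "\<forall>t\<in>?N. \<gamma> t \<in> W \<and> ?h t = g (\<gamma> t)"
      using *(4) **(4) O(3) O' by auto
    moreover have "s \<in> ?N" using *(3) **(3) s O(2) by blast
    ultimately show ?thesis using *(1) by blast
  qed
qed

definition liftable :: "'s::topological_space set \<Rightarrow> ('s \<Rightarrow> 'm) \<Rightarrow> bool" where
  "liftable S \<gamma> \<longleftrightarrow> (\<forall>s\<in>S. \<forall>v\<in>E (\<gamma> s). \<exists>h. lift S \<gamma> h \<and> h s = v)"

lemma liftable_Un:
  assumes "continuous_on (S1 \<union> S2) \<gamma>" "\<gamma> ` (S1 \<union> S2) \<subseteq> V" "closed S1" "closed S2"
    and "connected (S1 \<inter> S2)" "S1 \<inter> S2 \<noteq> {}"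
    and l1: "liftable S1 \<gamma>" and l2: "liftable S2 \<gamma>"
  shows "liftable (S1 \<union> S2) \<gamma>"
proof -
  obtain t where t: "t \<in> S1 \<inter> S2" using assms(6) by blast
  have agree: "\<And>s. s \<in> S1 \<inter> S2 \<Longrightarrow> h1 s = h2 s"
    if "lift S1 \<gamma> h1" "lift S2 \<gamma> h2" "h1 t = h2 t" for h1 h2
  proof -
    fix s assume s: "s \<in> S1 \<inter> S2"
    have c: "continuous_on (S1 \<inter> S2) \<gamma>" by (rule continuous_on_subset[OF assms(1)]) auto
    have V: "\<gamma> ` (S1 \<inter> S2) \<subseteq> V" using assms(2) by auto
    have "lift (S1 \<inter> S2) \<gamma> h1" by (rule lift_subset[OF that(1)]) auto
    moreover have "lift (S1 \<inter> S2) \<gamma> h2" by (rule lift_subset[OF that(2)]) auto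
    ultimately show "h1 s = h2 s" using t that(3) s by (rule lift_unique[OF assms(5) c V])
  qed
  show ?thesis
    unfolding liftable_def
  proof (intro ballI)
    fix s v assume s: "s \<in> S1 \<union> S2" and v: "v \<in> E (\<gamma> s)"
    have tS: "t \<in> S1" "t \<in> S2" using t by auto
    obtain h1 h2 where *: "lift S1 \<gamma> h1" "lift S2 \<gamma> h2" "h1 t = h2 t"
      "s \<in> S1 \<longrightarrow> h1 s = v" "s \<notin> S1 \<longrightarrow> h2 s = v"
    proof (cases "s \<in> S1")
      case True
      then obtain h1 where h1: "lift S1 \<gamma> h1" "h1 s = v" using l1 v unfolding liftable_def by blast
      then obtain h2 where "lift S2 \<gamma> h2" "h2 t = h1 t"
        using l2 tS lift_in_fibre[OF h1(1) tS(1)] unfolding liftable_def by blast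
      then show ?thesis using True h1 that[of h1 h2] by simp
    next
      case False
      then obtain h2 where h2: "lift S2 \<gamma> h2" "h2 s = v" using l2 v s unfolding liftable_def by blast
      then obtain h1 where "lift S1 \<gamma> h1" "h1 t = h2 t"
        using l1 tS lift_in_fibre[OF h2(1) tS(2)] unfolding liftable_def by blast
      then show ?thesis using False h2 that[of h1 h2] by simp
    qed
    show "\<exists>h. lift (S1 \<union> S2) \<gamma> h \<and> h s = v"
    proof (intro exI conjI)
      show "lift (S1 \<union> S2) \<gamma> (\<lambda>s. if s \<in> S1 then h1 s else h2 s)"
        by (rule lift_glue[OF assms(1-4) *(1,2) agree[OF *(1-3)]])
      show "(if s \<in> S1 then h1 s else h2 s) = v" using *(4,5) by simp
    qed
  qed
qed

text \<open>Small rectangles are mapped into evenly covered sets, and two liftable rectangles with a common edge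
  can be glued. Bisection, first in one direction and then in the other, reaches the whole square.\<close>
lemma liftable_square:
  fixes \<gamma> :: "real \<times> real \<Rightarrow> 'm"
  assumes cont: "continuous_on ({0..1} \<times> {0..1}) \<gamma>" and V: "\<gamma> ` ({0..1} \<times> {0..1}) \<subseteq> V"
  shows "liftable ({0..1} \<times> {0..1}) \<gamma>"
proof -
  let ?G = "\<lambda>a b c d. 0 \<le> a \<and> b \<le> 1 \<and> 0 \<le> c \<and> d \<le> 1 \<longrightarrow> liftable ({a..b} \<times> {c..d}) \<gamma>"
  have joint: "liftable (S1 \<union> S2) \<gamma>"
    if "S1 \<union> S2 \<subseteq> {0..1} \<times> {0..1}" "closed S1" "closed S2" "connected (S1 \<inter> S2)" "S1 \<inter> S2 \<noteq> {}"
      "liftable S1 \<gamma>" "liftable S2 \<gamma>" for S1 S2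
    using that V continuous_on_subset[OF cont that(1)] by (intro liftable_Un) auto
  \<comment> \<open>Cut the square into strips; the bound on the width of a strip depends on the part of its
    length that has been covered.\<close>
  have strips: "\<exists>e>0. \<forall>a b. a \<le> x \<and> x \<le> b \<and> b - a < e \<longrightarrow> ?G a b 0 1" if x: "0 \<le> x" "x \<le> 1" for x
  proof -
    let ?Q = "\<lambda>c d. \<exists>e>0. \<forall>a b. a \<le> x \<and> x \<le> b \<and> b - a < e \<longrightarrow> ?G a b c d"
    have "?Q 0 1"
    proof (rule Bolzano[of 0 1 ?Q])
      fix c d f assume Q: "?Q c d" "?Q d f" and "c \<le> d" "d \<le> f"
      obtain e1 where e1: "e1 > 0" "\<forall>a b. a \<le> x \<and> x \<le> b \<and> b - a < e1 \<longrightarrow> ?G a b c d"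
        using Q(1) by blast
      obtain e2 where e2: "e2 > 0" "\<forall>a b. a \<le> x \<and> x \<le> b \<and> b - a < e2 \<longrightarrow> ?G a b d f"
        using Q(2) by blast
      have "?G a b c f" if ab: "a \<le> x \<and> x \<le> b \<and> b - a < min e1 e2" for a b
      proof
        assume *: "0 \<le> a \<and> b \<le> 1 \<and> 0 \<le> c \<and> f \<le> 1"
        have eq: "{a..b} \<times> {c..f} = {a..b} \<times> {c..d} \<union> {a..b} \<times> {d..f}"
          using \<open>c \<le> d\<close> \<open>d \<le> f\<close> by auto
        have int: "({a..b} \<times> {c..d}) \<inter> ({a..b} \<times> {d..f}) = {a..b} \<times> {d}"
          using \<open>c \<le> d\<close> \<open>d \<le> f\<close> by auto
        show "liftable ({a..b} \<times> {c..f}) \<gamma>" unfolding eq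
        proof (rule joint)
          show "connected ({a..b} \<times> {c..d} \<inter> {a..b} \<times> {d..f})"
            unfolding int by (intro connected_Times) auto
          show "{a..b} \<times> {c..d} \<inter> {a..b} \<times> {d..f} \<noteq> {}" unfolding int using ab by auto
          show "liftable ({a..b} \<times> {c..d}) \<gamma>" "liftable ({a..b} \<times> {d..f}) \<gamma>"
            using e1(2) e2(2) ab * \<open>c \<le> d\<close> \<open>d \<le> f\<close> by auto
        qed (use * \<open>c \<le> d\<close> \<open>d \<le> f\<close> in \<open>auto intro!: closed_Times\<close>)
      qed
      then show "?Q c f" using e1(1) e2(1) by (intro exI[of _ "min e1 e2"]) auto
    next
      fix y :: real assume y: "0 \<le> y" "y \<le> 1"
      have "\<gamma> (x, y) \<in> V" using V x y by auto
      then obtain W where W: "openin (top_of_set V) W" "\<gamma> (x, y) \<in> W"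
        "\<forall>p\<in>W. \<forall>v\<in>E p. \<exists>g. (W, g) \<in> P \<and> g p = v" using even by blast
      have "openin (top_of_set ({0..1} \<times> {0..1})) (({0..1} \<times> {0..1}) \<inter> \<gamma> -` W)"
        using continuous_openin_preimage[OF cont _ W(1)] V by auto
      then obtain T where T: "open T" "({0..1} \<times> {0..1}) \<inter> \<gamma> -` W = ({0..1} \<times> {0..1}) \<inter> T"
        unfolding openin_open by blast
      have "(x, y) \<in> ({0..1} \<times> {0..1}) \<inter> \<gamma> -` W" using W(2) x y by simp
      then have "(x, y) \<in> T" unfolding T(2) by blast
      then obtain A' B' where AB: "open A'" "open B'" "(x, y) \<in> A' \<times> B'" "A' \<times> B' \<subseteq> T"
        by (rule open_prod_elim[OF T(1)])
      have "x \<in> A'" "y \<in> B'" using AB(3) by auto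
      obtain e1 where e1: "e1 > 0" "ball x e1 \<subseteq> A'" by (rule openE[OF AB(1) \<open>x \<in> A'\<close>])
      obtain e2 where e2: "e2 > 0" "ball y e2 \<subseteq> B'" by (rule openE[OF AB(2) \<open>y \<in> B'\<close>])
      have "?G a b c d" if "a \<le> x \<and> x \<le> b \<and> b - a < e1" "c \<le> y \<and> y \<le> d \<and> d - c < e2" for a b c d
      proof
        assume *: "0 \<le> a \<and> b \<le> 1 \<and> 0 \<le> c \<and> d \<le> 1"
        have "{a..b} \<subseteq> ball x e1" "{c..d} \<subseteq> ball y e2"
          using that by (auto simp: dist_real_def)
        then have "{a..b} \<subseteq> A'" "{c..d} \<subseteq> B'" using e1(2) e2(2) by (meson order_trans)+
        then have "{a..b} \<times> {c..d} \<subseteq> T" using AB(4) by blast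
        moreover have "{a..b} \<times> {c..d} \<subseteq> {0..1} \<times> {0..1}" using * by auto
        ultimately have "{a..b} \<times> {c..d} \<subseteq> ({0..1} \<times> {0..1}) \<inter> \<gamma> -` W"
          unfolding T(2) by blast
        then have "\<gamma> ` ({a..b} \<times> {c..d}) \<subseteq> W" by blast
        then show "liftable ({a..b} \<times> {c..d}) \<gamma>"
          unfolding liftable_def using W(3) lift_section[of W _ \<gamma> "{a..b} \<times> {c..d}"] by blast
      qed
      then have "?Q c d" if "c \<le> y \<and> y \<le> d \<and> d - c < e2" for c d
        using e1(1) that by blast
      then show "\<exists>e2>0. \<forall>c d. c \<le> y \<and> y \<le> d \<and> d - c < e2 \<longrightarrow> ?Q c d"
        using e2(1) by blast
    qed simp
    then show ?thesis by simp
  qed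
  have "?G 0 1 0 1"
  proof (rule Bolzano[of 0 1 "\<lambda>a b. ?G a b 0 1"])
    fix a b c :: real assume 1: "?G a b 0 1" "?G b c 0 1" "a \<le> b" "b \<le> c"
    show "?G a c 0 1"
    proof
      assume *: "0 \<le> a \<and> c \<le> 1 \<and> 0 \<le> (0::real) \<and> 1 \<le> (1::real)"
      have eq: "{a..c} \<times> {0..1::real} = {a..b} \<times> {0..1} \<union> {b..c} \<times> {0..1}"
        using 1 by auto
      have int: "({a..b} \<times> {0..1}) \<inter> ({b..c} \<times> {0..1}) = {b} \<times> {0..1::real}"
        using 1 by auto
      show "liftable ({a..c} \<times> {0..1}) \<gamma>" unfolding eq
      proof (rule joint)
        show "connected ({a..b} \<times> {0..1} \<inter> {b..c} \<times> {0..1::real})"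
          unfolding int by (intro connected_Times) auto
        show "{a..b} \<times> {0..1} \<inter> {b..c} \<times> {0..1::real} \<noteq> {}" unfolding int by auto
      qed (use 1 * in \<open>auto intro!: closed_Times\<close>)
    qed
  next
    fix x :: real assume "0 \<le> x" "x \<le> 1"
    from strips[OF this]
    show "\<exists>e>0. \<forall>a b. a \<le> x \<and> x \<le> b \<and> b - a < e \<longrightarrow> ?G a b 0 1" .
  qed simp
  then show ?thesis by simp
qed

text \<open>A path is a map of the square that depends on one coordinate only.\<close>
lemma path_lift_exists:
  assumes "path p" "path_image p \<subseteq> V" "v \<in> E (p 0)"
  obtains h where "lift {0..1} p h" "h 0 = v"
proof -
  have "liftable ({0..1} \<times> {0..1}) (\<lambda>z :: real \<times> real. p (snd z))"
  proof (rule liftable_square)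
    show "continuous_on ({0..1} \<times> {0..1}) (\<lambda>z :: real \<times> real. p (snd z))"
      by (rule continuous_on_compose2[OF assms(1)[unfolded path_def]])
        (auto intro!: continuous_intros)
  qed (use assms(2) in \<open>auto simp: path_image_def\<close>)
  then obtain h where h: "lift ({0..1} \<times> {0..1}) (\<lambda>z :: real \<times> real. p (snd z)) h" "h (0, 0) = v"
    using assms(3) unfolding liftable_def by force
  have "lift {0..1} (\<lambda>t. p (snd (0::real, t))) (\<lambda>t. h (0, t))"
    by (rule lift_compose[OF h(1)]) (auto intro!: continuous_intros)
  then show ?thesis using that h(2) by auto
qed

lemma path_lift_unique:
  assumes "path p" "path_image p \<subseteq> V" "lift {0..1} p h" "lift {0..1} p h'" "h 0 = h' 0"
  shows "h 1 = h' 1"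
  by (rule lift_unique[of "{0..1}" p h h' 0 1])
    (use assms in \<open>auto simp: path_def path_image_def\<close>)

lemma lift_joinpaths:
  assumes h: "lift {0..1} (p +++ q) h" and pq: "pathfinish p = pathstart q"
  shows "lift {0..1} p (\<lambda>t. h (t / 2))" "lift {0..1} q (\<lambda>t. h ((1 + t) / 2))"
proof -
  have "lift {0..1} (\<lambda>t. (p +++ q) (t / 2)) (\<lambda>t. h (t / 2))"
    by (rule lift_compose[OF h]) (auto intro!: continuous_intros)
  moreover have "(p +++ q) (t / 2) = p t" if "t \<in> {0..1}" for t
    using that by (auto simp: joinpaths_def)
  ultimately show "lift {0..1} p (\<lambda>t. h (t / 2))"
    by (rule lift_cong) auto
  have "lift {0..1} (\<lambda>t. (p +++ q) ((1 + t) / 2)) (\<lambda>t. h ((1 + t) / 2))"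
    by (rule lift_compose[OF h]) (auto intro!: continuous_intros)
  moreover have "(p +++ q) ((1 + t) / 2) = q t" if "t \<in> {0..1}" for t
  proof (cases "t = 0")
    case True
    then show ?thesis using pq by (simp add: joinpaths_def pathfinish_def pathstart_def)
  next
    case False
    then show ?thesis using that by (simp add: joinpaths_def add_divide_distrib)
  qed
  ultimately show "lift {0..1} q (\<lambda>t. h ((1 + t) / 2))"
    by (rule lift_cong) auto
qed

text \<open>Free homotopies of loops suffice: the loop formed by the two paths is contracted to a point, the
  contraction is lifted, and the base point of the contraction describes the same path on two opposite
  edges of the square.\<close>
lemma monodromy:
  assumes sc: "simply_connected V"
    and p: "path p" "path_image p \<subseteq> V" "lift {0..1} p h"
    and q: "path q" "path_image q \<subseteq> V" "lift {0..1} q k"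
    and "p 0 = q 0" "p 1 = q 1" "h 0 = k 0"
  shows "h 1 = k 1"
proof -
  let ?l = "p +++ reversepath q"
  have l: "path ?l" "path_image ?l \<subseteq> V" "pathfinish ?l = pathstart ?l"
  proof -
    have *: "pathfinish p = pathstart (reversepath q)"
      using \<open>p 1 = q 1\<close> by (simp add: pathfinish_def)
    show "path ?l" using p q * by (intro path_join_imp) auto
    show "path_image ?l \<subseteq> V" using p q * by (simp add: path_image_join)
    show "pathfinish ?l = pathstart ?l" using \<open>p 0 = q 0\<close>
      by (simp add: pathstart_def joinpaths_def pathfinish_def reversepath_def)
  qed
  have x0: "p 0 \<in> V" using p by (auto simp: path_image_def)
  have "homotopic_loops V ?l (\<lambda>t. p 0)"
    using sc l x0 unfolding simply_connected_def
    by (auto simp: path_def pathfinish_def pathstart_def path_image_def image_subset_iff)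
  then obtain H :: "real \<times> real \<Rightarrow> 'm" where H: "continuous_on ({0..1} \<times> {0..1}) H" "H \<in> {0..1} \<times> {0..1} \<rightarrow> V"
      "\<And>x. x \<in> {0..1} \<Longrightarrow> H (0, x) = ?l x" "\<And>x. x \<in> {0..1} \<Longrightarrow> H (1, x) = p 0"
      "\<And>t. t \<in> {0..1} \<Longrightarrow> H (t, 1) = H (t, 0)"
    unfolding homotopic_loops by (auto simp: pathfinish_def pathstart_def)
  have H00: "H (0, 0) = p 0" using H(3)[of 0] by (simp add: joinpaths_def)
  have "h 0 \<in> E (p 0)" using lift_in_fibre[OF p(3), of 0] by simp
  then obtain \<eta> where \<eta>: "lift ({0..1} \<times> {0..1}) H \<eta>" "\<eta> (0, 0) = h 0"
    using liftable_square[OF H(1)] H(2) H00 unfolding liftable_def by force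
  have edge: "lift {0..1} (\<lambda>t. H (f t)) (\<lambda>t. \<eta> (f t)) \<and> continuous_on {0..1} (\<lambda>t. H (f t)) \<and>
      (\<lambda>t. H (f t)) ` {0..1} \<subseteq> V"
    if f: "continuous_on {0..1} f" "\<And>t. t \<in> {0..1} \<Longrightarrow> f t \<in> {0..1} \<times> {0..1}"
    for f :: "real \<Rightarrow> real \<times> real"
  proof -
    have "f ` {0..1} \<subseteq> {0..1} \<times> {0..1}" using f(2) by blast
    then show ?thesis
      using lift_compose[OF \<eta>(1) f(1)] continuous_on_compose2[OF H(1) f(1)] H(2) by blast
  qed
  have cont: "continuous_on {0..1::real} (\<lambda>t. (c, t))" "continuous_on {0..1::real} (\<lambda>t. (t, c))"
    for c :: real by (auto intro!: continuous_intros)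
  \<comment> \<open>The lift is constant along the edge that is mapped to the base point, hence it takes equal
    values on the two edges that are mapped to the same path.\<close>
  have "\<eta> (1, 1) = \<eta> (1, 0)"
  proof -
    have e: "lift {0..1} (\<lambda>t. H (1, t)) (\<lambda>t. \<eta> (1, t))" "continuous_on {0..1} (\<lambda>t. H (1, t))"
      "(\<lambda>t. H (1, t)) ` {0..1} \<subseteq> V"
      using edge[OF cont(1)[of 1]] by auto
    have "lift {0..1::real} (\<lambda>t. H (1, 0)) (\<lambda>t. \<eta> (1, 0))"
      using edge[of "\<lambda>t. (1, 0)"] by simp
    then have "lift {0..1} (\<lambda>t. H (1, t)) (\<lambda>t. \<eta> (1, 0))"
      by (rule lift_cong) (use H(4) in auto)
    then show ?thesis
      using lift_unique[OF connected_Icc e(2,3,1), of "\<lambda>t. \<eta> (1, 0)" 0 1] by auto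
  qed
  moreover have "\<eta> (0, 1) = \<eta> (0, 0)"
  proof -
    have e: "lift {0..1} (\<lambda>t. H (t, c)) (\<lambda>t. \<eta> (t, c))" "continuous_on {0..1} (\<lambda>t. H (t, c))"
      "(\<lambda>t. H (t, c)) ` {0..1} \<subseteq> V" if "c \<in> {0..1}" for c
      using edge[OF cont(2)[of c]] that by auto
    have "lift {0..1} (\<lambda>t. H (t, 0)) (\<lambda>t. \<eta> (t, 1))"
      by (rule lift_cong[OF e(1)[of 1]]) (use H(5) in auto)
    then show ?thesis
      using lift_unique[OF connected_Icc e(2,3)[of 0] _ e(1)[of 0], of "\<lambda>t. \<eta> (t, 1)" 1 0] calculation
      by auto
  qed
  moreover have "lift {0..1} ?l (\<lambda>t. \<eta> (0, t))"
    by (rule lift_cong[of _ "\<lambda>t. H (0, t)"]) (use edge[OF cont(1)[of 0]] H(3) in auto)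
  ultimately have l2: "lift {0..1} ?l (\<lambda>t. \<eta> (0, t))" "\<eta> (0, 1) = h 0" using \<eta>(2) by auto
  have fs: "pathfinish p = pathstart (reversepath q)"
    using \<open>p 1 = q 1\<close> by (simp add: pathfinish_def)
  have "\<eta> (0, 1 / 2) = h 1"
    using path_lift_unique[OF p(1,2) lift_joinpaths(1)[OF l2(1) fs] p(3)] \<eta>(2) by simp
  moreover have "lift {0..1} (\<lambda>t. reversepath q (1 - t)) (\<lambda>t. \<eta> (0, (1 + (1 - t)) / 2))"
    by (rule lift_compose[OF lift_joinpaths(2)[OF l2(1) fs]]) (auto intro!: continuous_on_diff)
  then have "\<eta> (0, 1 / 2) = k 1"
    using path_lift_unique[OF q(1,2) _ q(3), of "\<lambda>t. \<eta> (0, (1 + (1 - t)) / 2)"] l2(2) \<open>h 0 = k 0\<close>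
    by (simp add: reversepath_def)
  ultimately show ?thesis by simp
qed

text \<open>The value at \<open>x\<close> is the end point of the lift of any path from \<open>x0\<close> to \<open>x\<close>; prolonging that path inside an
  evenly covered neighbourhood of \<open>x\<close> shows that the values form a section there.\<close>
theorem global_section:
  assumes sc: "simply_connected V" and x0: "x0 \<in> V" "v0 \<in> E x0"
  obtains f where "lift V (\<lambda>x. x) f"
proof -
  define adm where "adm p h \<longleftrightarrow> path p \<and> path_image p \<subseteq> V \<and> p 0 = x0 \<and> lift {0..1} p h \<and> h 0 = v0"
    for p and h :: "real \<Rightarrow> 'b"
  \<comment> \<open>Constant loops at two points are homotopic, and the track of the homotopy joins the points.\<close>
  have "\<exists>p h. adm p h \<and> p 1 = x" if "x \<in> V" for x
  proof -
    have "homotopic_loops V (\<lambda>t. x0) (\<lambda>t. x)"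
      using sc x0(1) that unfolding simply_connected_def
      by (auto simp: path_def pathfinish_def pathstart_def path_image_def image_subset_iff)
    then obtain H :: "real \<times> real \<Rightarrow> 'm" where H: "continuous_on ({0..1} \<times> {0..1}) H" "H \<in> {0..1} \<times> {0..1} \<rightarrow> V"
      "\<And>t. t \<in> {0..1} \<Longrightarrow> H (0, t) = x0" "\<And>t. t \<in> {0..1} \<Longrightarrow> H (1, t) = x"
      unfolding homotopic_loops by auto
    define p where "p = (\<lambda>t. H (t, 0))"
    have p: "path p" "path_image p \<subseteq> V" "p 0 = x0" "p 1 = x"
      using H unfolding p_def path_def path_image_def
      by (auto intro!: continuous_on_compose2[OF H(1)] continuous_intros simp: image_subset_iff)
    then obtain h where "lift {0..1} p h" "h 0 = v0"
      using path_lift_exists[of p v0] x0(2) by auto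
    then show ?thesis using p unfolding adm_def by blast
  qed
  then obtain pp hh where ph: "\<And>x. x \<in> V \<Longrightarrow> adm (pp x) (hh x) \<and> pp x 1 = x" by metis
  define f where "f x = hh x 1" for x
  have indep: "h 1 = f (p 1)" if "adm p h" for p h
  proof -
    have "p 1 \<in> V" using that unfolding adm_def path_image_def by auto
    from ph[OF this] that show ?thesis
      unfolding adm_def f_def by (intro monodromy[OF sc, of p h "pp (p 1)" "hh (p 1)"]) auto
  qed
  have "lift V (\<lambda>x. x) f"
    unfolding lift_def
  proof
    fix x assume x: "x \<in> V"
    obtain W where W: "openin (top_of_set V) W" "x \<in> W" "path_connected W"
      "\<forall>y\<in>W. \<forall>v\<in>E y. \<exists>g. (W, g) \<in> P \<and> g y = v" using even[OF x] by blast
    have WV: "W \<subseteq> V" using W(1) openin_imp_subset by blast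
    have px: "adm (pp x) (hh x)" "pp x 1 = x" using ph[OF x] by auto
    have "f x \<in> E x"
      using lift_in_fibre[of "{0..1}" "pp x" "hh x" 1] px unfolding adm_def f_def by auto
    then obtain g where g: "(W, g) \<in> P" "g x = f x" using W by blast
    have "f y = g y" if y: "y \<in> W" for y
    proof -
      obtain r where r: "path r" "path_image r \<subseteq> W" "pathstart r = x" "pathfinish r = y"
        using W(2,3) y unfolding path_connected_def by blast
      have j: "path (pp x +++ r)" "path_image (pp x +++ r) \<subseteq> V" "pathfinish (pp x) = pathstart r"
        "(pp x +++ r) 0 = x0" "(pp x +++ r) 1 = y"
      proof -
        have *: "path (pp x)" "path_image (pp x) \<subseteq> V" "pp x 0 = x0" "pathfinish (pp x) = pathstart r"
          using px r(3) unfolding adm_def by (auto simp: pathfinish_def)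
        show "path (pp x +++ r)" using * r by (intro path_join_imp)
        show "path_image (pp x +++ r) \<subseteq> V" using * r WV by (auto simp: path_image_join)
        show "pathfinish (pp x) = pathstart r" by (rule *)
        show "(pp x +++ r) 0 = x0" "(pp x +++ r) 1 = y"
          using * r by (auto simp: joinpaths_def pathfinish_def)
      qed
      obtain h where h: "lift {0..1} (pp x +++ r) h" "h 0 = v0"
        using path_lift_exists[OF j(1,2), of v0] j(4) x0(2) by auto
      have "adm (pp x +++ r) h" using j h unfolding adm_def by simp
      then have "f y = h 1" using indep[of "pp x +++ r" h] j(5) by simp
      also have "h (1 / 2) = hh x 1"
        using path_lift_unique[OF _ _ lift_joinpaths(1)[OF h(1) j(3)], of "hh x"] px h(2)
        unfolding adm_def by simp
      then have "h 1 = g (r 1)"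
        using path_lift_unique[OF r(1) _ lift_joinpaths(2)[OF h(1) j(3)]
            lift_section[OF g(1), of r "{0..1}"]] r WV g(2)
        by (auto simp: f_def path_image_def pathstart_def)
      finally show ?thesis using r(4) by (simp add: pathfinish_def)
    qed
    then show "\<exists>W g N. (W, g) \<in> P \<and> openin (top_of_set V) N \<and> x \<in> N \<and>
                 (\<forall>t\<in>N. t \<in> W \<and> f t = g t)"
      using g(1) W(1,2) by blast
  qed
  then show thesis by (rule that)
qed

end

section \<open>Partial derivatives of maps on the plane\<close>

abbreviation dx :: "(complex \<Rightarrow> 'b::real_normed_vector) \<Rightarrow> complex \<Rightarrow> 'b" where
  "dx f \<equiv> pderiv_dir f 1"

abbreviation dy :: "(complex \<Rightarrow> 'b::real_normed_vector) \<Rightarrow> complex \<Rightarrow> 'b" where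
  "dy f \<equiv> pderiv_dir f \<i>"

text \<open>Differentiability together with the values of both partial derivatives. Keeping the values
  in the predicate turns every computation of derivatives into an application of rules.\<close>
definition partials :: "(complex \<Rightarrow> 'b::real_normed_vector) \<Rightarrow> 'b \<Rightarrow> 'b \<Rightarrow> complex \<Rightarrow> bool" where
  "partials f a b z \<longleftrightarrow> (f has_derivative (\<lambda>h. Re h *\<^sub>R a + Im h *\<^sub>R b)) (at z)"

lemma partials_imp_pderiv_dir: "partials f a b z \<Longrightarrow> pderiv_dir f v z = Re v *\<^sub>R a + Im v *\<^sub>R b"
  unfolding partials_def pderiv_dir_def by (metis frechet_derivative_at)

lemma partials_imp_dx: "partials f a b z \<Longrightarrow> dx f z = a"
  and partials_imp_dy: "partials f a b z \<Longrightarrow> dy f z = b"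
  by (simp_all add: partials_imp_pderiv_dir)

lemma partials_unique: "partials f a b z \<Longrightarrow> partials f c d z \<Longrightarrow> a = c \<and> b = d"
  using partials_imp_dx partials_imp_dy by metis

lemma differentiable_imp_partials:
  assumes "f differentiable (at z)"
  shows "partials f (dx f z) (dy f z) z"
proof -
  let ?D = "frechet_derivative f (at z)"
  have D: "(f has_derivative ?D) (at z)" using assms by (simp add: frechet_derivative_works)
  then interpret linear ?D by (rule has_derivative_linear)
  have "?D = (\<lambda>h. Re h *\<^sub>R ?D 1 + Im h *\<^sub>R ?D \<i>)"
  proof
    fix h
    have "?D h = ?D (Re h *\<^sub>R 1 + Im h *\<^sub>R \<i>)" by (rule arg_cong[of _ _ ?D]) (simp add: complex_eq_iff)
    then show "?D h = Re h *\<^sub>R ?D 1 + Im h *\<^sub>R ?D \<i>" by (simp only: add scale)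
  qed
  with D show ?thesis unfolding partials_def pderiv_dir_def by (rule has_derivative_eq_rhs)
qed

lemma partials_imp_differentiable: "partials f a b z \<Longrightarrow> f differentiable (at z)"
  unfolding partials_def differentiable_def by blast

lemma partials_imp_isCont: "partials f a b z \<Longrightarrow> isCont f z"
  unfolding partials_def by (rule has_derivative_continuous)

lemma partials_transform:
  assumes "partials f a b z" "open U" "z \<in> U" "\<And>w. w \<in> U \<Longrightarrow> f w = g w"
  shows "partials g a b z"
  using assms unfolding partials_def by (rule has_derivative_transform_within_open)

lemma partials_eq_rhs: "partials f a b z \<Longrightarrow> a = c \<Longrightarrow> b = d \<Longrightarrow> partials f c d z"
  by simp

lemma partials_eq_on:
  "partials f a b z \<Longrightarrow> open U \<Longrightarrow> z \<in> U \<Longrightarrow> \<forall>w\<in>U. f w = g w \<Longrightarrow> partials g a b z"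
  using partials_transform by blast

lemma partials_const: "partials (\<lambda>w. c) 0 0 z"
  unfolding partials_def by simp

lemma partials_add: "partials f a b z \<Longrightarrow> partials g c d z \<Longrightarrow> partials (\<lambda>w. f w + g w) (a + c) (b + d) z"
  unfolding partials_def
  by (drule (1) has_derivative_add) (simp add: algebra_simps)

lemma partials_linear:
  assumes "bounded_linear T" "partials f a b z"
  shows "partials (\<lambda>w. T (f w)) (T a) (T b) z"
proof -
  interpret bounded_linear T by fact
  show ?thesis using has_derivative[OF assms(2)[unfolded partials_def]]
    unfolding partials_def by (simp add: add scaleR)
qed

lemma partials_diff: "partials f a b z \<Longrightarrow> partials g c d z \<Longrightarrow> partials (\<lambda>w. f w - g w) (a - c) (b - d) z"
  using partials_add[of f a b z "\<lambda>w. - g w" "- c" "- d"] partials_linear[of uminus g c d z]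
  by (simp add: bounded_linear_minus bounded_linear_ident)

lemma partials_bilinear:
  assumes "bounded_bilinear pr" "partials f a b z" "partials g c d z"
  shows "partials (\<lambda>w. pr (f w) (g w)) (pr a (g z) + pr (f z) c) (pr b (g z) + pr (f z) d) z"
proof -
  interpret bounded_bilinear pr by fact
  show ?thesis using FDERIV[OF assms(2,3)[unfolded partials_def]]
    unfolding partials_def by (simp add: algebra_simps add_left add_right scaleR_left scaleR_right)
qed

lemmas partials_inner = partials_bilinear[OF bounded_bilinear_inner]
lemmas partials_mult = partials_bilinear[OF bounded_bilinear_mult]
lemmas partials_scaleR = partials_bilinear[OF bounded_bilinear_scaleR]
lemmas partials_of_real = partials_linear[OF bounded_linear_of_real]

lemma bounded_bilinear_cross3: "bounded_bilinear cross3"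
  using bilinear_cross bilinear_conv_bounded_bilinear by blast

lemma partials_compose_real:
  fixes f :: "complex \<Rightarrow> real"
  assumes "partials f a b z" "(k has_real_derivative d) (at (f z))"
  shows "partials (\<lambda>w. k (f w)) (d * a) (d * b) z"
proof -
  have "(k has_derivative (*) d) (at (f z))"
    using assms(2) by (simp add: has_field_derivative_def)
  from has_derivative_compose[OF assms(1)[unfolded partials_def] this]
  show ?thesis unfolding partials_def by (simp add: algebra_simps)
qed

lemma partials_inverse:
  fixes f :: "complex \<Rightarrow> real"
  assumes "partials f a b z" "f z \<noteq> 0"
  shows "partials (\<lambda>w. inverse (f w)) (- a / (f z)\<^sup>2) (- b / (f z)\<^sup>2) z"
  using partials_compose_real[OF assms(1) DERIV_inverse[OF assms(2)]]
  by (simp add: power2_eq_square divide_simps)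

lemma partials_ln:
  fixes f :: "complex \<Rightarrow> real"
  assumes "partials f a b z" "f z > 0"
  shows "partials (\<lambda>w. ln (f w)) (a / f z) (b / f z) z"
  using partials_compose_real[OF assms(1) DERIV_ln[OF assms(2)]]
  by (simp add: divide_simps)

lemma has_field_derivative_imp_partials:
  "(f has_field_derivative d) (at z) \<Longrightarrow> partials f d (\<i> * d) z"
  unfolding partials_def has_field_derivative_def
  by (erule has_derivative_eq_rhs) (auto simp: complex_eq_iff algebra_simps)

text \<open>The Cauchy-Riemann equations.\<close>
lemma partials_imp_has_field_derivative:
  "partials f d (\<i> * d) z \<Longrightarrow> (f has_field_derivative d) (at z)"
  unfolding partials_def has_field_derivative_def
  by (erule has_derivative_eq_rhs) (auto simp: complex_eq_iff algebra_simps)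

lemma partials_compose_holomorphic:
  assumes "partials f a b (\<phi> z)" "(\<phi> has_field_derivative d) (at z)"
  shows "partials (\<lambda>w. f (\<phi> w)) (Re d *\<^sub>R a + Im d *\<^sub>R b) (Re d *\<^sub>R b - Im d *\<^sub>R a) z"
proof -
  have "(\<phi> has_derivative (*) d) (at z)" using assms(2) by (simp add: has_field_derivative_def)
  from has_derivative_compose[OF this assms(1)[unfolded partials_def]]
  show ?thesis unfolding partials_def by (rule has_derivative_eq_rhs) (auto simp: algebra_simps)
qed

lemma partials_zero_imp_constant:
  assumes "open S" "connected S" "\<And>z. z \<in> S \<Longrightarrow> partials f 0 0 z" "x \<in> S" "y \<in> S"
  shows "f x = f y"
  by (rule has_derivative_zero_unique_connected[OF assms(1,2) _ assms(4,5)])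
    (use assms(3) in \<open>simp add: partials_def\<close>)

lemma smooth_on_imp_partials:
  assumes "smooth_on f U" "open U" "z \<in> U"
  shows "partials f (dx f z) (dy f z) z"
proof -
  have "Ck_on 1 f U" using assms(1) unfolding smooth_on_def by blast
  then have "f differentiable_on U" by simp
  then show ?thesis using assms(2,3) differentiable_on_eq_differentiable_at
    by (intro differentiable_imp_partials) blast
qed

lemma smooth_on_dx: "smooth_on f U \<Longrightarrow> smooth_on (dx f) U"
  and smooth_on_dy: "smooth_on f U \<Longrightarrow> smooth_on (dy f) U"
proof -
  assume "smooth_on f U"
  then have "Ck_on (Suc k) f U" for k unfolding smooth_on_def by blast
  then have "Ck_on k (dx f) U \<and> Ck_on k (dy f) U" for k
    by (simp add: Basis_complex_def pderiv_dir_def[abs_def])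
  then show "smooth_on (dx f) U" "smooth_on (dy f) U" unfolding smooth_on_def by auto
qed

text \<open>Used for \<open>(a, b) = (1, \<i>)\<close> and for \<open>(a, b) = (\<i>, 1)\<close>: the second difference is symmetric in \<open>a\<close> and \<open>b\<close>.\<close>
lemma second_difference_mean_value:
  fixes f fa fab :: "complex \<Rightarrow> real"
  assumes h: "h > 0"
    and fa: "\<And>s t. 0 \<le> s \<Longrightarrow> s \<le> h \<Longrightarrow> 0 \<le> t \<Longrightarrow> t \<le> h \<Longrightarrow>
      ((\<lambda>s. f (z + of_real s * a + of_real t * b)) has_real_derivative
         fa (z + of_real s * a + of_real t * b)) (at s)"
    and fab: "\<And>s t. 0 \<le> s \<Longrightarrow> s \<le> h \<Longrightarrow> 0 \<le> t \<Longrightarrow> t \<le> h \<Longrightarrow>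
      ((\<lambda>t. fa (z + of_real s * a + of_real t * b)) has_real_derivative
         fab (z + of_real s * a + of_real t * b)) (at t)"
  obtains s t where "0 < s" "s < h" "0 < t" "t < h"
    "f (z + of_real h * a + of_real h * b) - f (z + of_real h * a) - f (z + of_real h * b) + f z
       = h * h * fab (z + of_real s * a + of_real t * b)"
proof -
  let ?w = "\<lambda>s t. z + of_real s * a + of_real t * b"
  have "\<exists>s>0. s < h \<and> (f (?w h h) - f (?w h 0)) - (f (?w 0 h) - f (?w 0 0)) =
      (h - 0) * (fa (?w s h) - fa (?w s 0))"
    using h fa[of _ h] fa[of _ 0]
    by (intro MVT2[of 0 h "\<lambda>s. f (?w s h) - f (?w s 0)" "\<lambda>s. fa (?w s h) - fa (?w s 0)"] DERIV_diff)
      auto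
  then obtain s where s: "0 < s" "s < h"
    "(f (?w h h) - f (?w h 0)) - (f (?w 0 h) - f (?w 0 0)) = h * (fa (?w s h) - fa (?w s 0))"
    by auto
  have "\<exists>t>0. t < h \<and> fa (?w s h) - fa (?w s 0) = (h - 0) * fab (?w s t)"
    using h s fab[of s] by (intro MVT2[of 0 h "\<lambda>t. fa (?w s t)"]) auto
  then obtain t where t: "0 < t" "t < h" "fa (?w s h) - fa (?w s 0) = h * fab (?w s t)"
    by auto
  show thesis
    by (rule that[OF s(1,2) t(1,2)]) (use s(3) t(3) in \<open>simp add: algebra_simps\<close>)
qed

lemma partials_along_line:
  assumes "partials f p q (w + of_real s * a)"
  shows "((\<lambda>s. f (w + of_real s * a)) has_vector_derivative Re a *\<^sub>R p + Im a *\<^sub>R q) (at s)"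
proof -
  have "((\<lambda>s. w + of_real s * a) has_derivative (\<lambda>r. of_real r * a)) (at s)"
    by (auto intro!: derivative_eq_intros)
  from has_derivative_compose[OF this assms[unfolded partials_def]]
  show ?thesis unfolding has_vector_derivative_def by (simp add: algebra_simps)
qed

text \<open>Symmetry of second derivatives: two applications of the mean value theorem express the second
  difference of a function over a small square by either mixed derivative at a point of the
  square.\<close>
lemma mixed_partials_commute_real:
  fixes f fx fy fxx fxy fyx fyy :: "complex \<Rightarrow> real"
  assumes U: "open U" "z \<in> U"
    and f: "\<And>w. w \<in> U \<Longrightarrow> partials f (fx w) (fy w) w"
    and fx: "\<And>w. w \<in> U \<Longrightarrow> partials fx (fxx w) (fxy w) w"
    and fy: "\<And>w. w \<in> U \<Longrightarrow> partials fy (fyx w) (fyy w) w"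
    and cont: "isCont fxy z" "isCont fyx z"
  shows "fxy z = fyx z"
proof (rule ccontr)
  assume ne: "fxy z \<noteq> fyx z"
  define e where "e = \<bar>fxy z - fyx z\<bar> / 2"
  have e: "e > 0" using ne by (simp add: e_def)
  obtain d1 where d1: "d1 > 0" "\<And>w. dist w z < d1 \<Longrightarrow> \<bar>fxy w - fxy z\<bar> < e"
    using cont(1) e unfolding continuous_at_eps_delta dist_real_def by blast
  obtain d2 where d2: "d2 > 0" "\<And>w. dist w z < d2 \<Longrightarrow> \<bar>fyx w - fyx z\<bar> < e"
    using cont(2) e unfolding continuous_at_eps_delta dist_real_def by blast
  obtain d3 where d3: "d3 > 0" "ball z d3 \<subseteq> U" using U by (meson openE)
  define h where "h = min d1 (min d2 d3) / 3"
  have h: "h > 0" using d1 d2 d3 by (simp add: h_def)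
  have near: "dist (z + of_real s * a + of_real t * b) z < min d1 (min d2 d3)"
    if "0 \<le> s" "s \<le> h" "0 \<le> t" "t \<le> h" "cmod a = 1" "cmod b = 1" for s t a b
  proof -
    have "dist (z + of_real s * a + of_real t * b) z = cmod (of_real s * a + of_real t * b)"
      by (simp add: dist_norm)
    also have "\<dots> \<le> s + t" using that by (metis abs_of_nonneg mult.right_neutral norm_mult norm_of_real norm_triangle_ineq)
    also have "\<dots> < 3 * h" using that h by linarith
    finally show ?thesis by (simp add: h_def)
  qed
  then have inU: "z + of_real s * a + of_real t * b \<in> U"
    if "0 \<le> s" "s \<le> h" "0 \<le> t" "t \<le> h" "cmod a = 1" "cmod b = 1" for s t a b
    using d3(2) that by (fastforce simp: dist_commute)
  have line: "((\<lambda>s. g (w + of_real s * a)) has_real_derivative Re a * p + Im a * q) (at s)"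
    if "partials g p q (w + of_real s * a)" for g :: "complex \<Rightarrow> real" and p q w s a
    using partials_along_line[OF that]
    by (simp add: has_real_derivative_iff_has_vector_derivative)
  obtain s t where 1: "0 < s" "s < h" "0 < t" "t < h"
    "f (z + of_real h * 1 + of_real h * \<i>) - f (z + of_real h * 1) - f (z + of_real h * \<i>) + f z
       = h * h * fxy (z + of_real s * 1 + of_real t * \<i>)"
  proof (rule second_difference_mean_value[OF h, of f z 1 \<i> fx fxy])
    fix s t assume st: "0 \<le> s" "s \<le> h" "0 \<le> t" "t \<le> h"
    have w: "z + of_real s * 1 + of_real t * \<i> \<in> U" using inU[OF st, of 1 \<i>] by simp
    show "((\<lambda>s. f (z + of_real s * 1 + of_real t * \<i>)) has_real_derivative
         fx (z + of_real s * 1 + of_real t * \<i>)) (at s)"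
      using line[of f _ _ "z + of_real t * \<i>" s 1] f[OF w] by (simp add: algebra_simps)
    show "((\<lambda>t. fx (z + of_real s * 1 + of_real t * \<i>)) has_real_derivative
         fxy (z + of_real s * 1 + of_real t * \<i>)) (at t)"
      using line[of fx _ _ "z + of_real s" t \<i>] fx[OF w] by (simp add: algebra_simps)
  qed blast
  obtain s' t' where 2: "0 < s'" "s' < h" "0 < t'" "t' < h"
    "f (z + of_real h * \<i> + of_real h * 1) - f (z + of_real h * \<i>) - f (z + of_real h * 1) + f z
       = h * h * fyx (z + of_real s' * \<i> + of_real t' * 1)"
  proof (rule second_difference_mean_value[OF h, of f z \<i> 1 fy fyx])
    fix s t assume st: "0 \<le> s" "s \<le> h" "0 \<le> t" "t \<le> h"
    have w: "z + of_real s * \<i> + of_real t * 1 \<in> U" using inU[OF st, of \<i> 1] by simp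
    show "((\<lambda>s. f (z + of_real s * \<i> + of_real t * 1)) has_real_derivative
         fy (z + of_real s * \<i> + of_real t * 1)) (at s)"
      using line[of f _ _ "z + of_real t" s \<i>] f[OF w] by (simp add: algebra_simps)
    show "((\<lambda>t. fy (z + of_real s * \<i> + of_real t * 1)) has_real_derivative
         fyx (z + of_real s * \<i> + of_real t * 1)) (at t)"
      using line[of fy _ _ "z + of_real s * \<i>" t 1] fy[OF w] by (simp add: algebra_simps)
  qed blast
  have "h * h * fxy (z + of_real s * 1 + of_real t * \<i>) = h * h * fyx (z + of_real s' * \<i> + of_real t' * 1)"
    using 1(5) 2(5) by (simp add: algebra_simps)
  then have "fxy (z + of_real s * 1 + of_real t * \<i>) = fyx (z + of_real s' * \<i> + of_real t' * 1)"
    using h by simp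
  moreover have "\<bar>fxy (z + of_real s * 1 + of_real t * \<i>) - fxy z\<bar> < e"
    using near[of s t 1 \<i>] 1 by (intro d1(2)) auto
  moreover have "\<bar>fyx (z + of_real s' * \<i> + of_real t' * 1) - fyx z\<bar> < e"
    using near[of s' t' \<i> 1] 2 by (intro d2(2)) auto
  ultimately show False unfolding e_def by (smt (verit) field_sum_of_halves)
qed

lemma mixed_partials_commute:
  fixes f :: "complex \<Rightarrow> 'b::real_inner"
  assumes sm: "smooth_on f U" and U: "open U" "z \<in> U"
  shows "dx (dy f) z = dy (dx f) z"
proof -
  have "dy (dx f) z \<bullet> e = dx (dy f) z \<bullet> e" for e
  proof (rule mixed_partials_commute_real[OF U, where f = "\<lambda>w. f w \<bullet> e" and fx = "\<lambda>w. dx f w \<bullet> e"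
        and fy = "\<lambda>w. dy f w \<bullet> e" and fxx = "\<lambda>w. dx (dx f) w \<bullet> e" and fyy = "\<lambda>w. dy (dy f) w \<bullet> e"])
    have *: "partials (\<lambda>w. g w \<bullet> e) (dx g w \<bullet> e) (dy g w \<bullet> e) w" if "smooth_on g U" "w \<in> U" for g w
      by (rule partials_linear[OF bounded_linear_inner_left smooth_on_imp_partials[OF that(1) U(1) that(2)]])
    show "partials (\<lambda>w. f w \<bullet> e) (dx f w \<bullet> e) (dy f w \<bullet> e) w"
      "partials (\<lambda>w. dx f w \<bullet> e) (dx (dx f) w \<bullet> e) (dy (dx f) w \<bullet> e) w"
      "partials (\<lambda>w. dy f w \<bullet> e) (dx (dy f) w \<bullet> e) (dy (dy f) w \<bullet> e) w" if "w \<in> U" for w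
      using * sm smooth_on_dx smooth_on_dy that by blast+
    show "isCont (\<lambda>w. dy (dx f) w \<bullet> e) z" "isCont (\<lambda>w. dx (dy f) w \<bullet> e) z"
      using * sm smooth_on_dx smooth_on_dy U(2) partials_imp_isCont by blast+
  qed
  then show ?thesis by (metis vector_eq_rdot)
qed

section \<open>Harmonic and holomorphic functions\<close>

lemma Ck_on_cong:
  assumes "open U" "\<And>z. z \<in> U \<Longrightarrow> f z = g z" "Ck_on n f U"
  shows "Ck_on n g U"
  using assms(2,3)
proof (induction n arbitrary: f g)
  case 0
  then show ?case using continuous_on_cong by simp
next
  case (Suc n)
  have diff: "f differentiable (at z)" if "z \<in> U" for z
    using Suc.prems(2) that differentiable_on_eq_differentiable_at[OF assms(1)] by auto
  then have "g differentiable (at z)" if "z \<in> U" for z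
    using that Suc.prems(1) assms(1) unfolding differentiable_def
    by (metis has_derivative_transform_within_open)
  moreover have "frechet_derivative f (at z) = frechet_derivative g (at z)" if "z \<in> U" for z
    using frechet_derivative_transform_within_open[OF diff[OF that] assms(1) that Suc.prems(1)] .
  ultimately show ?case
    using Suc.prems(2) Suc.IH[of "\<lambda>x. frechet_derivative f (at x) b" "\<lambda>x. frechet_derivative g (at x) b" for b]
    by (auto simp: differentiable_on_eq_differentiable_at[OF assms(1)])
qed

lemma Ck_on_local:
  assumes "open U" "\<And>z. z \<in> U \<Longrightarrow> \<exists>T. open T \<and> z \<in> T \<and> Ck_on n f T"
  shows "Ck_on n f U"
  using assms(2)
proof (induction n arbitrary: f)
  case 0
  then show ?case
    by (simp add: continuous_on_eq_continuous_at[OF assms(1)])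
      (metis continuous_on_eq_continuous_at)
next
  case (Suc n)
  have "f differentiable (at z)" if "z \<in> U" for z
  proof -
    obtain T where "open T" "z \<in> T" "f differentiable_on T" using Suc.prems[OF \<open>z \<in> U\<close>] by auto
    then show ?thesis using differentiable_on_eq_differentiable_at by blast
  qed
  moreover have "Ck_on n (\<lambda>x. frechet_derivative f (at x) b) U" if "b \<in> Basis" for b
  proof (rule Suc.IH)
    fix z assume "z \<in> U"
    then obtain T where "open T" "z \<in> T" "Ck_on (Suc n) f T" using Suc.prems by blast
    then show "\<exists>T. open T \<and> z \<in> T \<and> Ck_on n (\<lambda>x. frechet_derivative f (at x) b) T"
      using that by auto
  qed
  ultimately show ?case by (simp add: differentiable_on_eq_differentiable_at[OF assms(1)])
qed

lemma partials_Im_holomorphic: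
  assumes "k holomorphic_on S" "open S" "z \<in> S"
  shows "partials (\<lambda>z. Im (k z)) (Im (deriv k z)) (Im (\<i> * deriv k z)) z"
  using assms by (intro partials_linear[OF bounded_linear_Im] has_field_derivative_imp_partials holomorphic_derivI)

text \<open>The induction stays in the class of imaginary parts, as \<open>\<partial>\<^sub>x Im k = Im k'\<close> and \<open>\<partial>\<^sub>y Im k = Im (\<i> k')\<close>.\<close>
lemma Ck_on_Im_holomorphic:
  assumes "open S" "k holomorphic_on S"
  shows "Ck_on n (\<lambda>z. Im (k z)) S"
  using assms(2)
proof (induction n arbitrary: k)
  case 0
  then show ?case by (auto intro!: continuous_intros holomorphic_on_imp_continuous_on)
next
  case (Suc n)
  have hol: "deriv k holomorphic_on S" "(\<lambda>z. \<i> * deriv k z) holomorphic_on S"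
    using holomorphic_deriv[OF Suc.prems assms(1)] by (auto intro!: holomorphic_intros)
  note p = partials_Im_holomorphic[OF Suc.prems assms(1)]
  have "(\<lambda>z. Im (k z)) differentiable_on S"
    using p partials_imp_differentiable differentiable_on_eq_differentiable_at[OF assms(1)] by blast
  moreover have "Ck_on n (dx (\<lambda>z. Im (k z))) S"
    by (rule Ck_on_cong[OF assms(1) _ Suc.IH[OF hol(1)]]) (simp add: partials_imp_dx[OF p])
  moreover have "Ck_on n (dy (\<lambda>z. Im (k z))) S"
    by (rule Ck_on_cong[OF assms(1) _ Suc.IH[OF hol(2)]]) (simp add: partials_imp_dy[OF p])
  ultimately show ?case by (simp add: Basis_complex_def pderiv_dir_def[abs_def])
qed

lemma harmonic_on_local:
  assumes "open U"
    and loc: "\<And>z. z \<in> U \<Longrightarrow> \<exists>T k. open T \<and> z \<in> T \<and> k holomorphic_on T \<and> (\<forall>w\<in>T. u w = Im (k w))"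
  shows "harmonic_on u U"
  unfolding harmonic_on_def
proof (intro conjI ballI)
  show "Ck_on 2 u U"
  proof (rule Ck_on_local[OF assms(1)])
    fix z assume "z \<in> U"
    then obtain T k where "open T" "z \<in> T" "k holomorphic_on T" "\<forall>w\<in>T. u w = Im (k w)"
      using loc by blast
    then show "\<exists>T. open T \<and> z \<in> T \<and> Ck_on 2 u T"
      using Ck_on_cong[OF \<open>open T\<close> _ Ck_on_Im_holomorphic[OF \<open>open T\<close>, of k 2], of u] by auto
  qed
  fix z assume "z \<in> U"
  then obtain T k where T: "open T" "z \<in> T" "k holomorphic_on T" "\<forall>w\<in>T. u w = Im (k w)"
    using loc by blast
  note p = partials_Im_holomorphic[OF T(3,1)]
  have u: "dx u w = Im (deriv k w) \<and> dy u w = Im (\<i> * deriv k w)" if "w \<in> T" for w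
    using partials_eq_on[OF p[OF that] T(1) that, of u] T(4) partials_imp_dx partials_imp_dy by metis
  have d: "deriv k holomorphic_on T" by (rule holomorphic_deriv[OF T(3,1)])
  then have d': "(\<lambda>z. \<i> * deriv k z) holomorphic_on T"
    by (rule holomorphic_on_mult[OF holomorphic_on_const])
  have "deriv (\<lambda>z. \<i> * deriv k z) z = \<i> * deriv (deriv k) z"
    using holomorphic_derivI[OF d T(1,2)] by (intro DERIV_imp_deriv DERIV_cmult)
  then have "partials (dy u) (Im (\<i> * deriv (deriv k) z)) (Im (\<i> * (\<i> * deriv (deriv k) z))) z"
    using partials_eq_on[OF partials_Im_holomorphic[OF d' T(1,2)] T(1,2), of "dy u"] u by simp
  moreover have "partials (dx u) (Im (deriv (deriv k) z)) (Im (\<i> * deriv (deriv k) z)) z"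
    using partials_eq_on[OF partials_Im_holomorphic[OF d T(1,2)] T(1,2), of "dx u"] u by simp
  ultimately show "dx (dx u) z + dy (dy u) z = 0"
    using partials_imp_dx partials_imp_dy by fastforce
qed

text \<open>The maximum of \<open>|q|\<close> is attained at every point.\<close>
lemma constant_modulus_imp_constant:
  assumes "q holomorphic_on ball a e" "\<And>z. z \<in> ball a e \<Longrightarrow> cmod (q z) = 1" "w \<in> ball a e" "z \<in> ball a e"
  shows "q w = q z"
proof -
  have "q constant_on ball a e"
    by (rule maximum_modulus_principle[OF assms(1) open_ball connected_ball open_ball order_refl assms(3)])
      (simp only: assms(2) assms(2)[OF assms(3)] order_refl)
  then show ?thesis using assms(3,4) unfolding constant_on_def by metis
qed

text \<open>The points at which \<open>H Im k\<close> vanishes are described by \<open>\<lambda> = 1/k\<^sup>2\<close> alone, without the choice of the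
  square root \<open>k\<close>.\<close>
lemma inverse_square_positive_iff:
  fixes l k :: complex
  assumes "l * k\<^sup>2 = 1"
  shows "Im k = 0 \<longleftrightarrow> Im l = 0 \<and> Re l > 0"
proof -
  define s where "s = ((cmod k)\<^sup>2)\<^sup>2"
  have "k \<noteq> 0" using assms by auto
  then have s: "s > 0" by (simp add: s_def)
  have "complex_of_real s = (k * cnj k)\<^sup>2"
    unfolding s_def of_real_power[of "(cmod k)\<^sup>2"] complex_norm_square ..
  then have "l * complex_of_real s = (l * k\<^sup>2) * (cnj k)\<^sup>2" by (simp add: power_mult_distrib)
  then have e: "l * complex_of_real s = (cnj k)\<^sup>2" by (simp add: assms)
  have im: "Im l * s = - (2 * Re k * Im k)" using arg_cong[OF e, of Im] by (simp add: Im_power2)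
  have re: "Re l * s = (Re k)\<^sup>2 - (Im k)\<^sup>2" using arg_cong[OF e, of Re] by (simp add: Re_power2)
  show ?thesis
  proof
    assume k: "Im k = 0"
    then have "Re k \<noteq> 0" using \<open>k \<noteq> 0\<close> by (simp add: complex_eq_iff)
    then have "0 < Re l * s" using re k by simp
    then show "Im l = 0 \<and> Re l > 0" using im k s by (simp add: zero_less_mult_iff)
  next
    assume l: "Im l = 0 \<and> Re l > 0"
    have "0 < Re l * s" using l s by simp
    then have "(Im k)\<^sup>2 < (Re k)\<^sup>2" using re by simp
    then have "Re k \<noteq> 0" by auto
    then show "Im k = 0" using im l by simp
  qed
qed

section \<open>The structure equations of a conformal patch\<close>

text \<open>A surface in one conformal coordinate. \<open>X1, X2, nrm\<close> is an orthogonal frame, and \<open>L, M, N\<close> are the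
  coefficients of the second fundamental form.\<close>
locale conformal_patch =
  fixes X :: "complex \<Rightarrow> real^3" and U :: "complex set"
  assumes open_U: "open U"
    and smooth: "smooth_on X U"
    and conformal: "\<And>z. z \<in> U \<Longrightarrow> conformal_at X z"
begin

abbreviation "X1 \<equiv> dx X"
abbreviation "X2 \<equiv> dy X"
abbreviation "X11 \<equiv> dx (dx X)"
abbreviation "X12 \<equiv> dy (dx X)"
abbreviation "X22 \<equiv> dy (dy X)"
abbreviation "rho \<equiv> conf_factor X"
abbreviation "nrm \<equiv> unit_normal X"
abbreviation "L z \<equiv> X11 z \<bullet> nrm z"
abbreviation "M z \<equiv> X12 z \<bullet> nrm z"
abbreviation "N z \<equiv> X22 z \<bullet> nrm z"

lemma partials_X: "z \<in> U \<Longrightarrow> partials X (X1 z) (X2 z) z"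
  by (rule smooth_on_imp_partials[OF smooth open_U])

lemma partials_X1: "z \<in> U \<Longrightarrow> partials X1 (X11 z) (X12 z) z"
  by (rule smooth_on_imp_partials[OF smooth_on_dx[OF smooth] open_U])

lemma partials_X2: "z \<in> U \<Longrightarrow> partials X2 (X12 z) (X22 z) z"
  using smooth_on_imp_partials[OF smooth_on_dy[OF smooth] open_U]
    mixed_partials_commute[OF smooth open_U] by metis

lemma partials_X11: "z \<in> U \<Longrightarrow> partials X11 (dx X11 z) (dx X12 z) z"
  using smooth_on_imp_partials[OF smooth_on_dx[OF smooth_on_dx[OF smooth]] open_U]
    mixed_partials_commute[OF smooth_on_dx[OF smooth] open_U] by metis

lemma partials_X12: "z \<in> U \<Longrightarrow> partials X12 (dx X12 z) (dy X12 z) z"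
  by (rule smooth_on_imp_partials[OF smooth_on_dy[OF smooth_on_dx[OF smooth]] open_U])

lemma partials_X22: "z \<in> U \<Longrightarrow> partials X22 (dy X12 z) (dy X22 z) z"
proof -
  assume z: "z \<in> U"
  have "partials (dx (dy X)) (dx X12 z) (dy X12 z) z"
    using mixed_partials_commute[OF smooth open_U]
    by (intro partials_transform[OF partials_X12[OF z] open_U z]) simp
  then have "dy (dx (dy X)) z = dy X12 z" by (rule partials_imp_dy)
  then show ?thesis
    using smooth_on_imp_partials[OF smooth_on_dy[OF smooth_on_dy[OF smooth]] open_U z]
      mixed_partials_commute[OF smooth_on_dy[OF smooth] open_U z] by metis
qed

lemma first_form_eq:
  assumes "z \<in> U"
  shows "first_form X z v w = rho z * (v \<bullet> w)" and rho_pos: "rho z > 0"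
proof -
  obtain r where r: "r > 0" "\<And>v w. first_form X z v w = r * (v \<bullet> w)"
    using conformal[OF assms] unfolding conformal_at_def by blast
  have "rho z = r" using r(2)[of 1 1] by (simp add: conf_factor_def)
  with r show "first_form X z v w = rho z * (v \<bullet> w)" "rho z > 0" by auto
qed

lemma tangent_inner:
  assumes "z \<in> U"
  shows "X1 z \<bullet> X1 z = rho z" "X2 z \<bullet> X2 z = rho z" "X1 z \<bullet> X2 z = 0" "X2 z \<bullet> X1 z = 0"
  using first_form_eq(1)[OF assms, of 1 1] first_form_eq(1)[OF assms, of \<i> \<i>]
    first_form_eq(1)[OF assms, of 1 \<i>]
  by (simp_all add: first_form_def inner_commute)

lemma norm_cross_tangent:
  assumes "z \<in> U"
  shows "norm (cross3 (X1 z) (X2 z)) = rho z"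
proof -
  have "(norm (cross3 (X1 z) (X2 z)))\<^sup>2 = (norm (X1 z))\<^sup>2 * (norm (X2 z))\<^sup>2"
    using norm_cross_dot[of "X1 z" "X2 z"] tangent_inner[OF assms]
    by (simp add: power_mult_distrib)
  also have "\<dots> = (rho z)\<^sup>2"
    using tangent_inner[OF assms] unfolding power2_norm_eq_inner by (simp add: power2_eq_square)
  finally show ?thesis using rho_pos[OF assms] by (simp add: power2_eq_iff_nonneg)
qed

lemma normal_eq:
  assumes "z \<in> U"
  shows "nrm z = inverse (rho z) *\<^sub>R cross3 (X1 z) (X2 z)"
  by (simp add: unit_normal_def sgn_div_norm norm_cross_tangent[OF assms])

lemma normal_inner:
  assumes "z \<in> U"
  shows "nrm z \<bullet> nrm z = 1" "nrm z \<bullet> X1 z = 0" "nrm z \<bullet> X2 z = 0" "X1 z \<bullet> nrm z = 0" "X2 z \<bullet> nrm z = 0"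
proof -
  have "norm (nrm z) = 1"
    using rho_pos[OF assms] by (simp add: normal_eq[OF assms] norm_cross_tangent[OF assms])
  then show "nrm z \<bullet> nrm z = 1" by (simp add: norm_eq_1)
  show "nrm z \<bullet> X1 z = 0" "nrm z \<bullet> X2 z = 0" "X1 z \<bullet> nrm z = 0" "X2 z \<bullet> nrm z = 0"
    by (simp_all add: normal_eq[OF assms] dot_cross_self)
qed

text \<open>A vector orthogonal to both tangent vectors has vanishing cross product with their cross product,
  so it is parallel to the normal.\<close>
lemma frame_expansion:
  assumes "z \<in> U"
  shows "v = ((v \<bullet> X1 z) / rho z) *\<^sub>R X1 z + ((v \<bullet> X2 z) / rho z) *\<^sub>R X2 z + (v \<bullet> nrm z) *\<^sub>R nrm z"
proof -
  define w where
    "w = v - (((v \<bullet> X1 z) / rho z) *\<^sub>R X1 z + ((v \<bullet> X2 z) / rho z) *\<^sub>R X2 z + (v \<bullet> nrm z) *\<^sub>R nrm z)"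
  have w: "X1 z \<bullet> w = 0" "X2 z \<bullet> w = 0" "nrm z \<bullet> w = 0"
    using rho_pos[OF assms]
    by (simp_all add: w_def inner_diff_right inner_add_right tangent_inner[OF assms]
        normal_inner[OF assms] inner_commute)
  have "cross3 (cross3 (X1 z) (X2 z)) w = (X1 z \<bullet> w) *\<^sub>R X2 z - (X2 z \<bullet> w) *\<^sub>R X1 z"
    by (simp add: vec_eq_iff forall_3 cross3_def inner_vec_def sum_3 algebra_simps)
  then have "cross3 (nrm z) w = 0" using w by (simp add: normal_eq[OF assms] cross_mult_left)
  moreover have "nrm z \<noteq> 0" using normal_inner(1)[OF assms] by auto
  ultimately have "w = 0" using w(3) norm_and_cross_eq_0 by blast
  then show ?thesis by (simp add: w_def)
qed

lemma inner_frame: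
  assumes "z \<in> U"
  shows "v \<bullet> w = (v \<bullet> X1 z) * (w \<bullet> X1 z) / rho z + (v \<bullet> X2 z) * (w \<bullet> X2 z) / rho z
           + (v \<bullet> nrm z) * (w \<bullet> nrm z)"
  by (subst frame_expansion[OF assms, of v]) (simp add: inner_add_left inner_commute[of w])

text \<open>The Christoffel symbols, expressed by the derivatives of the conformal factor.\<close>
lemma christoffel:
  assumes "z \<in> U"
  shows "X12 z \<bullet> X2 z = X11 z \<bullet> X1 z" "X22 z \<bullet> X2 z = X12 z \<bullet> X1 z"
    "X11 z \<bullet> X2 z = - (X12 z \<bullet> X1 z)" "X22 z \<bullet> X1 z = - (X11 z \<bullet> X1 z)"
    and partials_rho: "partials rho (2 * (X11 z \<bullet> X1 z)) (2 * (X12 z \<bullet> X1 z)) z"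
proof -
  note inner = partials_inner[OF partials_X1[OF assms] partials_X1[OF assms]]
    partials_inner[OF partials_X2[OF assms] partials_X2[OF assms]]
    partials_inner[OF partials_X1[OF assms] partials_X2[OF assms]]
  have 1: "partials rho (X11 z \<bullet> X1 z + X1 z \<bullet> X11 z) (X12 z \<bullet> X1 z + X1 z \<bullet> X12 z) z"
    by (rule partials_transform[OF inner(1) open_U assms]) (simp add: tangent_inner)
  have 2: "partials rho (X12 z \<bullet> X2 z + X2 z \<bullet> X12 z) (X22 z \<bullet> X2 z + X2 z \<bullet> X22 z) z"
    by (rule partials_transform[OF inner(2) open_U assms]) (simp add: tangent_inner)
  have 3: "partials (\<lambda>z. 0) (X11 z \<bullet> X2 z + X1 z \<bullet> X12 z) (X12 z \<bullet> X2 z + X1 z \<bullet> X22 z) z"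
    by (rule partials_transform[OF inner(3) open_U assms]) (simp add: tangent_inner)
  show "X12 z \<bullet> X2 z = X11 z \<bullet> X1 z" "X22 z \<bullet> X2 z = X12 z \<bullet> X1 z"
    "X11 z \<bullet> X2 z = - (X12 z \<bullet> X1 z)" "X22 z \<bullet> X1 z = - (X11 z \<bullet> X1 z)"
    using partials_unique[OF 1 2] partials_unique[OF 3 partials_const] by (auto simp: inner_commute)
  show "partials rho (2 * (X11 z \<bullet> X1 z)) (2 * (X12 z \<bullet> X1 z)) z"
    using 1 by (simp add: inner_commute)
qed

text \<open>The Weingarten equations.\<close>
lemma partials_normal:
  assumes "z \<in> U"
  shows "partials nrm (- ((L z / rho z) *\<^sub>R X1 z + (M z / rho z) *\<^sub>R X2 z))
                      (- ((M z / rho z) *\<^sub>R X1 z + (N z / rho z) *\<^sub>R X2 z)) z"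
proof -
  have "partials (\<lambda>z. inverse (rho z)) (- (2 * (X11 z \<bullet> X1 z)) / (rho z)\<^sup>2) (- (2 * (X12 z \<bullet> X1 z)) / (rho z)\<^sup>2) z"
    using rho_pos[OF assms] by (intro partials_inverse partials_rho assms) simp
  from partials_scaleR[OF this partials_bilinear[OF bounded_bilinear_cross3
        partials_X1[OF assms] partials_X2[OF assms]]]
  obtain a b where "partials (\<lambda>z. inverse (rho z) *\<^sub>R cross3 (X1 z) (X2 z)) a b z" by blast
  then have n: "partials nrm a b z"
    by (rule partials_transform[OF _ open_U assms]) (simp add: normal_eq)
  have 1: "partials (\<lambda>z. 0) (a \<bullet> X1 z + nrm z \<bullet> X11 z) (b \<bullet> X1 z + nrm z \<bullet> X12 z) z"
    by (rule partials_transform[OF partials_inner[OF n partials_X1[OF assms]] open_U assms])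
      (simp add: normal_inner)
  have 2: "partials (\<lambda>z. 0) (a \<bullet> X2 z + nrm z \<bullet> X12 z) (b \<bullet> X2 z + nrm z \<bullet> X22 z) z"
    by (rule partials_transform[OF partials_inner[OF n partials_X2[OF assms]] open_U assms])
      (simp add: normal_inner)
  have 3: "partials (\<lambda>z. 1) (a \<bullet> nrm z + nrm z \<bullet> a) (b \<bullet> nrm z + nrm z \<bullet> b) z"
    by (rule partials_transform[OF partials_inner[OF n n] open_U assms]) (simp add: normal_inner)
  have "a \<bullet> X1 z = - L z" "b \<bullet> X1 z = - M z" "a \<bullet> X2 z = - M z" "b \<bullet> X2 z = - N z"
    "a \<bullet> nrm z = 0" "b \<bullet> nrm z = 0"
    using partials_unique[OF 1 partials_const] partials_unique[OF 2 partials_const]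
      partials_unique[OF 3 partials_const] by (auto simp: inner_commute)
  then have "a = - ((L z / rho z) *\<^sub>R X1 z + (M z / rho z) *\<^sub>R X2 z)"
    "b = - ((M z / rho z) *\<^sub>R X1 z + (N z / rho z) *\<^sub>R X2 z)"
    using frame_expansion[OF assms, of a] frame_expansion[OF assms, of b] by simp_all
  then show ?thesis using n by simp
qed

lemma second_form_eq:
  assumes "z \<in> U"
  shows "second_form X z v w =
           Re v * Re w * L z + (Re v * Im w + Im v * Re w) * M z + Im v * Im w * N z"
proof -
  have "partials (\<lambda>z. Re v *\<^sub>R X1 z + Im v *\<^sub>R X2 z)
     (Re v *\<^sub>R X11 z + Im v *\<^sub>R X12 z) (Re v *\<^sub>R X12 z + Im v *\<^sub>R X22 z) z"
    by (rule partials_add[OF partials_linear[OF bounded_linear_scaleR_right partials_X1[OF assms]]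
          partials_linear[OF bounded_linear_scaleR_right partials_X2[OF assms]]])
  then have "partials (pderiv_dir X v)
     (Re v *\<^sub>R X11 z + Im v *\<^sub>R X12 z) (Re v *\<^sub>R X12 z + Im v *\<^sub>R X22 z) z"
    by (rule partials_transform[OF _ open_U assms]) (simp add: partials_imp_pderiv_dir[OF partials_X, where v = v])
  from partials_imp_pderiv_dir[OF this, of w] show ?thesis
    by (simp add: second_form_def inner_add_left algebra_simps)
qed

lemma mean_curv_eq: "z \<in> U \<Longrightarrow> mean_curv X z = (L z + N z) / (2 * rho z)"
  using rho_pos[of z]
  by (simp add: mean_curv_def second_form_eq first_form_eq(1)) (simp add: field_simps)

lemma gauss_curv_eq: "z \<in> U \<Longrightarrow> gauss_curv X z = (L z * N z - (M z)\<^sup>2) / (rho z)\<^sup>2"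
  by (simp add: gauss_curv_def second_form_eq first_form_eq(1) power2_eq_square)

lemma hopf_eq:
  assumes "z \<in> U"
  shows "hopf X z = (of_real (L z - N z) - 2 * \<i> * of_real (M z)) / 4"
proof -
  have c: "partials (\<lambda>w. complex_of_real (Y w $ j)) (of_real (a $ j)) (of_real (b $ j)) w"
    if "partials Y a b w" for Y :: "complex \<Rightarrow> real^3" and a b w j
    by (rule partials_of_real[OF partials_linear[OF bounded_linear_vec_nth that]])
  have w1: "wirtinger (\<lambda>w. complex_of_real (X w $ j)) w = (of_real (X1 w $ j) - \<i> * of_real (X2 w $ j)) / 2"
    if "w \<in> U" for w j
    using c[OF partials_X[OF that], of j]
    by (simp add: wirtinger_def partials_imp_dx partials_imp_dy)
  have w2: "wirtinger (wirtinger (\<lambda>w. complex_of_real (X w $ j))) z =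
      (of_real (X11 z $ j - X22 z $ j) - 2 * \<i> * of_real (X12 z $ j)) / 4" for j
  proof -
    have "partials (\<lambda>w. (of_real (X1 w $ j) - \<i> * of_real (X2 w $ j)) / 2)
      ((of_real (X11 z $ j) - \<i> * of_real (X12 z $ j)) / 2)
      ((of_real (X12 z $ j) - \<i> * of_real (X22 z $ j)) / 2) z"
      by (rule partials_linear[OF bounded_linear_divide partials_diff[OF c[OF partials_X1[OF assms]]
            partials_linear[OF bounded_linear_mult_right c[OF partials_X2[OF assms]]]]])
    then have "partials (wirtinger (\<lambda>w. complex_of_real (X w $ j)))
      ((of_real (X11 z $ j) - \<i> * of_real (X12 z $ j)) / 2)
      ((of_real (X12 z $ j) - \<i> * of_real (X22 z $ j)) / 2) z"
      by (rule partials_transform[OF _ open_U assms]) (simp add: w1)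
    then show ?thesis
      unfolding wirtinger_def[of "wirtinger _"]
      by (simp add: partials_imp_dx partials_imp_dy) (simp add: field_simps)
  qed
  show ?thesis
    unfolding hopf_def w2
    by (simp add: inner_vec_def sum_3 field_simps)
qed

lemma norm_hopf:
  assumes "z \<in> U"
  shows "4 * (cmod (hopf X z))\<^sup>2 = ((L z - N z) / 2)\<^sup>2 + (M z)\<^sup>2"
  by (simp add: hopf_eq[OF assms] cmod_def) (simp add: power2_eq_square field_simps)

lemma curvature_discriminant:
  assumes "z \<in> U"
  shows "(mean_curv X z)\<^sup>2 - gauss_curv X z = (2 * cmod (hopf X z) / rho z)\<^sup>2"
  using norm_hopf[OF assms] rho_pos[OF assms]
  by (simp add: mean_curv_eq[OF assms] gauss_curv_eq[OF assms] power_divide power_mult_distrib)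
    (simp add: power2_eq_square field_simps)

lemma moebius_factor_eq:
  assumes "z \<in> U"
  shows "moebius_factor X z = 4 * (cmod (hopf X z))\<^sup>2 / rho z"
  using rho_pos[OF assms] unfolding moebius_factor_def curvature_discriminant[OF assms]
  by (simp add: power2_eq_square)

text \<open>Relative to the first form \<open>\<rho> (dx\<^sup>2 + dy\<^sup>2)\<close> the eigenvalues are the roots of
  \<open>(L - k \<rho>) (N - k \<rho>) = M\<^sup>2\<close>, whose discriminant is \<open>H\<^sup>2 - K = (2|Q|/\<rho>)\<^sup>2\<close>.\<close>
lemma principal_curvs_eq:
  assumes "z \<in> U"
  shows "principal_curvs X z =
    {mean_curv X z + 2 * cmod (hopf X z) / rho z, mean_curv X z - 2 * cmod (hopf X z) / rho z}"
proof -
  let ?a = "\<lambda>k. L z - k * rho z" and ?c = "\<lambda>k. N z - k * rho z"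
  have eig: "(\<forall>w. second_form X z v w = k * first_form X z v w) \<longleftrightarrow>
      ?a k * Re v + M z * Im v = 0 \<and> M z * Re v + ?c k * Im v = 0" (is "?l \<longleftrightarrow> ?r") for k v
  proof
    assume ?l
    from this[rule_format, of 1] this[rule_format, of \<i>] show ?r
      by (simp add: second_form_eq[OF assms] first_form_eq(1)[OF assms] algebra_simps)
  next
    assume ?r
    then have "Re w * (?a k * Re v + M z * Im v) + Im w * (M z * Re v + ?c k * Im v) = 0" for w
      by simp
    then show ?l
      by (simp add: second_form_eq[OF assms] first_form_eq(1)[OF assms] algebra_simps inner_complex_def)
  qed
  have sing: "(\<exists>v. v \<noteq> 0 \<and> a * Re v + m * Im v = 0 \<and> m * Re v + c * Im v = 0) \<longleftrightarrow> a * c = m\<^sup>2"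
    for a m c :: real
  proof
    assume "\<exists>v. v \<noteq> 0 \<and> a * Re v + m * Im v = 0 \<and> m * Re v + c * Im v = 0"
    then obtain v where v: "v \<noteq> 0" "a * Re v + m * Im v = 0" "m * Re v + c * Im v = 0" by blast
    have "(a * c - m\<^sup>2) * Re v = 0" "(a * c - m\<^sup>2) * Im v = 0"
      using v(2,3) by algebra+
    then show "a * c = m\<^sup>2" using v(1) by (auto simp: complex_eq_iff)
  next
    assume *: "a * c = m\<^sup>2"
    show "\<exists>v. v \<noteq> 0 \<and> a * Re v + m * Im v = 0 \<and> m * Re v + c * Im v = 0"
    proof (cases "a = 0 \<and> m = 0")
      case True
      then show ?thesis by (intro exI[of _ 1]) auto
    next
      case False
      then show ?thesis using *
        by (intro exI[of _ "Complex (- m) a"]) (auto simp: complex_eq_iff power2_eq_square mult.commute)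
    qed
  qed
  have "k \<in> principal_curvs X z \<longleftrightarrow> (k - mean_curv X z)\<^sup>2 = (2 * cmod (hopf X z) / rho z)\<^sup>2" for k
  proof -
    have "k \<in> principal_curvs X z \<longleftrightarrow> ?a k * ?c k = (M z)\<^sup>2"
      unfolding principal_curvs_def using eig sing by simp
    also have "\<dots> \<longleftrightarrow> (k - mean_curv X z)\<^sup>2 = (mean_curv X z)\<^sup>2 - gauss_curv X z"
      using rho_pos[OF assms]
      by (simp add: mean_curv_eq[OF assms] gauss_curv_eq[OF assms] power2_eq_square divide_simps)
        (auto simp: algebra_simps)
    finally show ?thesis by (simp add: curvature_discriminant[OF assms])
  qed
  moreover have "(k - h)\<^sup>2 = s\<^sup>2 \<longleftrightarrow> k = h + s \<or> k = h - s" for k h s :: real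
    unfolding power2_eq_iff by linarith
  ultimately show ?thesis by blast
qed

lemma max_curv_eq: "z \<in> U \<Longrightarrow> max_curv X z = mean_curv X z + 2 * cmod (hopf X z) / rho z"
  and min_curv_eq: "z \<in> U \<Longrightarrow> min_curv X z = mean_curv X z - 2 * cmod (hopf X z) / rho z"
  using rho_pos[of z]
  by (auto simp: max_curv_def min_curv_def principal_curvs_eq max_def min_def divide_simps)

text \<open>The Codazzi equation \<open>Q\<^sub>\<zbar> = (e\<^sup>\<omega>/2) H\<^sub>z\<close>.\<close>
lemma codazzi:
  assumes "z \<in> U"
  obtains h1 h2 q1 q2 where "partials (mean_curv X) h1 h2 z" "partials (hopf X) q1 q2 z"
    "q1 + \<i> * q2 = of_real (rho z / 2) * (of_real h1 - \<i> * of_real h2)"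
proof -
  let ?n1 = "- ((L z / rho z) *\<^sub>R X1 z + (M z / rho z) *\<^sub>R X2 z)"
  let ?n2 = "- ((M z / rho z) *\<^sub>R X1 z + (N z / rho z) *\<^sub>R X2 z)"
  define p q where "p = X11 z \<bullet> X1 z" and "q = X12 z \<bullet> X1 z"
  have r: "rho z \<noteq> 0" using rho_pos[OF assms] by simp
  define t1 t2 where "t1 = dx X12 z \<bullet> nrm z" and "t2 = dy X12 z \<bullet> nrm z"
  define L1 where "L1 = dx X11 z \<bullet> nrm z + X11 z \<bullet> ?n1"
  define N2 where "N2 = dy X22 z \<bullet> nrm z + X22 z \<bullet> ?n2"
  have chr: "X11 z \<bullet> X1 z = p" "X12 z \<bullet> X1 z = q" "X12 z \<bullet> X2 z = p" "X22 z \<bullet> X2 z = q"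
    "X11 z \<bullet> X2 z = - q" "X22 z \<bullet> X1 z = - p"
    using christoffel[OF assms] by (simp_all add: p_def q_def)
  have n: "v \<bullet> ?n1 = - (L z * (v \<bullet> X1 z) + M z * (v \<bullet> X2 z)) / rho z"
    "v \<bullet> ?n2 = - (M z * (v \<bullet> X1 z) + N z * (v \<bullet> X2 z)) / rho z" for v
    by (simp_all only: inner_minus_right inner_add_right inner_scaleR_right)
      (simp_all add: add_divide_distrib diff_divide_distrib)
  have pL: "partials L L1 (t1 - (M z * p - N z * q) / rho z) z"
    by (rule partials_eq_rhs[OF partials_inner[OF partials_X11[OF assms] partials_normal[OF assms]]])
      (unfold L1_def t1_def n chr, simp_all add: add_divide_distrib diff_divide_distrib)
  have pM: "partials M (t1 - (L z * q + M z * p) / rho z) (t2 - (M z * q + N z * p) / rho z) z"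
    by (rule partials_eq_rhs[OF partials_inner[OF partials_X12[OF assms] partials_normal[OF assms]]])
      (unfold t1_def t2_def n chr, simp_all add: add_divide_distrib diff_divide_distrib)
  have pN: "partials N (t2 - (M z * q - L z * p) / rho z) N2 z"
    by (rule partials_eq_rhs[OF partials_inner[OF partials_X22[OF assms] partials_normal[OF assms]]])
      (unfold N2_def t2_def n chr, simp_all add: add_divide_distrib diff_divide_distrib)
  have p2: "partials (\<lambda>z. inverse (rho z)) (- (2 * p) / (rho z)\<^sup>2) (- (2 * q) / (rho z)\<^sup>2) z"
    unfolding p_def q_def using r by (intro partials_inverse partials_rho assms) simp
  note H = partials_linear[OF bounded_linear_mult_right[of "1 / 2"]
      partials_mult[OF partials_add[OF pL pN] p2]]
  note Q = partials_linear[OF bounded_linear_divide[of 4] partials_diff[OF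
        partials_of_real[OF partials_diff[OF pL pN]]
        partials_linear[OF bounded_linear_mult_right[of "2 * \<i>"] partials_of_real[OF pM]]]]
  show thesis
  proof (rule that)
    show "partials (mean_curv X)
      (1 / 2 * ((L1 + (t2 - (M z * q - L z * p) / rho z)) * inverse (rho z)
         + (L z + N z) * (- (2 * p) / (rho z)\<^sup>2)))
      (1 / 2 * ((t1 - (M z * p - N z * q) / rho z + N2) * inverse (rho z)
         + (L z + N z) * (- (2 * q) / (rho z)\<^sup>2))) z"
      by (rule partials_transform[OF H open_U assms]) (simp add: mean_curv_eq divide_simps)
    show "partials (hopf X)
      ((of_real (L1 - (t2 - (M z * q - L z * p) / rho z))
          - 2 * \<i> * of_real (t1 - (L z * q + M z * p) / rho z)) / 4)
      ((of_real ((t1 - (M z * p - N z * q) / rho z) - N2)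
          - 2 * \<i> * of_real (t2 - (M z * q + N z * p) / rho z)) / 4) z"
      by (rule partials_transform[OF Q open_U assms]) (simp add: hopf_eq)
  qed (use r in \<open>simp add: complex_eq_iff field_simps power2_eq_square\<close>)
qed

lemma continuous_on_mean_curv: "continuous_on U (mean_curv X)"
  using codazzi partials_imp_isCont continuous_at_imp_continuous_on by metis

text \<open>The Gauss equation \<open>\<Delta>\<omega> = -2 K e\<^sup>\<omega>\<close>.\<close>
lemma gauss_equation:
  assumes "z \<in> U"
  defines "P \<equiv> \<lambda>z. 2 * (X11 z \<bullet> X1 z) * inverse (rho z)"
    and "R \<equiv> \<lambda>z. 2 * (X12 z \<bullet> X1 z) * inverse (rho z)"
  shows "partials (\<lambda>z. ln (rho z)) (P z) (R z) z"
    and "\<exists>a b c. partials P a b z \<and> partials R b c z \<and> a + c = - 2 * gauss_curv X z * rho z"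
proof -
  have r: "rho z > 0" using rho_pos[OF assms(1)] .
  show "partials (\<lambda>z. ln (rho z)) (P z) (R z) z"
    using partials_ln[OF partials_rho[OF assms(1)] r] by (simp add: P_def R_def divide_inverse)
  define p q where "p = X11 z \<bullet> X1 z" and "q = X12 z \<bullet> X1 z"
  have chr: "X11 z \<bullet> X1 z = p" "X12 z \<bullet> X1 z = q" "X12 z \<bullet> X2 z = p" "X22 z \<bullet> X2 z = q"
    "X11 z \<bullet> X2 z = - q" "X22 z \<bullet> X1 z = - p"
    using christoffel[OF assms(1)] by (simp_all add: p_def q_def)
  have p1: "partials (\<lambda>z. X11 z \<bullet> X1 z) (dx X12 z \<bullet> X2 z + X12 z \<bullet> X12 z) (dx X12 z \<bullet> X1 z + X11 z \<bullet> X12 z) z"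
  proof -
    have "partials (\<lambda>z. X11 z \<bullet> X1 z) (dx X12 z \<bullet> X2 z + X12 z \<bullet> X12 z) (dy X12 z \<bullet> X2 z + X12 z \<bullet> X22 z) z"
      by (rule partials_transform[OF partials_inner[OF partials_X12[OF assms(1)] partials_X2[OF assms(1)]]
            open_U assms(1)]) (simp add: christoffel)
    with partials_unique[OF this partials_inner[OF partials_X11[OF assms(1)] partials_X1[OF assms(1)]]]
    show ?thesis by simp
  qed
  have p2: "partials (\<lambda>z. X12 z \<bullet> X1 z) (dx X12 z \<bullet> X1 z + X11 z \<bullet> X12 z) (- (dx X12 z \<bullet> X2 z + X11 z \<bullet> X22 z)) z"
  proof -
    have "partials (\<lambda>z. - (X11 z \<bullet> X2 z)) (- (dx X11 z \<bullet> X2 z + X11 z \<bullet> X12 z)) (- (dx X12 z \<bullet> X2 z + X11 z \<bullet> X22 z)) z"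
      by (rule partials_linear[OF bounded_linear_minus[OF bounded_linear_ident]
            partials_inner[OF partials_X11[OF assms(1)] partials_X2[OF assms(1)]]])
    then have "partials (\<lambda>z. X12 z \<bullet> X1 z) (- (dx X11 z \<bullet> X2 z + X11 z \<bullet> X12 z)) (- (dx X12 z \<bullet> X2 z + X11 z \<bullet> X22 z)) z"
      by (rule partials_transform[OF _ open_U assms(1)]) (simp add: christoffel)
    from partials_unique[OF this partials_inner[OF partials_X12[OF assms(1)] partials_X1[OF assms(1)]]]
    show ?thesis
      by (intro partials_eq_rhs[OF partials_inner[OF partials_X12[OF assms(1)] partials_X1[OF assms(1)]]])
        (simp_all add: inner_commute)
  qed
  have inv: "partials (\<lambda>z. inverse (rho z)) (- (2 * p) / (rho z)\<^sup>2) (- (2 * q) / (rho z)\<^sup>2) z"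
    unfolding p_def q_def using r by (intro partials_inverse partials_rho assms) simp
  have key: "X12 z \<bullet> X12 z - X11 z \<bullet> X22 z = 2 * (p\<^sup>2 + q\<^sup>2) / rho z - (L z * N z - (M z)\<^sup>2)"
    using r unfolding inner_frame[OF assms(1), of "X12 z" "X12 z"] inner_frame[OF assms(1), of "X11 z" "X22 z"] chr
    by (simp add: power2_eq_square field_simps)
  note P = partials_mult[OF partials_linear[OF bounded_linear_mult_right[of 2] p1] inv]
  note R = partials_mult[OF partials_linear[OF bounded_linear_mult_right[of 2] p2] inv]
  let ?a = "2 * (dx X12 z \<bullet> X2 z + X12 z \<bullet> X12 z) * inverse (rho z) + 2 * (X11 z \<bullet> X1 z) * (- (2 * p) / (rho z)\<^sup>2)"
  let ?b = "2 * (dx X12 z \<bullet> X1 z + X11 z \<bullet> X12 z) * inverse (rho z) + 2 * (X11 z \<bullet> X1 z) * (- (2 * q) / (rho z)\<^sup>2)"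
  let ?c = "2 * (- (dx X12 z \<bullet> X2 z + X11 z \<bullet> X22 z)) * inverse (rho z) + 2 * (X12 z \<bullet> X1 z) * (- (2 * q) / (rho z)\<^sup>2)"
  have "partials P ?a ?b z" using P unfolding P_def .
  moreover have "partials R ?b ?c z" using R unfolding R_def chr by (simp add: mult.commute mult.left_commute)
  moreover have "?a + ?c = - 2 * gauss_curv X z * rho z"
  proof -
    have "?a + ?c = 2 * (X12 z \<bullet> X12 z - X11 z \<bullet> X22 z) * inverse (rho z) - 4 * (p\<^sup>2 + q\<^sup>2) / (rho z)\<^sup>2"
      unfolding chr using r by (simp add: power2_eq_square field_simps)
    also have "\<dots> = - 2 * gauss_curv X z * rho z"
      unfolding key gauss_curv_eq[OF assms(1)] using r by (simp add: power2_eq_square field_simps)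
    finally show ?thesis .
  qed
  ultimately show "\<exists>a b c. partials P a b z \<and> partials R b c z \<and> a + c = - 2 * gauss_curv X z * rho z"
    by blast
qed

end

section \<open>Change of coordinates\<close>

text \<open>\<open>X\<close> and \<open>X'\<close> are the same surface in two coordinates that are related by the holomorphic \<open>\<phi>\<close>.\<close>
locale coordinate_change =
  P: conformal_patch X U + P': conformal_patch X' U'
  for X U X' U' +
  fixes \<phi> :: "complex \<Rightarrow> complex" and S :: "complex set"
  assumes open_S: "open S" and S: "S \<subseteq> U" and \<phi>_S: "\<phi> ` S \<subseteq> U'"
    and hol: "\<phi> holomorphic_on S"
    and X_eq: "\<And>z. z \<in> S \<Longrightarrow> X z = X' (\<phi> z)"
begin

lemma \<phi>_deriv: "z \<in> S \<Longrightarrow> (\<phi> has_field_derivative deriv \<phi> z) (at z)"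
  by (rule holomorphic_derivI[OF hol open_S])

lemma deriv_\<phi>_deriv: "z \<in> S \<Longrightarrow> (deriv \<phi> has_field_derivative deriv (deriv \<phi>) z) (at z)"
  by (rule holomorphic_derivI[OF holomorphic_deriv[OF hol open_S] open_S])

lemma first_derivatives:
  assumes "z \<in> S"
  shows "dx X z = Re (deriv \<phi> z) *\<^sub>R dx X' (\<phi> z) + Im (deriv \<phi> z) *\<^sub>R dy X' (\<phi> z)"
    and "dy X z = Re (deriv \<phi> z) *\<^sub>R dy X' (\<phi> z) - Im (deriv \<phi> z) *\<^sub>R dx X' (\<phi> z)"
proof -
  have "\<phi> z \<in> U'" using \<phi>_S assms by blast
  have "partials X (Re (deriv \<phi> z) *\<^sub>R dx X' (\<phi> z) + Im (deriv \<phi> z) *\<^sub>R dy X' (\<phi> z))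
     (Re (deriv \<phi> z) *\<^sub>R dy X' (\<phi> z) - Im (deriv \<phi> z) *\<^sub>R dx X' (\<phi> z)) z"
    by (rule partials_transform[OF partials_compose_holomorphic[where f = X', OF P'.partials_X[OF \<open>\<phi> z \<in> U'\<close>]
            \<phi>_deriv[OF assms]] open_S assms]) (simp add: X_eq)
  then show "dx X z = Re (deriv \<phi> z) *\<^sub>R dx X' (\<phi> z) + Im (deriv \<phi> z) *\<^sub>R dy X' (\<phi> z)"
    "dy X z = Re (deriv \<phi> z) *\<^sub>R dy X' (\<phi> z) - Im (deriv \<phi> z) *\<^sub>R dx X' (\<phi> z)"
    by (rule partials_imp_dx, rule partials_imp_dy)
qed

lemma conf_factor_change:
  assumes "z \<in> S"
  shows "conf_factor X z = (cmod (deriv \<phi> z))\<^sup>2 * conf_factor X' (\<phi> z)"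
    and deriv_nonzero: "deriv \<phi> z \<noteq> 0"
proof -
  have z: "z \<in> U" "\<phi> z \<in> U'" using assms S \<phi>_S by auto
  have "conf_factor X z = dx X z \<bullet> dx X z" using P.tangent_inner(1)[OF z(1)] by simp
  also have "\<dots> = ((Re (deriv \<phi> z))\<^sup>2 + (Im (deriv \<phi> z))\<^sup>2) * conf_factor X' (\<phi> z)"
    unfolding first_derivatives[OF assms]
    by (simp add: inner_add_left inner_add_right P'.tangent_inner[OF z(2)] power2_eq_square algebra_simps)
  finally show eq: "conf_factor X z = (cmod (deriv \<phi> z))\<^sup>2 * conf_factor X' (\<phi> z)"
    by (simp add: cmod_power2)
  show "deriv \<phi> z \<noteq> 0" using P.rho_pos[OF z(1)] eq by auto
qed

lemma unit_normal_change:
  assumes "z \<in> S"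
  shows "unit_normal X z = unit_normal X' (\<phi> z)"
proof -
  have z: "z \<in> U" "\<phi> z \<in> U'" using assms S \<phi>_S by auto
  have "cross3 (dx X z) (dy X z) = (cmod (deriv \<phi> z))\<^sup>2 *\<^sub>R cross3 (dx X' (\<phi> z)) (dy X' (\<phi> z))"
    unfolding first_derivatives[OF assms] cmod_power2
    by (simp add: vec_eq_iff forall_3 cross3_def power2_eq_square algebra_simps)
  then show ?thesis
    using deriv_nonzero[OF assms] by (simp add: unit_normal_def sgn_scaleR)
qed

text \<open>The second derivative of the coordinate change contributes only tangential terms.\<close>
lemma second_form_change:
  fixes z
  defines "\<alpha> \<equiv> Re (deriv \<phi> z)" and "\<beta> \<equiv> Im (deriv \<phi> z)"
  assumes "z \<in> S"
  shows "P.L z = \<alpha>\<^sup>2 * P'.L (\<phi> z) + 2 * \<alpha> * \<beta> * P'.M (\<phi> z) + \<beta>\<^sup>2 * P'.N (\<phi> z)"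
    and "P.M z = (\<alpha>\<^sup>2 - \<beta>\<^sup>2) * P'.M (\<phi> z) - \<alpha> * \<beta> * (P'.L (\<phi> z) - P'.N (\<phi> z))"
    and "P.N z = \<beta>\<^sup>2 * P'.L (\<phi> z) - 2 * \<alpha> * \<beta> * P'.M (\<phi> z) + \<alpha>\<^sup>2 * P'.N (\<phi> z)"
proof -
  have z: "z \<in> U" "\<phi> z \<in> U'" using assms S \<phi>_S by auto
  let ?d = "deriv (deriv \<phi>) z"
  note d = has_field_derivative_imp_partials[OF deriv_\<phi>_deriv[OF assms(3)]]
  note re = partials_linear[OF bounded_linear_Re d] and im = partials_linear[OF bounded_linear_Im d]
  note Y1 = partials_compose_holomorphic[where f = "dx X'", OF P'.partials_X1[OF z(2)] \<phi>_deriv[OF assms(3)]]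
  note Y2 = partials_compose_holomorphic[where f = "dy X'", OF P'.partials_X2[OF z(2)] \<phi>_deriv[OF assms(3)]]
  have fd: "\<forall>w\<in>S. Re (deriv \<phi> w) *\<^sub>R dx X' (\<phi> w) + Im (deriv \<phi> w) *\<^sub>R dy X' (\<phi> w) = dx X w"
    "\<forall>w\<in>S. Re (deriv \<phi> w) *\<^sub>R dy X' (\<phi> w) - Im (deriv \<phi> w) *\<^sub>R dx X' (\<phi> w) = dy X w"
    by (simp_all add: first_derivatives)
  note 1 = partials_eq_on[OF partials_add[OF partials_scaleR[OF re Y1] partials_scaleR[OF im Y2]]
      open_S assms(3) fd(1)]
  note 2 = partials_eq_on[OF partials_diff[OF partials_scaleR[OF re Y2] partials_scaleR[OF im Y1]]
      open_S assms(3) fd(2)]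
  note eqs = partials_unique[OF 1 P.partials_X1[OF z(1)]] partials_unique[OF 2 P.partials_X2[OF z(1)]]
  show "P.L z = \<alpha>\<^sup>2 * P'.L (\<phi> z) + 2 * \<alpha> * \<beta> * P'.M (\<phi> z) + \<beta>\<^sup>2 * P'.N (\<phi> z)"
    unfolding eqs(1)[THEN conjunct1, symmetric] unit_normal_change[OF assms(3)]
    by (simp add: inner_add_left inner_diff_left P'.normal_inner[OF z(2)] \<alpha>_def \<beta>_def)
      (simp add: power2_eq_square algebra_simps)
  show "P.M z = (\<alpha>\<^sup>2 - \<beta>\<^sup>2) * P'.M (\<phi> z) - \<alpha> * \<beta> * (P'.L (\<phi> z) - P'.N (\<phi> z))"
    unfolding eqs(1)[THEN conjunct2, symmetric] unit_normal_change[OF assms(3)]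
    by (simp add: inner_add_left inner_diff_left P'.normal_inner[OF z(2)] \<alpha>_def \<beta>_def)
      (simp add: power2_eq_square algebra_simps)
  show "P.N z = \<beta>\<^sup>2 * P'.L (\<phi> z) - 2 * \<alpha> * \<beta> * P'.M (\<phi> z) + \<alpha>\<^sup>2 * P'.N (\<phi> z)"
    unfolding eqs(2)[THEN conjunct2, symmetric] unit_normal_change[OF assms(3)]
    by (simp add: inner_add_left inner_diff_left P'.normal_inner[OF z(2)] \<alpha>_def \<beta>_def)
      (simp add: power2_eq_square algebra_simps)
qed

lemma mean_curv_change:
  assumes "z \<in> S"
  shows "mean_curv X z = mean_curv X' (\<phi> z)"
proof -
  have z: "z \<in> U" "\<phi> z \<in> U'" using assms S \<phi>_S by auto
  have "P.L z + P.N z = (cmod (deriv \<phi> z))\<^sup>2 * (P'.L (\<phi> z) + P'.N (\<phi> z))"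
    unfolding second_form_change[OF assms] cmod_power2 by (simp add: algebra_simps)
  then show ?thesis
    using deriv_nonzero[OF assms]
    by (simp add: P.mean_curv_eq[OF z(1)] P'.mean_curv_eq[OF z(2)] conf_factor_change[OF assms])
qed

lemma hopf_change:
  assumes "z \<in> S"
  shows "hopf X z = (deriv \<phi> z)\<^sup>2 * hopf X' (\<phi> z)"
proof -
  have z: "z \<in> U" "\<phi> z \<in> U'" using assms S \<phi>_S by auto
  show ?thesis
    unfolding P.hopf_eq[OF z(1)] P'.hopf_eq[OF z(2)] second_form_change[OF assms]
    by (simp add: complex_eq_iff power2_eq_square) (simp add: algebra_simps)
qed

end

text \<open>If \<open>Y\<close> arises from \<open>X\<close> by an orientation-preserving similarity with ratio \<open>r\<close>, this is the orthogonal part of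
  the similarity, recovered from the frames at \<open>z\<close>.\<close>
definition frame_map :: "real \<Rightarrow> (complex \<Rightarrow> real^3) \<Rightarrow> (complex \<Rightarrow> real^3) \<Rightarrow> complex \<Rightarrow> real^3 \<Rightarrow> real^3" where
  "frame_map r X Y z v = (1 / (r * conf_factor X z)) *\<^sub>R ((v \<bullet> dx X z) *\<^sub>R dx Y z + (v \<bullet> dy X z) *\<^sub>R dy Y z)
     + (v \<bullet> unit_normal X z) *\<^sub>R unit_normal Y z"

lemma frame_map_change:
  assumes X: "coordinate_change X U X' U' \<phi> S" and Y: "coordinate_change Y U Y' U' \<phi> S" and z: "z \<in> S"
  shows "frame_map r X Y z = frame_map r X' Y' (\<phi> z)"
proof
  fix v
  interpret X: coordinate_change X U X' U' \<phi> S by fact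
  interpret Y: coordinate_change Y U Y' U' \<phi> S by fact
  have t: "(v \<bullet> dx X z) *\<^sub>R dx Y z + (v \<bullet> dy X z) *\<^sub>R dy Y z =
     (cmod (deriv \<phi> z))\<^sup>2 *\<^sub>R ((v \<bullet> dx X' (\<phi> z)) *\<^sub>R dx Y' (\<phi> z) + (v \<bullet> dy X' (\<phi> z)) *\<^sub>R dy Y' (\<phi> z))"
    unfolding X.first_derivatives[OF z] Y.first_derivatives[OF z] cmod_power2
    by (simp add: vec_eq_iff inner_add_right inner_diff_right power2_eq_square algebra_simps)
  show "frame_map r X Y z v = frame_map r X' Y' (\<phi> z) v"
    unfolding frame_map_def t using X.deriv_nonzero[OF z]
    by (simp add: X.conf_factor_change[OF z] X.unit_normal_change[OF z] Y.unit_normal_change[OF z])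
qed

section \<open>Two surfaces over the same coordinate domain\<close>

locale patch_pair = F: conformal_patch X U + G: conformal_patch Y U for X Y U
begin

lemma preserved_moebius_factor:
  assumes z: "z \<in> U" and moe: "moebius_factor Y z = moebius_factor X z"
  defines "m \<equiv> sqrt (conf_factor Y z / conf_factor X z)"
  shows "m > 0" "conf_factor Y z = m\<^sup>2 * conf_factor X z" "cmod (hopf Y z) = m * cmod (hopf X z)"
proof -
  have r: "conf_factor X z > 0" "conf_factor Y z > 0" using F.rho_pos[OF z] G.rho_pos[OF z] by auto
  then show m: "m > 0" and my: "conf_factor Y z = m\<^sup>2 * conf_factor X z" by (auto simp: m_def)
  have "(cmod (hopf Y z))\<^sup>2 = (m * cmod (hopf X z))\<^sup>2"
    using moe r m unfolding F.moebius_factor_eq[OF z] G.moebius_factor_eq[OF z] my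
    by (simp add: field_simps power_mult_distrib)
  then show "cmod (hopf Y z) = m * cmod (hopf X z)"
    using m by (simp add: power2_eq_iff_nonneg)
qed

text \<open>With \<open>s = 2|Q|/\<rho>\<close> the cross-multiplied ratio \<open>(H' + s') (H - s) = (H + s) (H' - s')\<close> reduces to
  \<open>s' H = s H'\<close>, and the Moebius metric gives \<open>s' = s/m\<close>.\<close>
lemma preserved_mean_curv:
  assumes z: "z \<in> U" and moe: "moebius_factor Y z = moebius_factor X z"
    and ratio: "max_curv Y z * min_curv X z = max_curv X z * min_curv Y z"
    and Q: "hopf X z \<noteq> 0"
  shows "mean_curv Y z = mean_curv X z / sqrt (conf_factor Y z / conf_factor X z)"
proof -
  define m where "m = sqrt (conf_factor Y z / conf_factor X z)"
  note mm = preserved_moebius_factor[OF z moe, folded m_def]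
  define s where "s = 2 * cmod (hopf X z) / conf_factor X z"
  have s: "s > 0" using Q F.rho_pos[OF z] by (simp add: s_def)
  have s': "2 * cmod (hopf Y z) / conf_factor Y z = s / m"
    using mm(1) F.rho_pos[OF z] unfolding mm(2,3) s_def by (simp add: power2_eq_square)
  have "(mean_curv Y z + s / m) * (mean_curv X z - s) = (mean_curv X z + s) * (mean_curv Y z - s / m)"
    using ratio unfolding F.max_curv_eq[OF z] G.max_curv_eq[OF z] F.min_curv_eq[OF z] G.min_curv_eq[OF z] s'
    by (simp add: s_def)
  then have "(2 * s) * (mean_curv X z / m) = (2 * s) * mean_curv Y z" by (simp add: algebra_simps)
  moreover have "2 * s \<noteq> 0" using s by simp
  ultimately have "mean_curv X z / m = mean_curv Y z" using mult_left_cancel by blast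
  then show ?thesis by (simp add: m_def)
qed

text \<open>By the Gauss equation \<open>u = log (\<rho>'/\<rho>)\<close> is harmonic. Its complex derivative \<open>g = u\<^sub>x - \<i> u\<^sub>y\<close> is therefore
  holomorphic, and a primitive \<open>p\<close> of \<open>g\<close> has real part \<open>u\<close> up to a constant.\<close>
lemma harmonic_log_ratio:
  assumes B: "ball a e \<subseteq> U"
    and K: "\<And>z. z \<in> ball a e \<Longrightarrow>
      gauss_curv Y z * conf_factor Y z = gauss_curv X z * conf_factor X z"
  obtains f where "f holomorphic_on ball a e"
    "\<And>z. z \<in> ball a e \<Longrightarrow> cmod (f z) = sqrt (conf_factor Y z / conf_factor X z)"
proof -
  define PX where "PX z = 2 * (dx (dx X) z \<bullet> dx X z) * inverse (conf_factor X z)" for z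
  define RX where "RX z = 2 * (dy (dx X) z \<bullet> dx X z) * inverse (conf_factor X z)" for z
  define PY where "PY z = 2 * (dx (dx Y) z \<bullet> dx Y z) * inverse (conf_factor Y z)" for z
  define RY where "RY z = 2 * (dy (dx Y) z \<bullet> dx Y z) * inverse (conf_factor Y z)" for z
  define g where "g z = of_real (PY z - PX z) - \<i> * of_real (RY z - RX z)" for z
  define u where "u z = ln (conf_factor Y z) - ln (conf_factor X z)" for z
  have U: "z \<in> U" if "z \<in> ball a e" for z using that B by blast
  have "\<exists>d. (g has_field_derivative d) (at z)" if z: "z \<in> ball a e" for z
  proof -
    obtain a b c where X: "partials PX a b z" "partials RX b c z" "a + c = - 2 * gauss_curv X z * conf_factor X z"
      using F.gauss_equation(2)[OF U[OF z]] unfolding PX_def[symmetric] RX_def[symmetric] by blast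
    obtain a' b' c' where Y: "partials PY a' b' z" "partials RY b' c' z" "a' + c' = - 2 * gauss_curv Y z * conf_factor Y z"
      using G.gauss_equation(2)[OF U[OF z]] unfolding PY_def[symmetric] RY_def[symmetric] by blast
    have "a + c = a' + c'" using X(3) Y(3) K[OF z] by (simp add: mult.assoc)
    have "partials g (of_real (a' - a) - \<i> * of_real (b' - b)) (of_real (b' - b) - \<i> * of_real (c' - c)) z"
      unfolding g_def
      by (rule partials_diff[OF partials_of_real[OF partials_diff[OF Y(1) X(1)]]
            partials_linear[OF bounded_linear_mult_right partials_of_real[OF partials_diff[OF Y(2) X(2)]]]])
    moreover have "of_real (b' - b) - \<i> * of_real (c' - c) = \<i> * (of_real (a' - a) - \<i> * of_real (b' - b))"
      using \<open>a + c = a' + c'\<close> by (simp add: complex_eq_iff)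
    ultimately show ?thesis using partials_imp_has_field_derivative by metis
  qed
  then have "g holomorphic_on ball a e"
    by (simp add: holomorphic_on_open)
  then obtain p where p: "\<And>z. z \<in> ball a e \<Longrightarrow> (p has_field_derivative g z) (at z within ball a e)"
    using holomorphic_convex_primitive'[OF convex_ball open_ball] by blast
  then have p': "(p has_field_derivative g z) (at z)" if "z \<in> ball a e" for z
    using that by (metis at_within_open open_ball)
  define k where "k = Re (p a) - u a"
  have k: "Re (p z) - u z = k" if z: "z \<in> ball a e" for z
    unfolding k_def
  proof (rule partials_zero_imp_constant[OF open_ball connected_ball _ z, of "\<lambda>z. Re (p z) - u z"])
    show "a \<in> ball a e" using z by (metis ball_eq_empty centre_in_ball empty_iff not_le)
    fix w assume w: "w \<in> ball a e"
    have "partials u (PY w - PX w) (RY w - RX w) w"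
      unfolding u_def PX_def PY_def RX_def RY_def
      by (rule partials_diff[OF G.gauss_equation(1)[OF U[OF w]] F.gauss_equation(1)[OF U[OF w]]])
    from partials_diff[OF partials_linear[OF bounded_linear_Re has_field_derivative_imp_partials[OF p'[OF w]]] this]
    show "partials (\<lambda>z. Re (p z) - u z) 0 0 w" by (rule partials_eq_rhs) (simp_all add: g_def)
  qed
  show thesis
  proof (rule that)
    show "(\<lambda>z. exp ((p z - of_real k) / 2)) holomorphic_on ball a e"
    proof -
      have "p holomorphic_on ball a e" unfolding holomorphic_on_open[OF open_ball] using p' by blast
      then show ?thesis by (intro holomorphic_intros) auto
    qed
    fix z assume z: "z \<in> ball a e"
    have r: "conf_factor X z > 0" "conf_factor Y z > 0" using F.rho_pos[OF U[OF z]] G.rho_pos[OF U[OF z]] by auto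
    have "cmod (exp ((p z - of_real k) / 2)) = exp (u z / 2)" using k[OF z] by simp
    also have "\<dots> = sqrt (exp (u z))" 
      by (rule real_sqrt_unique[symmetric]) (simp_all add: power2_eq_square flip: exp_add)
    also have "exp (u z) = conf_factor Y z / conf_factor X z" using r by (simp add: u_def exp_diff)
    finally show "cmod (exp ((p z - of_real k) / 2)) = sqrt (conf_factor Y z / conf_factor X z)" .
  qed
qed

end

context patch_pair
begin

text \<open>With \<open>\<lambda> = 1/k\<^sup>2\<close> the second mean curvature is \<open>H' = H k \<kappa>\<close>, where \<open>\<kappa>\<close> is the conjugate of \<open>k\<close>. As \<open>\<lambda>\<close> is
  holomorphic, \<open>Q'\<^sub>\<zbar> = \<lambda> Q\<^sub>\<zbar>\<close>, and the Codazzi equations turn this into \<open>H'\<^sub>z = \<kappa>\<^sup>2 H\<^sub>z\<close>. Inserting \<open>H'\<close> gives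
  \<open>(k - \<kappa>) H\<^sub>z + k' H = 0\<close>, that is \<open>(H (k - \<kappa>))\<^sub>z = 0\<close>.\<close>
lemma mean_curv_times_Im_constant:
  assumes B: "ball a e \<subseteq> U" and lam: "lam holomorphic_on ball a e"
    and rho: "\<And>z. z \<in> ball a e \<Longrightarrow> conf_factor Y z = (cmod (lam z))\<^sup>2 * conf_factor X z"
    and H: "\<And>z. z \<in> ball a e \<Longrightarrow> mean_curv Y z = 1 / cmod (lam z) * mean_curv X z"
    and Q: "\<And>z. z \<in> ball a e \<Longrightarrow> hopf Y z = lam z * hopf X z"
  obtains k c where "k holomorphic_on ball a e" "\<And>z. z \<in> ball a e \<Longrightarrow> lam z * (k z)\<^sup>2 = 1"
    "\<And>z. z \<in> ball a e \<Longrightarrow> mean_curv X z * Im (k z) = c"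
proof -
  have nz: "lam z \<noteq> 0" if "z \<in> ball a e" for z
    using rho[OF that] G.rho_pos[of z] B that by auto
  have inv: "(\<lambda>z. inverse (lam z)) holomorphic_on ball a e"
    using lam nz by (intro holomorphic_intros)
  obtain k where k: "k holomorphic_on ball a e"
    "\<And>z. z \<in> ball a e \<Longrightarrow> inverse (lam z) = (k z)\<^sup>2"
  proof (rule contractible_imp_holomorphic_sqrt[OF inv])
    show "contractible (ball a e)" by (simp add: convex_imp_contractible)
    show "inverse (lam z) \<noteq> 0" if "z \<in> ball a e" for z using nz[OF that] by simp
  qed blast
  have k2: "lam z * (k z)\<^sup>2 = 1" if "z \<in> ball a e" for z
    using k(2)[OF that] nz[OF that] by (metis right_inverse)
  have "partials (\<lambda>z. mean_curv X z * Im (k z)) 0 0 z" if z: "z \<in> ball a e" for z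
  proof -
    have zU: "z \<in> U" using z B by blast
    obtain h1 h2 q1 q2 where X: "partials (mean_curv X) h1 h2 z" "partials (hopf X) q1 q2 z"
      "q1 + \<i> * q2 = of_real (conf_factor X z / 2) * (of_real h1 - \<i> * of_real h2)"
      by (rule F.codazzi[OF zU])
    obtain h1' h2' q1' q2' where Y: "partials (mean_curv Y) h1' h2' z" "partials (hopf Y) q1' q2' z"
      "q1' + \<i> * q2' = of_real (conf_factor Y z / 2) * (of_real h1' - \<i> * of_real h2')"
      by (rule G.codazzi[OF zU])
    define \<eta> where "\<eta> = complex_of_real h1 - \<i> * of_real h2"
    define \<eta>' where "\<eta>' = complex_of_real h1' - \<i> * of_real h2'"
    define l where "l = deriv lam z"
    define K where "K = k z"
    define K' where "K' = deriv k z"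
    have lz: "partials lam l (\<i> * l) z"
      unfolding l_def by (rule has_field_derivative_imp_partials[OF holomorphic_derivI[OF lam open_ball z]])
    have kz: "partials k K' (\<i> * K') z"
      unfolding K'_def by (rule has_field_derivative_imp_partials[OF holomorphic_derivI[OF k(1) open_ball z]])
    have "partials (hopf Y) (l * hopf X z + lam z * q1) (\<i> * l * hopf X z + lam z * q2) z"
      using Q by (intro partials_eq_on[OF partials_mult[OF lz X(2)] open_ball z]) simp
    from partials_unique[OF this Y(2)]
    have "q1' + \<i> * q2' = (l * hopf X z + lam z * q1) + \<i> * (\<i> * l * hopf X z + lam z * q2)" by simp
    also have "\<dots> = lam z * (q1 + \<i> * q2)" by (simp add: algebra_simps)
    finally have "of_real ((cmod (lam z))\<^sup>2) * (of_real (conf_factor X z / 2) * \<eta>') =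
        lam z * (of_real (conf_factor X z / 2) * \<eta>)"
      unfolding Y(3) X(3) rho[OF z] by (simp add: \<eta>_def \<eta>'_def)
    then have "of_real (conf_factor X z / 2) * (of_real ((cmod (lam z))\<^sup>2) * \<eta>') =
        of_real (conf_factor X z / 2) * (lam z * \<eta>)"
      by (simp add: mult.left_commute mult.commute)
    then have "of_real ((cmod (lam z))\<^sup>2) * \<eta>' = lam z * \<eta>"
      using F.rho_pos[OF zU] by simp
    then have "lam z * (cnj (lam z) * \<eta>') = lam z * \<eta>"
      unfolding complex_norm_square mult.assoc .
    then have "cnj (lam z) * \<eta>' = \<eta>" using nz[OF z] by simp
    then have "cnj (lam z * K\<^sup>2) * \<eta>' = cnj K ^ 2 * \<eta>" by (simp add: algebra_simps)
    \<comment> \<open>Here \<open>\<eta> = 2 H\<^sub>z\<close> and \<open>\<eta>' = 2 H'\<^sub>z\<close>; the two formulas for \<open>\<eta>'\<close> come from Codazzi and from the product rule.\<close>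
    then have 1: "\<eta>' = (cnj K)\<^sup>2 * \<eta>" using k2[OF z] by (simp add: K_def)
    have HY: "mean_curv Y w = mean_curv X w * (k w * cnj (k w))" if "w \<in> ball a e" for w
    proof -
      have "cmod (lam w) * (cmod (k w))\<^sup>2 = 1" using k2[OF that] by (metis norm_mult norm_one norm_power)
      then have "1 / cmod (lam w) = (cmod (k w))\<^sup>2" by (metis divide_eq_eq mult.commute zero_neq_one mult_zero_left)
      then show ?thesis unfolding H[OF that] by (simp add: complex_norm_square[symmetric])
    qed
    have "partials (\<lambda>w. complex_of_real (mean_curv Y w))
       (of_real h1 * (K * cnj K) + of_real (mean_curv X z) * (K' * cnj K + K * cnj K'))
       (of_real h2 * (K * cnj K) + of_real (mean_curv X z) * (\<i> * K' * cnj K + K * cnj (\<i> * K'))) z"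
      unfolding K_def using HY
      by (intro partials_eq_on[OF partials_mult[OF partials_of_real[OF X(1)]
              partials_mult[OF kz partials_linear[OF bounded_linear_cnj kz]]] open_ball z]) simp
    from partials_unique[OF this partials_of_real[OF Y(1)]]
    have "\<eta>' = (of_real h1 * (K * cnj K) + of_real (mean_curv X z) * (K' * cnj K + K * cnj K'))
       - \<i> * (of_real h2 * (K * cnj K) + of_real (mean_curv X z) * (\<i> * K' * cnj K + K * cnj (\<i> * K')))"
      unfolding \<eta>'_def by simp
    then have 2: "\<eta>' = K * cnj K * \<eta> + 2 * of_real (mean_curv X z) * K' * cnj K"
      by (simp add: \<eta>_def algebra_simps)
    have "K \<noteq> 0" using k2[OF z] by (auto simp: K_def)
    have "cnj K * (cnj K * \<eta>) = cnj K * (K * \<eta> + 2 * of_real (mean_curv X z) * K')"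
      using 1 2 by (simp add: algebra_simps power2_eq_square)
    then have "cnj K * \<eta> = K * \<eta> + 2 * of_real (mean_curv X z) * K'"
      using \<open>K \<noteq> 0\<close> by simp
    then have "(K - cnj K) * \<eta> + 2 * of_real (mean_curv X z) * K' = 0" by (simp add: algebra_simps)
    then have "h1 * Im K + mean_curv X z * Im K' = 0" "h2 * Im K + mean_curv X z * Re K' = 0"
      by (auto simp: \<eta>_def complex_eq_iff algebra_simps)
    then show ?thesis
      using partials_mult[OF X(1) partials_linear[OF bounded_linear_Im kz]] by (simp add: K_def)
  qed
  then have "mean_curv X z * Im (k z) = mean_curv X a * Im (k a)" if "z \<in> ball a e" for z
    using that by (intro partials_zero_imp_constant[OF open_ball connected_ball])
      (auto simp: dist_norm intro: le_less_trans[OF norm_ge_zero])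
  then show thesis using that k(1) k2 by metis
qed

end

locale scaled_pair = patch_pair +
  fixes r :: real
  assumes r: "r > 0"
    and rho_scaled: "\<And>z. z \<in> U \<Longrightarrow> conf_factor Y z = r\<^sup>2 * conf_factor X z"
    and H_scaled: "\<And>z. z \<in> U \<Longrightarrow> mean_curv Y z = 1 / r * mean_curv X z"
    and Q_scaled: "\<And>z. z \<in> U \<Longrightarrow> hopf Y z = of_real r * hopf X z"
begin

lemma second_form_scaled:
  assumes "z \<in> U"
  shows "G.L z = r * F.L z" "G.M z = r * F.M z" "G.N z = r * F.N z"
proof -
  have "G.L z + G.N z = 2 * (r\<^sup>2 * conf_factor X z) * mean_curv Y z"
    using r F.rho_pos[OF assms] unfolding G.mean_curv_eq[OF assms] rho_scaled[OF assms] by simp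
  also have "\<dots> = r * (F.L z + F.N z)"
    using r F.rho_pos[OF assms] unfolding H_scaled[OF assms] F.mean_curv_eq[OF assms]
    by (simp add: power2_eq_square)
  finally have sum: "G.L z + G.N z = r * (F.L z + F.N z)" .
  have "G.L z - G.N z = r * (F.L z - F.N z)" and M: "G.M z = r * F.M z"
    using Q_scaled[OF assms] unfolding F.hopf_eq[OF assms] G.hopf_eq[OF assms]
    by (auto simp: complex_eq_iff)
  with sum show "G.L z = r * F.L z" "G.M z = r * F.M z" "G.N z = r * F.N z"
    by (auto simp: algebra_simps)
qed

lemma christoffel_scaled:
  assumes "z \<in> U"
  shows "dx (dx Y) z \<bullet> dx Y z = r\<^sup>2 * (dx (dx X) z \<bullet> dx X z)"
    "dy (dx Y) z \<bullet> dx Y z = r\<^sup>2 * (dy (dx X) z \<bullet> dx X z)"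
proof -
  have "partials (conf_factor Y) (r\<^sup>2 * (2 * (dx (dx X) z \<bullet> dx X z))) (r\<^sup>2 * (2 * (dy (dx X) z \<bullet> dx X z))) z"
    using rho_scaled
    by (intro partials_eq_on[OF partials_linear[OF bounded_linear_mult_right F.partials_rho[OF assms]]
          F.open_U assms]) simp
  from partials_unique[OF this G.partials_rho[OF assms]]
  show "dx (dx Y) z \<bullet> dx Y z = r\<^sup>2 * (dx (dx X) z \<bullet> dx X z)"
    "dy (dx Y) z \<bullet> dx Y z = r\<^sup>2 * (dy (dx X) z \<bullet> dx X z)" by simp_all
qed

text \<open>Both frames solve the same linear system, the equations of Gauss and Weingarten.\<close>
lemma frame_map_stationary:
  assumes z: "z \<in> U"
  shows "partials (\<lambda>z. frame_map r X Y z v) 0 0 z"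
proof -
  define p q where "p = dx (dx X) z \<bullet> dx X z" and "q = dy (dx X) z \<bullet> dx X z"
  let ?\<rho> = "conf_factor X z"
  have \<rho>: "?\<rho> > 0" by (rule F.rho_pos[OF z])
  have chr: "dx (dx X) z \<bullet> dx X z = p" "dy (dx X) z \<bullet> dx X z = q" "dy (dx X) z \<bullet> dy X z = p"
    "dy (dy X) z \<bullet> dy X z = q" "dx (dx X) z \<bullet> dy X z = - q" "dy (dy X) z \<bullet> dx X z = - p"
    using F.christoffel[OF z] by (simp_all add: p_def q_def)
  have chr': "dx (dx Y) z \<bullet> dx Y z = r\<^sup>2 * p" "dy (dx Y) z \<bullet> dx Y z = r\<^sup>2 * q"
    "dy (dx Y) z \<bullet> dy Y z = r\<^sup>2 * p" "dy (dy Y) z \<bullet> dy Y z = r\<^sup>2 * q"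
    "dx (dx Y) z \<bullet> dy Y z = - (r\<^sup>2 * q)" "dy (dy Y) z \<bullet> dx Y z = - (r\<^sup>2 * p)"
    using G.christoffel[OF z] christoffel_scaled[OF z] by (simp_all add: p_def q_def)
  have c: "partials (\<lambda>z. 1 / (r * conf_factor X z)) (- (2 * p) / (r * ?\<rho>\<^sup>2)) (- (2 * q) / (r * ?\<rho>\<^sup>2)) z"
  proof -
    have "partials (\<lambda>z. (1 / r) * inverse (conf_factor X z)) ((1 / r) * (- (2 * p) / ?\<rho>\<^sup>2)) ((1 / r) * (- (2 * q) / ?\<rho>\<^sup>2)) z"
      unfolding p_def q_def
      by (rule partials_linear[OF bounded_linear_mult_right partials_inverse[OF F.partials_rho[OF z]]])
        (use \<rho> in simp)
    then show ?thesis by (simp add: divide_inverse mult.commute mult.left_commute)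
  qed
  have v: "partials (\<lambda>z. v \<bullet> f z) (v \<bullet> a) (v \<bullet> b) z" if "partials f a b z" for f a b
    by (rule partials_linear[OF bounded_linear_inner_right that])
  note P = partials_add[OF partials_scaleR[OF c partials_add[OF
        partials_scaleR[OF v[OF F.partials_X1[OF z]] G.partials_X1[OF z]]
        partials_scaleR[OF v[OF F.partials_X2[OF z]] G.partials_X2[OF z]]]]
      partials_scaleR[OF v[OF F.partials_normal[OF z]] G.partials_normal[OF z]]]
  have ve: "v \<bullet> dx (dx X) z = ((v \<bullet> dx X z) * p - (v \<bullet> dy X z) * q) / ?\<rho> + (v \<bullet> unit_normal X z) * F.L z"
    "v \<bullet> dy (dx X) z = ((v \<bullet> dx X z) * q + (v \<bullet> dy X z) * p) / ?\<rho> + (v \<bullet> unit_normal X z) * F.M z"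
    "v \<bullet> dy (dy X) z = ((v \<bullet> dy X z) * q - (v \<bullet> dx X z) * p) / ?\<rho> + (v \<bullet> unit_normal X z) * F.N z"
    unfolding F.inner_frame[OF z, of v "dx (dx X) z"] F.inner_frame[OF z, of v "dy (dx X) z"]
      F.inner_frame[OF z, of v "dy (dy X) z"] chr
    by (simp_all add: add_divide_distrib diff_divide_distrib)
  have zero: "w = 0" if "w \<bullet> dx Y z = 0" "w \<bullet> dy Y z = 0" "w \<bullet> unit_normal Y z = 0" for w
    using G.frame_expansion[OF z, of w] that by simp
  note simps = inner_add_left inner_diff_left inner_diff_right inner_add_right ve chr' second_form_scaled[OF z]
    G.tangent_inner[OF z] G.normal_inner[OF z] F.tangent_inner[OF z] F.normal_inner[OF z] rho_scaled[OF z]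
  show ?thesis
    unfolding frame_map_def
    by (rule partials_eq_rhs[OF P]; rule zero; (insert r \<rho>, simp add: simps, simp add: field_simps power2_eq_square))
qed

lemma frame_map_orthogonal:
  assumes z: "z \<in> U"
  shows "orthogonal_transformation (frame_map r X Y z)"
  unfolding orthogonal_transformation_def
proof (intro conjI allI)
  show "linear (frame_map r X Y z)"
    by (rule linearI) (simp_all add: frame_map_def inner_add_left algebra_simps)
  show "frame_map r X Y z v \<bullet> frame_map r X Y z w = v \<bullet> w" for v w
    unfolding frame_map_def F.inner_frame[OF z, of v w] using r F.rho_pos[OF z]
    by (simp add: inner_add_left inner_add_right G.tangent_inner[OF z] G.normal_inner[OF z] rho_scaled[OF z])
      (simp add: field_simps power2_eq_square)
qed

lemma frame_map_tangent:
  assumes z: "z \<in> U"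
  shows "frame_map r X Y z (dx X z) = (1 / r) *\<^sub>R dx Y z" "frame_map r X Y z (dy X z) = (1 / r) *\<^sub>R dy Y z"
  using r F.rho_pos[OF z]
  by (simp_all add: frame_map_def F.tangent_inner[OF z] F.normal_inner[OF z])

text \<open>The frame map is constant and takes the differential of \<open>X\<close> to that of \<open>Y\<close> divided by \<open>r\<close>, so
  \<open>Y\<close> and \<open>r B X\<close> differ by a constant.\<close>
lemma similar_on_ball:
  assumes B: "ball a e \<subseteq> U" and z: "z \<in> ball a e"
  shows "frame_map r X Y z = frame_map r X Y a"
    and "Y z - r *\<^sub>R frame_map r X Y a (X z) = Y a - r *\<^sub>R frame_map r X Y a (X a)"
proof -
  have a: "a \<in> ball a e" using z by (metis ball_eq_empty centre_in_ball empty_iff not_le)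
  have fm: "frame_map r X Y w = frame_map r X Y a" if "w \<in> ball a e" for w
    using partials_zero_imp_constant[OF open_ball connected_ball _ that a] frame_map_stationary B by blast
  then show "frame_map r X Y z = frame_map r X Y a" using z .
  have "partials (\<lambda>w. Y w - r *\<^sub>R frame_map r X Y a (X w)) 0 0 w" if w: "w \<in> ball a e" for w
  proof -
    have U: "w \<in> U" "a \<in> U" using B w a by auto
    have "bounded_linear (frame_map r X Y a)"
      using frame_map_orthogonal[OF U(2)] orthogonal_transformation_linear linear_conv_bounded_linear by blast
    from partials_diff[OF G.partials_X[OF U(1)] partials_linear[OF bounded_linear_scaleR_right[of r]
        partials_linear[OF this F.partials_X[OF U(1)]]]]
    show ?thesis
      by (rule partials_eq_rhs) (use r in \<open>simp_all add: fm[OF w, symmetric] frame_map_tangent[OF U(1)]\<close>)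
  qed
  then show "Y z - r *\<^sub>R frame_map r X Y a (X z) = Y a - r *\<^sub>R frame_map r X Y a (X a)"
    using partials_zero_imp_constant[OF open_ball connected_ball _ z a] by blast
qed

end

section \<open>Surfaces over a Riemann surface\<close>

locale riemann =
  fixes M :: "'m::t2_space set" and A :: "'m chart set"
  assumes RS: "riemann_surface M A"
begin

lemma connected_M: "connected M"
  and M_eq: "\<Union> (chart_dom ` A) = M"
  using RS unfolding riemann_surface_def by auto

lemma openin_chart_dom: "c \<in> A \<Longrightarrow> openin (top_of_set M) (chart_dom c)"
  and open_chart_img: "c \<in> A \<Longrightarrow> open (chart_img c)"
  and homeo: "c \<in> A \<Longrightarrow> homeomorphism (chart_dom c) (chart_img c) (coord c) (coord_inv c)"
  and transition: "c \<in> A \<Longrightarrow> d \<in> A \<Longrightarrow>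
        in_chart c (coord d) holomorphic_on coord c ` (chart_dom c \<inter> chart_dom d)"
  using RS unfolding riemann_surface_def by auto

lemma chart_dom_subset: "c \<in> A \<Longrightarrow> chart_dom c \<subseteq> M"
  using M_eq by blast

lemma chart_exists: "p \<in> M \<Longrightarrow> \<exists>c\<in>A. p \<in> chart_dom c"
  using M_eq by blast

lemma coord_in: "p \<in> chart_dom c \<Longrightarrow> coord c p \<in> chart_img c"
  unfolding chart_img_def by blast

lemma coord_inv_coord: "c \<in> A \<Longrightarrow> p \<in> chart_dom c \<Longrightarrow> coord_inv c (coord c p) = p"
  using homeo homeomorphism_apply1 by metis

lemma coord_inv_in: "c \<in> A \<Longrightarrow> z \<in> chart_img c \<Longrightarrow> coord_inv c z \<in> chart_dom c"
  using homeomorphism_image2[OF homeo] by blast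

lemma coord_coord_inv: "c \<in> A \<Longrightarrow> z \<in> chart_img c \<Longrightarrow> coord c (coord_inv c z) = z"
  using homeo homeomorphism_apply2 by metis

lemma in_chart_coord: "c \<in> A \<Longrightarrow> p \<in> chart_dom c \<Longrightarrow> in_chart c f (coord c p) = f p"
  by (simp add: in_chart_def coord_inv_coord)

lemma open_coord_image:
  assumes c: "c \<in> A" and V: "openin (top_of_set M) V"
  shows "open (coord c ` (chart_dom c \<inter> V))"
proof -
  have "openin (top_of_set (chart_dom c)) (chart_dom c \<inter> V)"
    using V chart_dom_subset[OF c] unfolding openin_open by blast
  then have "openin (top_of_set (chart_img c)) (coord c ` (chart_dom c \<inter> V))"
    by (rule homeomorphism_imp_open_map[OF homeo[OF c]])
  then show ?thesis using open_chart_img[OF c] by (metis openin_open_eq)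
qed

lemma openin_coord_inv_image:
  assumes c: "c \<in> A" and S: "open S" "S \<subseteq> chart_img c"
  shows "openin (top_of_set M) (coord_inv c ` S)"
proof -
  have "openin (top_of_set (chart_img c)) S" using S by (simp add: openin_open_eq open_chart_img[OF c])
  then have "openin (top_of_set (chart_dom c)) (coord_inv c ` S)"
    by (rule homeomorphism_imp_open_map[OF homeomorphism_symD[OF homeo[OF c]]])
  then show ?thesis using openin_chart_dom[OF c] by (rule openin_trans)
qed

lemma coordinate_disc:
  assumes c: "c \<in> A" and V: "openin (top_of_set M) V" and p: "p \<in> chart_dom c" "p \<in> V"
  obtains e where "e > 0" "ball (coord c p) e \<subseteq> chart_img c"
    "openin (top_of_set M) (coord_inv c ` ball (coord c p) e)"
    "p \<in> coord_inv c ` ball (coord c p) e"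
    "coord_inv c ` ball (coord c p) e \<subseteq> chart_dom c \<inter> V"
    "path_connected (coord_inv c ` ball (coord c p) e)"
proof -
  have "coord c p \<in> coord c ` (chart_dom c \<inter> V)" using p by blast
  then obtain e where e: "e > 0" "ball (coord c p) e \<subseteq> coord c ` (chart_dom c \<inter> V)"
    using open_coord_image[OF c V] by (meson openE)
  have sub: "ball (coord c p) e \<subseteq> chart_img c" using e(2) unfolding chart_img_def by blast
  have "continuous_on (chart_img c) (coord_inv c)" using homeo[OF c] unfolding homeomorphism_def by blast
  then have pc: "path_connected (coord_inv c ` ball (coord c p) e)"
    using sub by (intro path_connected_continuous_image convex_imp_path_connected)
      (auto intro: continuous_on_subset)
  have "coord_inv c z \<in> chart_dom c \<inter> V" if "z \<in> ball (coord c p) e" for z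
  proof -
    have "z \<in> coord c ` (chart_dom c \<inter> V)" using that e(2) by (rule rev_subsetD)
    then obtain q where "q \<in> chart_dom c \<inter> V" "z = coord c q" by blast
    then show ?thesis using coord_inv_coord[OF c] by simp
  qed
  then have "coord_inv c ` ball (coord c p) e \<subseteq> chart_dom c \<inter> V" by blast
  moreover have "p \<in> coord_inv c ` ball (coord c p) e"
    using coord_inv_coord[OF c p(1)] e(1) by (metis centre_in_ball image_eqI)
  ultimately show thesis
    using that[OF e(1) sub openin_coord_inv_image[OF c open_ball sub]] pc by blast
qed

lemma patch:
  "conformal_immersion A F \<Longrightarrow> c \<in> A \<Longrightarrow> conformal_patch (in_chart c F) (chart_img c)"
  unfolding conformal_immersion_def conformal_patch_def using open_chart_img by blast

lemma change:
  assumes F: "conformal_immersion A F" and c: "c \<in> A" and d: "d \<in> A"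
  shows "coordinate_change (in_chart c F) (chart_img c) (in_chart d F) (chart_img d)
           (in_chart c (coord d)) (coord c ` (chart_dom c \<inter> chart_dom d))"
proof -
  interpret P: conformal_patch "in_chart c F" "chart_img c" by (rule patch[OF F c])
  interpret P': conformal_patch "in_chart d F" "chart_img d" by (rule patch[OF F d])
  show ?thesis
  proof
    show "open (coord c ` (chart_dom c \<inter> chart_dom d))"
      by (rule open_coord_image[OF c openin_chart_dom[OF d]])
    show "coord c ` (chart_dom c \<inter> chart_dom d) \<subseteq> chart_img c" unfolding chart_img_def by blast
    show "in_chart c (coord d) ` coord c ` (chart_dom c \<inter> chart_dom d) \<subseteq> chart_img d"
      using c by (auto simp: in_chart_coord intro: coord_in)
    show "in_chart c (coord d) holomorphic_on coord c ` (chart_dom c \<inter> chart_dom d)"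
      by (rule transition[OF c d])
    show "in_chart c F z = in_chart d F (in_chart c (coord d) z)"
      if "z \<in> coord c ` (chart_dom c \<inter> chart_dom d)" for z
      using that c d by (auto simp: in_chart_coord)
  qed
qed

lemma mean_curv_chart_indep:
  assumes "conformal_immersion A F" "c \<in> A" "d \<in> A" "p \<in> chart_dom c" "p \<in> chart_dom d"
  shows "mean_curv (in_chart c F) (coord c p) = mean_curv (in_chart d F) (coord d p)"
proof -
  interpret coordinate_change "in_chart c F" "chart_img c" "in_chart d F" "chart_img d"
    "in_chart c (coord d)" "coord c ` (chart_dom c \<inter> chart_dom d)" by (rule change[OF assms(1-3)])
  show ?thesis using mean_curv_change[of "coord c p"] assms by (simp add: in_chart_coord)
qed

lemma hopf_chart_zero:
  assumes "conformal_immersion A F" "c \<in> A" "d \<in> A" "p \<in> chart_dom c" "p \<in> chart_dom d"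
  shows "hopf (in_chart c F) (coord c p) = 0 \<longleftrightarrow> hopf (in_chart d F) (coord d p) = 0"
proof -
  interpret coordinate_change "in_chart c F" "chart_img c" "in_chart d F" "chart_img d"
    "in_chart c (coord d)" "coord c ` (chart_dom c \<inter> chart_dom d)" by (rule change[OF assms(1-3)])
  have "coord c p \<in> coord c ` (chart_dom c \<inter> chart_dom d)" using assms by blast
  then show ?thesis using hopf_change[of "coord c p"] deriv_nonzero[of "coord c p"] assms
    by (simp add: in_chart_coord)
qed

lemma data_ratios_chart_indep:
  assumes F: "conformal_immersion A F" and G: "conformal_immersion A G" and c: "c \<in> A" "d \<in> A"
    and p: "p \<in> chart_dom c" "p \<in> chart_dom d"
  shows "hopf (in_chart c G) (coord c p) / hopf (in_chart c F) (coord c p) =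
         hopf (in_chart d G) (coord d p) / hopf (in_chart d F) (coord d p)" (is ?h)
    and "conf_factor (in_chart c G) (coord c p) / conf_factor (in_chart c F) (coord c p) =
         conf_factor (in_chart d G) (coord d p) / conf_factor (in_chart d F) (coord d p)" (is ?r)
    and "frame_map r (in_chart c F) (in_chart c G) (coord c p) =
         frame_map r (in_chart d F) (in_chart d G) (coord d p)" (is ?f)
proof -
  interpret F: coordinate_change "in_chart c F" "chart_img c" "in_chart d F" "chart_img d"
    "in_chart c (coord d)" "coord c ` (chart_dom c \<inter> chart_dom d)" by (rule change[OF F c])
  interpret G: coordinate_change "in_chart c G" "chart_img c" "in_chart d G" "chart_img d"
    "in_chart c (coord d)" "coord c ` (chart_dom c \<inter> chart_dom d)" by (rule change[OF G c])
  have z: "coord c p \<in> coord c ` (chart_dom c \<inter> chart_dom d)" using p by blast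
  have tr: "in_chart c (coord d) (coord c p) = coord d p" using c p by (simp add: in_chart_coord)
  show ?h ?r
    using F.hopf_change[OF z] G.hopf_change[OF z] F.conf_factor_change[OF z] G.conf_factor_change[OF z]
    unfolding tr by simp_all
  show ?f using frame_map_change[OF F.coordinate_change_axioms G.coordinate_change_axioms z] unfolding tr .
qed

end

locale preserving_pair = riemann M A for M :: "'m::t2_space set" and A +
  fixes F G :: "'m \<Rightarrow> real^3"
  assumes F: "conformal_immersion A F" and def: "preserving_deformation A F G"
begin

lemma G: "conformal_immersion A G" and moebius: "same_moebius_metric A F G"
  and ratio: "same_curv_ratio A F G"
  using def unfolding preserving_deformation_def by auto

lemma pair: "c \<in> A \<Longrightarrow> patch_pair (in_chart c F) (in_chart c G) (chart_img c)"
  unfolding patch_pair_def using patch F G by blast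

text \<open>The Hopf differentials determine \<open>\<lambda>\<close> away from the umbilic points; at an umbilic point only
  the modulus of \<open>\<lambda>\<close> is determined.\<close>
definition dilation :: "'m \<Rightarrow> complex" where
  "dilation p = (let c = (SOME c. c \<in> A \<and> p \<in> chart_dom c); X = in_chart c F; Y = in_chart c G; z = coord c p
     in if hopf X z = 0 then of_real (sqrt (conf_factor Y z / conf_factor X z)) else hopf Y z / hopf X z)"

lemma dilation_eq:
  assumes d: "d \<in> A" and z: "z \<in> chart_img d"
  shows "in_chart d dilation z =
    (if hopf (in_chart d F) z = 0 then of_real (sqrt (conf_factor (in_chart d G) z / conf_factor (in_chart d F) z))
     else hopf (in_chart d G) z / hopf (in_chart d F) z)"
proof -
  define p where "p = coord_inv d z"
  have p: "p \<in> chart_dom d" "coord d p = z"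
    using coord_inv_in[OF d z] coord_coord_inv[OF d z] by (simp_all add: p_def)
  define c where "c = (SOME c. c \<in> A \<and> p \<in> chart_dom c)"
  have "c \<in> A \<and> p \<in> chart_dom c" unfolding c_def by (rule someI[of _ d]) (use d p in blast)
  then have c: "c \<in> A" "p \<in> chart_dom c" by auto
  have "in_chart d dilation z = dilation p" by (simp add: in_chart_def p_def)
  then show ?thesis
    using hopf_chart_zero[OF F c(1) d c(2) p(1)] data_ratios_chart_indep(1,2)[OF F G c(1) d c(2) p(1)]
    unfolding dilation_def c_def[symmetric] Let_def p(2) by simp
qed

lemma cmod_dilation:
  assumes d: "d \<in> A" and z: "z \<in> chart_img d"
  shows "cmod (in_chart d dilation z) = sqrt (conf_factor (in_chart d G) z / conf_factor (in_chart d F) z)"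
    (is "_ = ?m")
proof -
  interpret patch_pair "in_chart d F" "in_chart d G" "chart_img d" by (rule pair[OF d])
  have moe: "moebius_factor (in_chart d G) z = moebius_factor (in_chart d F) z"
    using moebius d z unfolding same_moebius_metric_def by blast
  have m: "?m > 0" "cmod (hopf (in_chart d G) z) = ?m * cmod (hopf (in_chart d F) z)"
    using preserved_moebius_factor[OF z moe] by auto
  show ?thesis
  proof (cases "hopf (in_chart d F) z = 0")
    case True
    then show ?thesis using m(1) unfolding dilation_eq[OF d z] by simp
  next
    case False
    then show ?thesis using m(2) unfolding dilation_eq[OF d z] by (simp add: norm_divide)
  qed
qed

text \<open>An umbilic point in one chart is umbilic in all of them, so the density of the non-umbilic points in \<open>M\<close>
  can be tested in the chart \<open>c\<close>.\<close>
lemma non_umbilic_dense: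
  assumes dense: "M \<subseteq> closure (non_umbilic_points A F)" and c: "c \<in> A"
    and S: "open S" "S \<subseteq> chart_img c" "S \<noteq> {}"
  obtains z where "z \<in> S" "hopf (in_chart c F) z \<noteq> 0"
proof -
  obtain O' where O': "open O'" "coord_inv c ` S = M \<inter> O'"
    using openin_coord_inv_image[OF c S(1,2)] unfolding openin_open by blast
  obtain p where p: "p \<in> coord_inv c ` S" using S(3) by blast
  then have "p \<in> closure (non_umbilic_points A F)" "p \<in> O'" using O' dense by auto
  then have "O' \<inter> non_umbilic_points A F \<noteq> {}"
    using open_Int_closure_eq_empty[OF O'(1)] by blast
  then obtain q where q: "q \<in> O'" "q \<in> non_umbilic_points A F" by blast
  from q(2) obtain d where d: "d \<in> A" "q \<in> chart_dom d" "moebius_factor (in_chart d F) (coord d q) \<noteq> 0"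
    unfolding non_umbilic_points_def by blast
  interpret D: conformal_patch "in_chart d F" "chart_img d" by (rule patch[OF F d(1)])
  have hd: "hopf (in_chart d F) (coord d q) \<noteq> 0"
    using d(3) D.moebius_factor_eq[OF coord_in[OF d(2)]] by auto
  have "q \<in> M" using chart_dom_subset[OF d(1)] d(2) by blast
  then have "q \<in> coord_inv c ` S" using q(1) O'(2) by blast
  then obtain z where z: "z \<in> S" "q = coord_inv c z" by blast
  then have zc: "z \<in> chart_img c" using S(2) by blast
  then have "coord c q = z" "q \<in> chart_dom c" using coord_coord_inv[OF c] coord_inv_in[OF c] z(2) by auto
  then show thesis using that[OF z(1)] hd hopf_chart_zero[OF F c d(1) _ d(2)] by blast
qed

text \<open>Both sides are continuous, and they agree at the non-umbilic points, which are dense.\<close>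
lemma mean_curv_dilation:
  assumes dense: "M \<subseteq> closure (non_umbilic_points A F)" and c: "c \<in> A" and z: "z \<in> chart_img c"
  shows "mean_curv (in_chart c G) z =
    mean_curv (in_chart c F) z / sqrt (conf_factor (in_chart c G) z / conf_factor (in_chart c F) z)"
proof (rule ccontr)
  interpret patch_pair "in_chart c F" "in_chart c G" "chart_img c" by (rule pair[OF c])
  let ?g = "\<lambda>z. mean_curv (in_chart c G) z -
    mean_curv (in_chart c F) z / sqrt (conf_factor (in_chart c G) z / conf_factor (in_chart c F) z)"
  assume "\<not> ?thesis"
  then have ne: "?g z \<noteq> 0" by simp
  have "continuous_on (chart_img c) (conf_factor (in_chart c F))"
    "continuous_on (chart_img c) (conf_factor (in_chart c G))"
    using F.partials_rho G.partials_rho partials_imp_isCont continuous_at_imp_continuous_on by metis+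
  moreover have "conf_factor (in_chart c F) w > 0" "conf_factor (in_chart c G) w > 0"
    if "w \<in> chart_img c" for w using F.rho_pos[OF that] G.rho_pos[OF that] by auto
  ultimately have "continuous_on (chart_img c) ?g"
    by (intro continuous_intros F.continuous_on_mean_curv G.continuous_on_mean_curv) (force simp: less_le)+
  then have "open (chart_img c \<inter> ?g -` (- {0}))"
    using continuous_open_preimage open_chart_img[OF c] by blast
  moreover have "z \<in> chart_img c \<inter> ?g -` (- {0})" using z ne by simp
  ultimately obtain w where w: "w \<in> chart_img c \<inter> ?g -` (- {0})" "hopf (in_chart c F) w \<noteq> 0"
    using non_umbilic_dense[OF dense c, of "chart_img c \<inter> ?g -` (- {0})"] by blast
  have "moebius_factor (in_chart c G) w = moebius_factor (in_chart c F) w"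
    "max_curv (in_chart c G) w * min_curv (in_chart c F) w = max_curv (in_chart c F) w * min_curv (in_chart c G) w"
    using moebius ratio c w unfolding same_moebius_metric_def same_curv_ratio_def by blast+
  then have "?g w = 0" using preserved_mean_curv[of w] w by simp
  then show False using w by simp
qed

lemma deformed_by_dilation:
  assumes dense: "M \<subseteq> closure (non_umbilic_points A F)"
  shows "deformed_by A F G dilation"
  unfolding deformed_by_def
proof (intro ballI)
  fix c z assume c: "c \<in> A" and z: "z \<in> chart_img c"
  interpret patch_pair "in_chart c F" "in_chart c G" "chart_img c" by (rule pair[OF c])
  have moe: "moebius_factor (in_chart c G) z = moebius_factor (in_chart c F) z"
    using moebius c z unfolding same_moebius_metric_def by blast
  note m = preserved_moebius_factor[OF z moe]
  have "hopf (in_chart c G) z = in_chart c dilation z * hopf (in_chart c F) z"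
    using m(3) unfolding dilation_eq[OF c z] by auto
  then show "conf_factor (in_chart c G) z = (cmod (in_chart c dilation z))\<^sup>2 * conf_factor (in_chart c F) z \<and>
        mean_curv (in_chart c G) z = 1 / cmod (in_chart c dilation z) * mean_curv (in_chart c F) z \<and>
        hopf (in_chart c G) z = in_chart c dilation z * hopf (in_chart c F) z"
    using m(2) mean_curv_dilation[OF dense c z] unfolding cmod_dilation[OF c z] by simp
qed

end

locale deformed_pair = preserving_pair M A F G for M :: "'m::t2_space set" and A F G +
  fixes lam :: "'m \<Rightarrow> complex"
  assumes lam: "deformed_by A F G lam"
begin

lemma conf_factor_lam:
  "c \<in> A \<Longrightarrow> z \<in> chart_img c \<Longrightarrow>
     conf_factor (in_chart c G) z = (cmod (in_chart c lam z))\<^sup>2 * conf_factor (in_chart c F) z"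
  and mean_curv_lam:
  "c \<in> A \<Longrightarrow> z \<in> chart_img c \<Longrightarrow>
     mean_curv (in_chart c G) z = 1 / cmod (in_chart c lam z) * mean_curv (in_chart c F) z"
  and hopf_lam:
  "c \<in> A \<Longrightarrow> z \<in> chart_img c \<Longrightarrow>
     hopf (in_chart c G) z = in_chart c lam z * hopf (in_chart c F) z"
  using lam unfolding deformed_by_def by blast+

lemma lam_chart_nonzero: "c \<in> A \<Longrightarrow> z \<in> chart_img c \<Longrightarrow> in_chart c lam z \<noteq> 0"
  using conf_factor_lam[of c z] conformal_patch.rho_pos[OF patch[OF G], of c z] by auto

lemma lam_nonzero:
  assumes "p \<in> M"
  shows "lam p \<noteq> 0"
proof -
  obtain c where "c \<in> A" "p \<in> chart_dom c" using chart_exists[OF assms] by blast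
  then show ?thesis using lam_chart_nonzero[of c "coord c p"] by (simp add: coord_in in_chart_coord)
qed

text \<open>The form \<open>K \<rho>\<close> is the difference of \<open>H\<^sup>2 \<rho>\<close> and the Moebius factor \<open>(H\<^sup>2 - K) \<rho>\<close>, and both are preserved.\<close>
lemma modulus_local:
  assumes c: "c \<in> A" and B: "ball a e \<subseteq> chart_img c"
  obtains f where "f holomorphic_on ball a e"
    "\<And>z. z \<in> ball a e \<Longrightarrow> cmod (f z) = cmod (in_chart c lam z)"
proof -
  interpret patch_pair "in_chart c F" "in_chart c G" "chart_img c" by (rule pair[OF c])
  have K: "gauss_curv (in_chart c G) z * conf_factor (in_chart c G) z =
      gauss_curv (in_chart c F) z * conf_factor (in_chart c F) z" if "z \<in> ball a e" for z
  proof -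
    have z: "z \<in> chart_img c" using that B by blast
    have "moebius_factor (in_chart c G) z = moebius_factor (in_chart c F) z"
      using moebius c z unfolding same_moebius_metric_def by blast
    moreover have "(mean_curv (in_chart c G) z)\<^sup>2 * conf_factor (in_chart c G) z =
        (mean_curv (in_chart c F) z)\<^sup>2 * conf_factor (in_chart c F) z"
      using lam_chart_nonzero[OF c z]
      by (simp add: conf_factor_lam[OF c z] mean_curv_lam[OF c z] power_divide)
    ultimately show ?thesis unfolding moebius_factor_def by (simp add: left_diff_distrib)
  qed
  obtain f where f: "f holomorphic_on ball a e"
    "\<And>z. z \<in> ball a e \<Longrightarrow> cmod (f z) = sqrt (conf_factor (in_chart c G) z / conf_factor (in_chart c F) z)"
    using harmonic_log_ratio[OF B K] by blast
  have "cmod (f z) = cmod (in_chart c lam z)" if "z \<in> ball a e" for z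
  proof -
    have z: "z \<in> chart_img c" using that B by blast
    show ?thesis using F.rho_pos[OF z] by (simp add: f(2)[OF that] conf_factor_lam[OF c z])
  qed
  then show thesis using that f(1) by blast
qed

end

section \<open>The modulus of the deformation factor\<close>

context riemann
begin

lemma holomorphic_fun_chart:
  assumes hol: "holomorphic_fun A V g" and c: "c \<in> A" and S: "coord_inv c ` S \<subseteq> V" "S \<subseteq> chart_img c"
  shows "in_chart c g holomorphic_on S"
proof -
  have "z \<in> coord c ` (chart_dom c \<inter> V)" if "z \<in> S" for z
  proof -
    have "coord_inv c z \<in> chart_dom c \<inter> V" "coord c (coord_inv c z) = z"
      using that S coord_inv_in[OF c] coord_coord_inv[OF c] by auto
    then show ?thesis by (metis imageI)
  qed
  then have "S \<subseteq> coord c ` (chart_dom c \<inter> V)" by (rule subsetI)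
  moreover have "in_chart c g holomorphic_on coord c ` (chart_dom c \<inter> V)"
    using hol c unfolding holomorphic_fun_def by blast
  ultimately show ?thesis using holomorphic_on_subset by blast
qed

lemma holomorphic_fun_of_disc:
  assumes c: "c \<in> A" and f: "f holomorphic_on B" and W: "W \<subseteq> chart_dom c" "coord c ` W \<subseteq> B"
  shows "holomorphic_fun A W (\<lambda>p. k * f (coord c p))"
  unfolding holomorphic_fun_def
proof
  fix d assume d: "d \<in> A"
  have sub: "coord d ` (chart_dom d \<inter> W) \<subseteq> coord d ` (chart_dom d \<inter> chart_dom c)" using W(1) by blast
  have "in_chart d (coord c) holomorphic_on coord d ` (chart_dom d \<inter> W)"
    using transition[OF d c] sub by (rule holomorphic_on_subset)
  moreover have "in_chart d (coord c) ` coord d ` (chart_dom d \<inter> W) \<subseteq> B"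
    using W d by (auto simp: in_chart_coord)
  ultimately have "(f \<circ> in_chart d (coord c)) holomorphic_on coord d ` (chart_dom d \<inter> W)"
    using f holomorphic_on_compose_gen by blast
  then have "(\<lambda>z. k * (f \<circ> in_chart d (coord c)) z) holomorphic_on coord d ` (chart_dom d \<inter> W)"
    by (rule holomorphic_on_mult[OF holomorphic_on_const])
  then show "in_chart d (\<lambda>p. k * f (coord c p)) holomorphic_on coord d ` (chart_dom d \<inter> W)"
    by (simp add: in_chart_def comp_def)
qed

lemma openin_chart_subset:
  "openin (top_of_set M) V \<Longrightarrow> openin (top_of_set V) W \<longleftrightarrow> openin (top_of_set M) W \<and> W \<subseteq> V"
  by (meson openin_imp_subset openin_subset_trans openin_trans)

lemma chart_locally_constant:
  assumes "\<And>c p. c \<in> A \<Longrightarrow> p \<in> chart_dom c \<Longrightarrow>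
     \<exists>e>0. ball (coord c p) e \<subseteq> chart_img c \<and> (\<forall>z\<in>ball (coord c p) e. f (coord_inv c z) = f p)"
  shows "f constant_on M"
proof (rule locally_constant_imp_constant[OF connected_M])
  fix p assume "p \<in> M"
  then obtain c where c: "c \<in> A" "p \<in> chart_dom c" using chart_exists by blast
  obtain e where e: "e > 0" "ball (coord c p) e \<subseteq> chart_img c"
    "\<forall>z\<in>ball (coord c p) e. f (coord_inv c z) = f p" using assms[OF c] by blast
  have "p \<in> coord_inv c ` ball (coord c p) e"
    using coord_inv_coord[OF c] e(1) by (metis centre_in_ball image_eqI)
  then show "\<exists>T. openin (top_of_set M) T \<and> p \<in> T \<and> (\<forall>q\<in>T. f q = f p)"
    using openin_coord_inv_image[OF c(1) open_ball e(2)] e(3) by blast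
qed

lemma chart_ball:
  assumes "c \<in> A" "z \<in> chart_img c"
  obtains e where "e > 0" "ball z e \<subseteq> chart_img c"
  using open_chart_img[OF assms(1)] assms(2) by (meson openE)

end

context deformed_pair
begin

text \<open>The local solutions \<open>g\<close> of the problem \<open>|g| = |\<lambda>|\<close>; they are the sheets of a covering.\<close>
definition moduli :: "'m set \<Rightarrow> ('m set \<times> ('m \<Rightarrow> complex)) set" where
  "moduli V = {(W, g). openin (top_of_set V) W \<and> holomorphic_fun A W g \<and> (\<forall>p\<in>W. cmod (g p) = cmod (lam p))}"

text \<open>Two solutions have a quotient that is holomorphic of modulus one, hence locally constant; multiplying one
  solution on a disc by unimodular constants gives all values of the right modulus at a given point.\<close>
lemma local_sections_moduli:
  assumes V: "openin (top_of_set M) V"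
  shows "local_sections V (moduli V) (\<lambda>p. {v. cmod v = cmod (lam p)})"
proof
  show "g x \<in> {v. cmod v = cmod (lam x)}" if "(W, g) \<in> moduli V" "x \<in> W" for W g x
    using that unfolding moduli_def by auto
next
  fix W g W' g' x assume P: "(W, g) \<in> moduli V" "(W', g') \<in> moduli V" and x: "x \<in> W \<inter> W'"
  have W: "openin (top_of_set M) W" "openin (top_of_set M) W'" "W \<subseteq> V" "holomorphic_fun A W g"
      "holomorphic_fun A W' g'" "\<And>p. p \<in> W \<Longrightarrow> cmod (g p) = cmod (lam p)"
      "\<And>p. p \<in> W' \<Longrightarrow> cmod (g' p) = cmod (lam p)"
    using P unfolding moduli_def openin_chart_subset[OF V] by auto
  have o: "openin (top_of_set M) (W \<inter> W')" using W(1,2) by (rule openin_Int)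
  have WM: "W \<subseteq> M" using W(1) openin_imp_subset by blast
  then obtain c where c: "c \<in> A" "x \<in> chart_dom c" using chart_exists x by blast
  obtain e where e: "e > 0" "ball (coord c x) e \<subseteq> chart_img c"
    "openin (top_of_set M) (coord_inv c ` ball (coord c x) e)"
    "x \<in> coord_inv c ` ball (coord c x) e"
    "coord_inv c ` ball (coord c x) e \<subseteq> chart_dom c \<inter> (W \<inter> W')"
    "path_connected (coord_inv c ` ball (coord c x) e)"
    by (rule coordinate_disc[OF c(1) o c(2) x])
  let ?B = "ball (coord c x) e"
  define q where "q = (\<lambda>z. in_chart c g z / in_chart c g' z)"
  have nz: "in_chart c g' z \<noteq> 0" and mod1: "cmod (q z) = 1" if "z \<in> ?B" for z
  proof -
    have p: "coord_inv c z \<in> W" "coord_inv c z \<in> W'" using e(5) that by auto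
    then have "lam (coord_inv c z) \<noteq> 0" using lam_nonzero WM by blast
    then have "cmod (g' (coord_inv c z)) \<noteq> 0" using W(7)[OF p(2)] by simp
    moreover have "cmod (g (coord_inv c z)) = cmod (g' (coord_inv c z))" using W(6,7) p by simp
    ultimately show "in_chart c g' z \<noteq> 0" "cmod (q z) = 1"
      unfolding q_def in_chart_def by (auto simp: norm_divide)
  qed
  have "in_chart c g holomorphic_on ?B" "in_chart c g' holomorphic_on ?B"
    using e(5) by (auto intro!: holomorphic_fun_chart[OF W(4) c(1) _ e(2)] holomorphic_fun_chart[OF W(5) c(1) _ e(2)])
  then have "q holomorphic_on ?B" unfolding q_def using nz by (intro holomorphic_on_divide)
  then have const: "q z = q (coord c x)" if "z \<in> ?B" for z
    using constant_modulus_imp_constant[of q "coord c x" e z "coord c x"] mod1 that e(1) by simp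
  have "(g y = g' y) = (q (coord c x) = 1)" if y: "y \<in> coord_inv c ` ?B" for y
  proof -
    obtain z where z: "z \<in> ?B" "y = coord_inv c z" using y by blast
    have "q z = g y / g' y" "g' y \<noteq> 0" using nz[OF z(1)] z(2) by (simp_all add: q_def in_chart_def)
    then show ?thesis using const[OF z(1)] by auto
  qed
  moreover have "openin (top_of_set V) (coord_inv c ` ?B)"
    unfolding openin_chart_subset[OF V] using e(3,5) W(3) by blast
  ultimately show "\<exists>N. openin (top_of_set V) N \<and> x \<in> N \<and> N \<subseteq> W \<inter> W' \<and>
              ((\<forall>y\<in>N. g y = g' y) \<or> (\<forall>y\<in>N. g y \<noteq> g' y))"
    using e(4,5) by (intro exI[of _ "coord_inv c ` ?B"]) auto
next
  fix x assume x: "x \<in> V"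
  then have "x \<in> M" using V openin_imp_subset by blast
  then obtain c where c: "c \<in> A" "x \<in> chart_dom c" using chart_exists by blast
  obtain e where e: "e > 0" "ball (coord c x) e \<subseteq> chart_img c"
    "openin (top_of_set M) (coord_inv c ` ball (coord c x) e)"
    "x \<in> coord_inv c ` ball (coord c x) e"
    "coord_inv c ` ball (coord c x) e \<subseteq> chart_dom c \<inter> V"
    "path_connected (coord_inv c ` ball (coord c x) e)"
    by (rule coordinate_disc[OF c(1) V c(2) x])
  let ?B = "ball (coord c x) e"
  let ?W = "coord_inv c ` ?B"
  obtain f where f: "f holomorphic_on ?B" "\<And>z. z \<in> ?B \<Longrightarrow> cmod (f z) = cmod (in_chart c lam z)"
    using modulus_local[OF c(1) e(2)] by blast
  have oW: "openin (top_of_set V) ?W"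
    unfolding openin_chart_subset[OF V] using e(3,5) by blast
  have cW: "coord c y \<in> ?B" "cmod (f (coord c y)) = cmod (lam y)" if y: "y \<in> ?W" for y
  proof -
    obtain z where z: "z \<in> ?B" "y = coord_inv c z" using y by blast
    then have "coord c y = z" using coord_coord_inv[OF c(1)] e(2) by blast
    then show "coord c y \<in> ?B" "cmod (f (coord c y)) = cmod (lam y)"
      using z f(2)[OF z(1)] by (simp_all add: in_chart_def)
  qed
  have "\<exists>g. (?W, g) \<in> moduli V \<and> g y = v" if y: "y \<in> ?W" and v: "v \<in> {v. cmod v = cmod (lam y)}" for y v
  proof -
    have ly: "lam y \<noteq> 0" using y e(5) V lam_nonzero openin_imp_subset by blast
    let ?k = "v / f (coord c y)"
    have "holomorphic_fun A ?W (\<lambda>p. ?k * f (coord c p))"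
      by (rule holomorphic_fun_of_disc[OF c(1) f(1)]) (use e(5) cW(1) in auto)
    moreover have "cmod (?k * f (coord c p)) = cmod (lam p)" if "p \<in> ?W" for p
      using cW(2)[OF that] cW(2)[OF y] v ly by (simp add: norm_mult norm_divide)
    moreover have "?k * f (coord c y) = v" using cW(2)[OF y] ly by auto
    ultimately show ?thesis using oW unfolding moduli_def by blast
  qed
  then show "\<exists>W. openin (top_of_set V) W \<and> x \<in> W \<and> path_connected W \<and>
          (\<forall>y\<in>W. \<forall>v\<in>{v. cmod v = cmod (lam y)}. \<exists>g. (W, g) \<in> moduli V \<and> g y = v)"
    using oW e(4,6) by blast
qed

theorem modulus_global:
  assumes V: "openin (top_of_set M) V" and sc: "simply_connected V"
  shows "\<exists>f. holomorphic_fun A V f \<and> (\<forall>p\<in>V. cmod (lam p) = cmod (f p))"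
proof (cases "V = {}")
  case True
  then show ?thesis by (simp add: holomorphic_fun_def holomorphic_on_def)
next
  case False
  then obtain x0 where x0: "x0 \<in> V" by blast
  interpret local_sections V "moduli V" "\<lambda>p. {v. cmod v = cmod (lam p)}"
    by (rule local_sections_moduli[OF V])
  obtain f where f: "lift V (\<lambda>x. x) f"
    using global_section[OF sc x0, of "lam x0"] by blast
  have "holomorphic_fun A V f"
    unfolding holomorphic_fun_def
  proof
    fix c assume c: "c \<in> A"
    have "in_chart c f field_differentiable at z" if z: "z \<in> coord c ` (chart_dom c \<inter> V)" for z
    proof -
      obtain p where p: "p \<in> chart_dom c" "p \<in> V" "z = coord c p" using z by blast
      obtain W g N where N: "(W, g) \<in> moduli V" "openin (top_of_set V) N" "p \<in> N"
        "\<forall>t\<in>N. t \<in> W \<and> f t = g t" using f p(2) unfolding lift_def by blast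
      have oN: "openin (top_of_set M) N" using N(2) V by (rule openin_trans)
      let ?S = "coord c ` (chart_dom c \<inter> N)"
      have S: "open ?S" "z \<in> ?S" using open_coord_image[OF c oN] p N(3) by blast+
      have "holomorphic_fun A W g" using N(1) unfolding moduli_def by blast
      then have "in_chart c g holomorphic_on ?S"
        by (rule holomorphic_fun_chart[OF _ c]) (use N(4) coord_inv_coord[OF c] in \<open>auto intro: coord_in\<close>)
      moreover have "in_chart c g w = in_chart c f w" if "w \<in> ?S" for w
        using that N(4) c by (auto simp: in_chart_coord)
      ultimately have "in_chart c f holomorphic_on ?S" using holomorphic_cong by metis
      then show ?thesis using S holomorphic_on_imp_differentiable_at by blast
    qed
    then show "in_chart c f holomorphic_on coord c ` (chart_dom c \<inter> V)"
      unfolding holomorphic_on_def using field_differentiable_at_within by blast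
  qed
  moreover have "cmod (lam p) = cmod (f p)" if "p \<in> V" for p
    using lift_in_fibre[OF f that] by simp
  ultimately show ?thesis by blast
qed

section \<open>Holomorphic deformation factors and harmonic inverse mean curvature\<close>

text \<open>The uniqueness part of the fundamental theorem of surfaces. The linear part of the similarity is the frame map,
  which is the same in all charts and locally constant, hence constant on the connected \<open>M\<close>.\<close>
lemma positive_constant_imp_similar:
  assumes r: "r > 0" and const: "\<And>p. p \<in> M \<Longrightarrow> lam p = of_real r"
  shows "similar_surfaces M F G"
proof -
  have sp: "scaled_pair (in_chart c F) (in_chart c G) (chart_img c) r" if c: "c \<in> A" for c
  proof -
    interpret patch_pair "in_chart c F" "in_chart c G" "chart_img c" by (rule pair[OF c])
    have l: "in_chart c lam z = of_real r" if "z \<in> chart_img c" for z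
      using const coord_inv_in[OF c that] chart_dom_subset[OF c] by (auto simp: in_chart_def)
    show ?thesis
      by unfold_locales (use r l conf_factor_lam[OF c] mean_curv_lam[OF c] hopf_lam[OF c] in simp_all)
  qed
  define ch where "ch p = (SOME c. c \<in> A \<and> p \<in> chart_dom c)" for p
  have ch: "ch p \<in> A \<and> p \<in> chart_dom (ch p)" if "p \<in> M" for p
    unfolding ch_def by (rule someI_ex) (use chart_exists[OF that] in blast)
  define B where "B p = frame_map r (in_chart (ch p) F) (in_chart (ch p) G) (coord (ch p) p)" for p
  have B: "B p = frame_map r (in_chart c F) (in_chart c G) (coord c p)"
    if c: "c \<in> A" and p: "p \<in> chart_dom c" for c p
    unfolding B_def using data_ratios_chart_indep(3)[OF F G _ c _ p] ch chart_dom_subset[OF c] p by blast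
  have loc: "\<exists>e>0. ball (coord c p) e \<subseteq> chart_img c \<and>
      (\<forall>z\<in>ball (coord c p) e. B (coord_inv c z) = B p \<and>
         G (coord_inv c z) - r *\<^sub>R B p (F (coord_inv c z)) = G p - r *\<^sub>R B p (F p))"
    if c: "c \<in> A" and p: "p \<in> chart_dom c" for c p
  proof -
    interpret scaled_pair "in_chart c F" "in_chart c G" "chart_img c" r by (rule sp[OF c])
    obtain e where e: "e > 0" "ball (coord c p) e \<subseteq> chart_img c"
      by (rule chart_ball[OF c coord_in[OF p]])
    have "B (coord_inv c z) = B p \<and>
         G (coord_inv c z) - r *\<^sub>R B p (F (coord_inv c z)) = G p - r *\<^sub>R B p (F p)"
      if z: "z \<in> ball (coord c p) e" for z
    proof -
      have zc: "z \<in> chart_img c" using z e(2) by blast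
      show ?thesis
        using similar_on_ball[OF e(2) z] B[OF c coord_inv_in[OF c zc]] B[OF c p]
        by (simp add: coord_coord_inv[OF c zc] in_chart_coord[OF c p]) (simp add: in_chart_def)
    qed
    then show ?thesis using e by blast
  qed
  have "B constant_on M" by (rule chart_locally_constant) (use loc in blast)
  then obtain B0 where B0: "\<And>p. p \<in> M \<Longrightarrow> B p = B0" unfolding constant_on_def by blast
  have "(\<lambda>p. G p - r *\<^sub>R B0 (F p)) constant_on M"
  proof (rule chart_locally_constant)
    fix c p assume "c \<in> A" "p \<in> chart_dom c"
    moreover then have "B p = B0" using B0 chart_dom_subset by blast
    ultimately show "\<exists>e>0. ball (coord c p) e \<subseteq> chart_img c \<and> (\<forall>z\<in>ball (coord c p) e.
        G (coord_inv c z) - r *\<^sub>R B0 (F (coord_inv c z)) = G p - r *\<^sub>R B0 (F p))"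
      using loc[of c p] by fastforce
  qed
  then obtain b where b: "\<And>p. p \<in> M \<Longrightarrow> G p - r *\<^sub>R B0 (F p) = b" unfolding constant_on_def by blast
  have "M \<noteq> {}" using RS unfolding riemann_surface_def by blast
  then obtain p c where p: "p \<in> M" "c \<in> A" "p \<in> chart_dom c" using chart_exists by blast
  interpret scaled_pair "in_chart c F" "in_chart c G" "chart_img c" r by (rule sp[OF p(2)])
  have "orthogonal_transformation B0"
    using frame_map_orthogonal[OF coord_in[OF p(3)]] B[OF p(2,3)] B0[OF p(1)] by simp
  moreover have "G q = r *\<^sub>R B0 (F q) + b" if "q \<in> M" for q using b[OF that] by (simp add: algebra_simps)
  ultimately show ?thesis using r unfolding similar_surfaces_def by blast
qed

lemma holomorphic_real_constant:
  assumes hol: "holomorphic_fun A M lam" and c: "c \<in> A" and B: "ball a e \<subseteq> chart_img c"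
    and real: "\<And>z. z \<in> ball a e \<Longrightarrow> Im (in_chart c lam z) = 0" and z: "z \<in> ball a e" "w \<in> ball a e"
  shows "in_chart c lam z = in_chart c lam w"
proof (rule partials_zero_imp_constant[OF open_ball connected_ball _ z])
  fix y assume y: "y \<in> ball a e"
  have h: "in_chart c lam holomorphic_on ball a e"
    by (rule holomorphic_fun_chart[OF hol c _ B]) (use coord_inv_in[OF c] chart_dom_subset[OF c] B in blast)
  let ?d = "deriv (in_chart c lam) y"
  have p: "partials (in_chart c lam) ?d (\<i> * ?d) y"
    by (rule has_field_derivative_imp_partials[OF holomorphic_derivI[OF h open_ball y]])
  have "partials (\<lambda>y. Im (in_chart c lam y)) 0 0 y"
    by (rule partials_eq_on[OF partials_const[of 0] open_ball y]) (simp add: real)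
  from partials_unique[OF this partials_linear[OF bounded_linear_Im p]]
  have "?d = 0" by (simp add: complex_eq_iff)
  then show "partials (in_chart c lam) 0 0 y" using p by simp
qed

text \<open>By the identity theorem, applied in coordinate discs, the points near which \<open>\<lambda> = k\<close> form an open and
  closed set.\<close>
lemma constant_near_imp_constant:
  assumes hol: "holomorphic_fun A M lam" and c: "c0 \<in> A" and B0: "ball a0 e0 \<subseteq> chart_img c0" "e0 > 0"
    and const: "\<And>z. z \<in> ball a0 e0 \<Longrightarrow> in_chart c0 lam z = k"
    and p: "p \<in> M"
  shows "lam p = k"
proof -
  define near where "near p \<longleftrightarrow> (\<exists>N. openin (top_of_set M) N \<and> p \<in> N \<and> (\<forall>q\<in>N. lam q = k))" for p
  have "near constant_on M"
  proof (rule chart_locally_constant)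
    fix c p assume c: "c \<in> A" and p: "p \<in> chart_dom c"
    obtain e where e: "e > 0" "ball (coord c p) e \<subseteq> chart_img c"
      by (rule chart_ball[OF c coord_in[OF p]])
    let ?B = "ball (coord c p) e"
    have h: "in_chart c lam holomorphic_on ?B"
      by (rule holomorphic_fun_chart[OF hol c _ e(2)]) (use coord_inv_in[OF c] chart_dom_subset[OF c] e(2) in blast)
    have oB: "openin (top_of_set M) (coord_inv c ` ?B)" by (rule openin_coord_inv_image[OF c open_ball e(2)])
    have all: "near (coord_inv c w)" if z: "z \<in> ?B" "near (coord_inv c z)" and w: "w \<in> ?B" for z w
    proof -
      obtain N where N: "openin (top_of_set M) N" "coord_inv c z \<in> N" "\<forall>q\<in>N. lam q = k"
        using z(2) unfolding near_def by blast
      have zc: "z \<in> chart_img c" using z(1) e(2) by blast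
      let ?S = "coord c ` (chart_dom c \<inter> N) \<inter> ?B"
      have S: "open ?S" using open_coord_image[OF c N(1)] by blast
      have "z \<in> coord c ` (chart_dom c \<inter> N)"
        using N(2) coord_inv_in[OF c zc] coord_coord_inv[OF c zc] by (metis IntI imageI)
      then have ne: "?S \<noteq> {}" using z(1) by blast
      have eq: "in_chart c lam y = k" if "y \<in> ?S" for y
        using that N(3) c by (auto simp: in_chart_coord)
      have "in_chart c lam y = k" if "y \<in> ?B" for y
        by (rule analytic_continuation_open[OF S open_ball ne connected_ball _ h holomorphic_on_const eq that]) auto
      then have "\<forall>q\<in>coord_inv c ` ?B. lam q = k" by (auto simp: in_chart_def)
      then show ?thesis unfolding near_def using oB w by blast
    qed
    have "coord c p \<in> ?B" using e(1) by simp
    then have "near (coord_inv c z) = near p" if "z \<in> ?B" for z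
      using all[of z "coord c p"] all[of "coord c p" z] that coord_inv_coord[OF c p] by auto
    then show "\<exists>e>0. ball (coord c p) e \<subseteq> chart_img c \<and> (\<forall>z\<in>ball (coord c p) e. near (coord_inv c z) = near p)"
      using e by blast
  qed
  moreover have "near (coord_inv c0 a0)"
    unfolding near_def
  proof (intro exI conjI)
    show "openin (top_of_set M) (coord_inv c0 ` ball a0 e0)" by (rule openin_coord_inv_image[OF c open_ball B0(1)])
    show "coord_inv c0 a0 \<in> coord_inv c0 ` ball a0 e0" using B0(2) by simp
    show "\<forall>q\<in>coord_inv c0 ` ball a0 e0. lam q = k" using const by (auto simp: in_chart_def)
  qed
  moreover have "a0 \<in> chart_img c0" using B0 centre_in_ball by blast
  then have "coord_inv c0 a0 \<in> M" using coord_inv_in[OF c] chart_dom_subset[OF c] by blast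
  ultimately have "near p" using p unfolding constant_on_def by metis
  then show ?thesis unfolding near_def by blast
qed

text \<open>On a disc \<open>H Im k = b\<close> with \<open>\<lambda> = 1/k\<^sup>2\<close>. The predicate \<open>deg\<close> expresses \<open>b = 0\<close> by quantities that depend neither
  on the chart nor on the sign of \<open>k\<close>, so it is constant on the connected \<open>M\<close>.\<close>
theorem himc:
  assumes hol: "holomorphic_fun A M lam" and ns: "\<not> similar_surfaces M F G" and nm: "\<not> minimal_surface A F"
  shows "himc_surface A F"
proof -
  have disc: "\<exists>e k b. e > 0 \<and> ball a e \<subseteq> chart_img c \<and> k holomorphic_on ball a e \<and>
      (\<forall>z\<in>ball a e. in_chart c lam z * (k z)\<^sup>2 = 1 \<and> mean_curv (in_chart c F) z * Im (k z) = b)"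
    if c: "c \<in> A" and a: "a \<in> chart_img c" for c a
  proof -
    interpret patch_pair "in_chart c F" "in_chart c G" "chart_img c" by (rule pair[OF c])
    obtain e where e: "e > 0" "ball a e \<subseteq> chart_img c" by (rule chart_ball[OF c a])
    have h: "in_chart c lam holomorphic_on ball a e"
      by (rule holomorphic_fun_chart[OF hol c _ e(2)]) (use coord_inv_in[OF c] chart_dom_subset[OF c] e(2) in blast)
    have sub: "z \<in> chart_img c" if "z \<in> ball a e" for z using that e(2) by blast
    show ?thesis
    proof (rule mean_curv_times_Im_constant[OF e(2) h])
      fix k b assume k: "k holomorphic_on ball a e" "\<And>z. z \<in> ball a e \<Longrightarrow> in_chart c lam z * (k z)\<^sup>2 = 1"
        "\<And>z. z \<in> ball a e \<Longrightarrow> mean_curv (in_chart c F) z * Im (k z) = b"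
      have "\<forall>z\<in>ball a e. in_chart c lam z * (k z)\<^sup>2 = 1 \<and> mean_curv (in_chart c F) z * Im (k z) = b"
        by (intro ballI conjI) (erule k)+
      with e k(1) show ?thesis by blast
    qed (rule conf_factor_lam[OF c sub] mean_curv_lam[OF c sub] hopf_lam[OF c sub], assumption)+
  qed
  define H where "H p = mean_curv (in_chart (SOME c. c \<in> A \<and> p \<in> chart_dom c) F) (coord (SOME c. c \<in> A \<and> p \<in> chart_dom c) p)" for p
  have H: "H p = mean_curv (in_chart c F) (coord c p)" if "c \<in> A" "p \<in> chart_dom c" for c p
  proof -
    let ?d = "SOME c. c \<in> A \<and> p \<in> chart_dom c"
    have "?d \<in> A \<and> p \<in> chart_dom ?d" by (rule someI[of _ c]) (use that in blast)
    then show ?thesis unfolding H_def using mean_curv_chart_indep[OF F _ that(1) _ that(2)] by blast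
  qed
  define deg where "deg p \<longleftrightarrow> H p = 0 \<or> Im (lam p) = 0 \<and> Re (lam p) > 0" for p
  have deg: "deg (coord_inv c z) \<longleftrightarrow> mean_curv (in_chart c F) z * Im k = 0"
    if c: "c \<in> A" and z: "z \<in> chart_img c" and k: "in_chart c lam z * k\<^sup>2 = 1" for c z k
    using inverse_square_positive_iff[OF k] H[OF c coord_inv_in[OF c z]] coord_coord_inv[OF c z]
    unfolding deg_def by (auto simp: in_chart_def)
  have "deg constant_on M"
  proof (rule chart_locally_constant)
    fix c p assume c: "c \<in> A" and p: "p \<in> chart_dom c"
    obtain e k b where e: "e > 0" "ball (coord c p) e \<subseteq> chart_img c"
      and k: "\<forall>z\<in>ball (coord c p) e. in_chart c lam z * (k z)\<^sup>2 = 1 \<and> mean_curv (in_chart c F) z * Im (k z) = b"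
      using disc[OF c coord_in[OF p]] by blast
    have *: "deg (coord_inv c z) \<longleftrightarrow> b = 0" if z: "z \<in> ball (coord c p) e" for z
    proof -
      have "z \<in> chart_img c" "in_chart c lam z * (k z)\<^sup>2 = 1" "mean_curv (in_chart c F) z * Im (k z) = b"
        using k z e(2) by blast+
      then show ?thesis using deg[OF c, of z "k z"] by simp
    qed
    have "deg p \<longleftrightarrow> b = 0" using *[of "coord c p"] e(1) coord_inv_coord[OF c p] by simp
    then show "\<exists>e>0. ball (coord c p) e \<subseteq> chart_img c \<and> (\<forall>z\<in>ball (coord c p) e. deg (coord_inv c z) = deg p)"
      using e * by blast
  qed
  then consider "\<forall>p\<in>M. deg p" | "\<forall>p\<in>M. \<not> deg p" unfolding constant_on_def by (metis (full_types))
  then show ?thesis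
  proof cases
    case 1
    obtain c z0 where c: "c \<in> A" and z0: "z0 \<in> chart_img c" "mean_curv (in_chart c F) z0 \<noteq> 0"
      using nm unfolding minimal_surface_def by blast
    interpret patch_pair "in_chart c F" "in_chart c G" "chart_img c" by (rule pair[OF c])
    have "open (chart_img c \<inter> mean_curv (in_chart c F) -` (- {0}))"
      using continuous_open_preimage[OF F.continuous_on_mean_curv] open_chart_img[OF c] by blast
    moreover have "z0 \<in> chart_img c \<inter> mean_curv (in_chart c F) -` (- {0})" using z0 by simp
    ultimately obtain e where e: "e > 0" "ball z0 e \<subseteq> chart_img c \<inter> mean_curv (in_chart c F) -` (- {0})"
      by (meson openE)
    have B: "ball z0 e \<subseteq> chart_img c" using e(2) by blast
    have pos: "Im (in_chart c lam z) = 0 \<and> Re (in_chart c lam z) > 0" if z: "z \<in> ball z0 e" for z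
    proof -
      have zc: "z \<in> chart_img c" "mean_curv (in_chart c F) z \<noteq> 0" using z e(2) by auto
      have "deg (coord_inv c z)" using 1 coord_inv_in[OF c zc(1)] chart_dom_subset[OF c] by blast
      then show ?thesis
        using H[OF c coord_inv_in[OF c zc(1)]] coord_coord_inv[OF c zc(1)] zc(2)
        unfolding deg_def by (simp add: in_chart_def)
    qed
    have z0B: "z0 \<in> ball z0 e" using e(1) by simp
    define r where "r = Re (in_chart c lam z0)"
    have "in_chart c lam z = of_real r" if "z \<in> ball z0 e" for z
      using holomorphic_real_constant[OF hol c B _ that z0B] pos pos[OF z0B]
      by (simp add: r_def complex_eq_iff)
    then have "lam p = of_real r" if "p \<in> M" for p
      using constant_near_imp_constant[OF hol c B e(1) _ that] by blast
    moreover have "r > 0" using pos[OF z0B] by (simp add: r_def)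
    ultimately show ?thesis using positive_constant_imp_similar ns by blast
  next
    case 2
    have "\<exists>T k. open T \<and> z \<in> T \<and> k holomorphic_on T \<and> (\<forall>w\<in>T. 1 / mean_curv (in_chart c F) w = Im (k w))"
      and "mean_curv (in_chart c F) z \<noteq> 0" if c: "c \<in> A" and z: "z \<in> chart_img c" for c z
    proof -
      obtain e k b where e: "e > 0" "ball z e \<subseteq> chart_img c" "k holomorphic_on ball z e"
        and k: "\<forall>w\<in>ball z e. in_chart c lam w * (k w)\<^sup>2 = 1 \<and> mean_curv (in_chart c F) w * Im (k w) = b"
        using disc[OF c z] by blast
      have zB: "z \<in> ball z e" using e(1) by simp
      have "\<not> deg (coord_inv c z)" using 2 coord_inv_in[OF c z] chart_dom_subset[OF c] by blast
      then have b: "b \<noteq> 0" using deg[OF c z, of "k z"] k zB by auto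
      then show "mean_curv (in_chart c F) z \<noteq> 0" using k zB by fastforce
      have "1 / mean_curv (in_chart c F) w = Im (k w / of_real b)" if "w \<in> ball z e" for w
      proof -
        have "mean_curv (in_chart c F) w * Im (k w) = b" using k that by blast
        then show ?thesis using b by (auto simp: field_simps)
      qed
      moreover have "(\<lambda>w. k w / of_real b) holomorphic_on ball z e"
        using e(3) b by (intro holomorphic_intros) auto
      ultimately show "\<exists>T k. open T \<and> z \<in> T \<and> k holomorphic_on T \<and> (\<forall>w\<in>T. 1 / mean_curv (in_chart c F) w = Im (k w))"
        using zB by (intro exI[of _ "ball z e"] exI[of _ "\<lambda>w. k w / of_real b"]) auto
    qed
    then show ?thesis
      unfolding himc_surface_def using F open_chart_img by (auto intro!: harmonic_on_local)
  qed
qed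

end

text \<open>Congruences are similarities, so a member of the family that is not similar to \<open>F\<close> is not congruent to it.\<close>
lemma unimodular_imp_bonnet:
  assumes F: "conformal_immersion A F" and RS: "riemann_surface M A"
    and fam: "one_parameter_family M A F T \<Phi>"
    and def: "\<forall>t\<in>T. deformed_by A F (\<Phi> t) (lam t)"
    and ns: "\<exists>t\<in>T. \<not> similar_surfaces M F (\<Phi> t)"
    and uni: "\<forall>t\<in>T. \<forall>p\<in>M. cmod (lam t p) = 1"
  shows "bonnet_surface M A F"
proof -
  interpret riemann M A by unfold_locales (rule RS)
  have "isometric_to A F (\<Phi> t) \<and> same_mean_curv A F (\<Phi> t)" if t: "t \<in> T" for t
  proof -
    have imm: "conformal_immersion A (\<Phi> t)" using fam t unfolding one_parameter_family_def by blast
    have *: "conf_factor (in_chart c (\<Phi> t)) z = conf_factor (in_chart c F) z \<and>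
        mean_curv (in_chart c (\<Phi> t)) z = mean_curv (in_chart c F) z" if c: "c \<in> A" and z: "z \<in> chart_img c" for c z
    proof -
      have "cmod (in_chart c (lam t) z) = 1"
        using uni t coord_inv_in[OF c z] chart_dom_subset[OF c] by (auto simp: in_chart_def)
      then show ?thesis using def t c z unfolding deformed_by_def by fastforce
    qed
    have "first_form (in_chart c (\<Phi> t)) z v w = first_form (in_chart c F) z v w"
      if "c \<in> A" "z \<in> chart_img c" for c z v w
      using conformal_patch.first_form_eq(1)[OF patch[OF F that(1)] that(2)]
        conformal_patch.first_form_eq(1)[OF patch[OF imm that(1)] that(2)] *[OF that] by simp
    then show ?thesis using * unfolding isometric_to_def same_mean_curv_def by blast
  qed
  moreover have "similar_surfaces M F G'" if "congruent_surfaces M F G'" for G'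
    using that unfolding congruent_surfaces_def similar_surfaces_def
    by (metis scaleR_one zero_less_one)
  ultimately show ?thesis using F fam ns unfolding bonnet_surface_def by blast
qed

theorem theorem2p4:
  fixes M :: "'m::t2_space set" and A :: "'m chart set" and F :: "'m \<Rightarrow> real^3"
  assumes "riemann_surface M A"
    and "conformal_immersion A F"
    and "M \<subseteq> closure (non_umbilic_points A F)"
  shows "(\<forall>G. preserving_deformation A F G \<longrightarrow>
            (\<exists>lam. deformed_by A F G lam \<and>
              (\<forall>V. openin (top_of_set M) V \<and> simply_connected V \<longrightarrow>
                (\<exists>f. holomorphic_fun A V f \<and> (\<forall>p\<in>V. cmod (lam p) = cmod (f p))))))
       \<and> (\<forall>T \<Phi> lam. one_parameter_family M A F T \<Phi> \<and>
            (\<forall>t\<in>T. preserving_deformation A F (\<Phi> t) \<and> deformed_by A F (\<Phi> t) (lam t)) \<and>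
            (\<exists>t\<in>T. \<not> similar_surfaces M F (\<Phi> t)) \<and>
            (\<forall>t\<in>T. \<forall>p\<in>M. cmod (lam t p) = 1)
            \<longrightarrow> bonnet_surface M A F)
       \<and> (\<forall>G lam. preserving_deformation A F G \<and> deformed_by A F G lam \<and>
            \<not> similar_surfaces M F G \<and> \<not> minimal_surface A F \<and>
            holomorphic_fun A M lam
            \<longrightarrow> himc_surface A F)"
proof (intro conjI allI impI)
  fix G assume G: "preserving_deformation A F G"
  interpret preserving_pair M A F G by unfold_locales (use assms G in auto)
  interpret deformed_pair M A F G dilation by unfold_locales (rule deformed_by_dilation[OF assms(3)])
  show "\<exists>lam. deformed_by A F G lam \<and>
              (\<forall>V. openin (top_of_set M) V \<and> simply_connected V \<longrightarrow>
                (\<exists>f. holomorphic_fun A V f \<and> (\<forall>p\<in>V. cmod (lam p) = cmod (f p))))"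
    using lam modulus_global by blast
next
  fix T \<Phi> lam
  assume "one_parameter_family M A F T \<Phi> \<and>
            (\<forall>t\<in>T. preserving_deformation A F (\<Phi> t) \<and> deformed_by A F (\<Phi> t) (lam t)) \<and>
            (\<exists>t\<in>T. \<not> similar_surfaces M F (\<Phi> t)) \<and>
            (\<forall>t\<in>T. \<forall>p\<in>M. cmod (lam t p) = 1)"
  then show "bonnet_surface M A F"
    by (intro unimodular_imp_bonnet[OF assms(2,1)]) auto
next
  fix G lam
  assume *: "preserving_deformation A F G \<and> deformed_by A F G lam \<and>
            \<not> similar_surfaces M F G \<and> \<not> minimal_surface A F \<and> holomorphic_fun A M lam"
  interpret deformed_pair M A F G lam by unfold_locales (use assms * in auto)
  show "himc_surface A F" using himc * by blast
qed

end
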